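(* Let $\Sigma\mathrm{Vect}$ be the full subcategory of $[\mathrm{Vect},\mathrm{Vect}]$ whose objects are the strong $\mathbf{k}$-vector spaces. The following hold. (1) $\Sigma\mathrm{Vect}$ is the largest full subcategory of $[\mathrm{Vect},\mathrm{Vect}]$ that satisfies (A3$^*$) and contains all representables $\mathbb{Y}V$. In particular, for every locally small $\mathbf{k}$-additive category $\mathcal{C}$ with a fully faithful $\mathbf{k}$-additive functor $\iota:\mathrm{Vect}^{\mathrm{op}}\to\mathcal{C}$ satisfying (A1) and (A3) (and hence also (A2)), $\mathcal{C}$ is equivalent to a full subcategory of $\Sigma\mathrm{Vect}$. (2) $\Sigma\mathrm{Vect}$ contains all of the functors $\mathrm{Fin}\,V=V\otimes_{\mathbf{k}}-$ for $V\in\mathrm{Vect}$, and it is the largest full subcategory of $[\mathrm{Vect},\mathrm{Vect}]$ containing all $\mathbb{Y}V$ and all $\mathrm{Fin}\,V$ ($V\in\mathrm{Vect}$) in which, for every small set $I$, the canonical arrow $\delta_I:(\mathbb{Y}\mathbf{k})^{\oplus I}\to\mathrm{Vect}(\mathbf{k}^{\oplus I},-)\cong(\mathbb{Y}\mathbf{k})^I$ is an epimorphism.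
   Context: Fix a field $\mathbf{k}$ and a (non-trivial) Grothendieck universe; sets in it are called small. $\mathrm{Vect}$ is the category of small $\mathbf{k}$-vector spaces and linear maps. $[\mathrm{Vect},\mathrm{Vect}]$ is the category of $\mathbf{k}$-additive functors $\mathrm{Vect}\to\mathrm{Vect}$ (functors acting $\mathbf{k}$-linearly on hom-spaces) and natural transformations. $\mathbb{Y}V:=\mathrm{Vect}(V,-)$. For a small set $I$, $\delta_i:\mathbf{k}^{\oplus I}\to\mathbf{k}$ is the $i$-th coordinate functional and $\sigma:\mathbf{k}^{\oplus I}\to\mathbf{k}$ is the functional with value $1$ on every canonical basis vector. For $X\in[\mathrm{Vect},\mathrm{Vect}]$, a family $(x_i)_{i\in I}\in (X\mathbf{k})^I$ is summable if there is $x\in X(\mathbf{k}^{\oplus I})$ with $X(\delta_i)(x)=x_i$ for all $i\in I$; a sum of the family is any element $X(\sigma)(x)$ for such an $x$. $X$ is $\mathbf{k}$-concrete if for every $V\in\mathrm{Vect}$ and all $f,g:\mathbb{Y}V\to X$, $f=g$ iff their components at $\mathbf{k}$ coincide. $X$ is a strong $\mathbf{k}$-vector space if it is $\mathbf{k}$-concrete and every summable family (indexed by any small set) has a unique sum. A category is $\mathbf{k}$-additive if it is enriched in $\mathbf{k}$-vector spaces and has finite biproducts. For a fully faithful $\mathbf{k}$-additive $\iota:\mathrm{Vect}^{\mathrm{op}}\to\mathcal{C}$: (A1) $\iota$ is dense: every $X\in\mathcal{C}$ is, via the canonical cocone, the colimit of the (possibly large) diagram $(\iota\downarrow X)\to\mathcal{C}$,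 $(f:\iota V\to X)\mapsto\iota V$. (A2) $\iota\mathbf{k}$ is a separator, i.e. $\mathcal{C}(\iota\mathbf{k},-):\mathcal{C}\to\mathrm{Vect}$ is faithful. (A3) For every $V\in \mathrm{Vect}$, every basis $B$ of $V$, and every $X\in\mathcal{C}$, an arrow $f:\iota V\to X$ is uniquely determined by the composites $f\cdot\iota(\delta_b^B):\iota\mathbf{k}\to X$, $b\in B$, where $\delta^B_b:V\to\mathbf{k}$ is the linear functional with $\delta_b^B(b')=1$ if $b=b'$ and $0$ otherwise for $b'\in B$ (regarded as an arrow $\mathbf{k}\to V$ in $\mathrm{Vect}^{\mathrm{op}}$). A full subcategory $\mathcal{C}\subseteq[\mathrm{Vect},\mathrm{Vect}]$ satisfies (A3$^*$) if for every $X\in\mathcal{C}$, every small set $I$ and every $(x_i)_{i\in I}\in(X\mathbf{k})^I$ there is at most one $x\in X(\mathbf{k}^{\oplus I})$ with $X(\delta_i)(x)=x_i$ for all $i\in I$. *)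

theory Defs
  imports "HOL-Algebra.Module"
begin

section \<open>Grothendieck universes\<close>

text \<open>
  A type of this class is a Grothendieck universe: its elements are the small sets, and
  \<open>elts x\<close> is the set of members of \<open>x\<close> (members of small sets are small by typing).
  In \<open>subset_closed\<close> and \<open>family_union\<close> the subset, respectively the family, is an arbitrary one of
  the ambient logic, as it must be for a universe inside an ambient set theory.
  The last axiom excludes the trivial universes (the empty one and that of hereditarily finite sets).
\<close>

class grothendieck_universe =
  fixes elts :: "'a \<Rightarrow> 'a set"
  assumes extensionality: "elts x = elts y \<Longrightarrow> x = y"
    and foundation: "wf {(x, y). x \<in> elts y}"
    and subset_closed: "A \<subseteq> elts x \<Longrightarrow> \<exists>y. elts y = A"
    and pairing: "\<exists>z. elts z = {x, y}"
    and power_set: "\<exists>z. elts z = {y. elts y \<subseteq> elts x}"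
    and family_union: "\<exists>z. elts z = (\<Union>i\<in>elts x. elts (f i))"
    and nontrivial: "\<exists>x. infinite (elts x)"

definition small :: "'u::grothendieck_universe set \<Rightarrow> bool" where
  "small A \<longleftrightarrow> (\<exists>x. elts x = A)"

definition vset :: "'u::grothendieck_universe set \<Rightarrow> 'u" where
  "vset A = (THE x. elts x = A)"

definition vpair :: "'u::grothendieck_universe \<Rightarrow> 'u \<Rightarrow> 'u" where
  "vpair x y = vset {vset {x}, vset {x, y}}"

text \<open>Functions between small sets, as elements of the universe (their graphs).\<close>

definition vfun :: "'u::grothendieck_universe set \<Rightarrow> ('u \<Rightarrow> 'u) \<Rightarrow> 'u" where
  "vfun A f = vset ((\<lambda>x. vpair x (f x)) ` A)"

definition vapp :: "'u::grothendieck_universe \<Rightarrow> 'u \<Rightarrow> 'u" where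
  "vapp g x = (THE y. vpair x y \<in> elts g)"


section \<open>Categories enriched in vector spaces\<close>

definition lin_maps :: "'k ring \<Rightarrow> ('k, 'a) module \<Rightarrow> ('k, 'b) module \<Rightarrow> ('a \<Rightarrow> 'b) set" where
  "lin_maps k V W =
    {f. f \<in> carrier V \<rightarrow> carrier W \<and>
        (\<forall>x\<in>carrier V. \<forall>y\<in>carrier V. f (x \<oplus>\<^bsub>V\<^esub> y) = f x \<oplus>\<^bsub>W\<^esub> f y) \<and>
        (\<forall>c\<in>carrier k. \<forall>x\<in>carrier V. f (c \<odot>\<^bsub>V\<^esub> x) = c \<odot>\<^bsub>W\<^esub> f x)}"

text \<open>
  \<open>Hom C A B\<close> is a vector space whose carrier is the set of arrows from \<open>A\<close> to \<open>B\<close>; its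
  ring fields \<open>mult\<close> and \<open>one\<close> are irrelevant, as for all module records.
  \<open>Comp C A B D g f\<close> is the composite of \<open>f : A \<rightarrow> B\<close> and \<open>g : B \<rightarrow> D\<close>. The objects are
  passed explicitly because different hom-sets need not be disjoint.
\<close>

record ('o, 'k, 'a) lcat =
  Obj :: "'o set"
  Hom :: "'o \<Rightarrow> 'o \<Rightarrow> ('k, 'a) module"
  Idn :: "'o \<Rightarrow> 'a"
  Comp :: "'o \<Rightarrow> 'o \<Rightarrow> 'o \<Rightarrow> 'a \<Rightarrow> 'a \<Rightarrow> 'a"

abbreviation Arr :: "('o, 'k, 'a) lcat \<Rightarrow> 'o \<Rightarrow> 'o \<Rightarrow> 'a set" where
  "Arr C A B \<equiv> carrier (Hom C A B)"

locale k_category =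
  fixes k :: "'k ring" and C :: "('o, 'k, 'a) lcat"
  assumes hom_module: "\<lbrakk>A \<in> Obj C; B \<in> Obj C\<rbrakk> \<Longrightarrow> module k (Hom C A B)"
    and idn_arr: "A \<in> Obj C \<Longrightarrow> Idn C A \<in> Arr C A A"
    and comp_linear_left:
      "\<lbrakk>A \<in> Obj C; B \<in> Obj C; D \<in> Obj C; f \<in> Arr C A B\<rbrakk>
        \<Longrightarrow> (\<lambda>g. Comp C A B D g f) \<in> lin_maps k (Hom C B D) (Hom C A D)"
    and comp_linear_right:
      "\<lbrakk>A \<in> Obj C; B \<in> Obj C; D \<in> Obj C; g \<in> Arr C B D\<rbrakk>
        \<Longrightarrow> (\<lambda>f. Comp C A B D g f) \<in> lin_maps k (Hom C A B) (Hom C A D)"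
    and idn_right: "\<lbrakk>A \<in> Obj C; B \<in> Obj C; f \<in> Arr C A B\<rbrakk> \<Longrightarrow> Comp C A A B f (Idn C A) = f"
    and idn_left: "\<lbrakk>A \<in> Obj C; B \<in> Obj C; f \<in> Arr C A B\<rbrakk> \<Longrightarrow> Comp C A B B (Idn C B) f = f"
    and comp_assoc:
      "\<lbrakk>A \<in> Obj C; B \<in> Obj C; D \<in> Obj C; E \<in> Obj C;
        f \<in> Arr C A B; g \<in> Arr C B D; h \<in> Arr C D E\<rbrakk>
        \<Longrightarrow> Comp C A D E h (Comp C A B D g f) = Comp C A B E (Comp C B D E h g) f"

definition zero_object :: "('o, 'k, 'a) lcat \<Rightarrow> 'o \<Rightarrow> bool" where
  "zero_object C Z \<longleftrightarrow> Z \<in> Obj C \<and> Idn C Z = \<zero>\<^bsub>Hom C Z Z\<^esub>"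

definition biproduct :: "('o, 'k, 'a) lcat \<Rightarrow> 'o \<Rightarrow> 'o \<Rightarrow> 'o \<Rightarrow> bool" where
  "biproduct C A B P \<longleftrightarrow> P \<in> Obj C \<and>
    (\<exists>i1\<in>Arr C A P. \<exists>i2\<in>Arr C B P. \<exists>p1\<in>Arr C P A. \<exists>p2\<in>Arr C P B.
      Comp C A P A p1 i1 = Idn C A \<and>
      Comp C B P B p2 i2 = Idn C B \<and>
      Comp C B P A p1 i2 = \<zero>\<^bsub>Hom C B A\<^esub> \<and>
      Comp C A P B p2 i1 = \<zero>\<^bsub>Hom C A B\<^esub> \<and>
      Comp C P A P i1 p1 \<oplus>\<^bsub>Hom C P P\<^esub> Comp C P B P i2 p2 = Idn C P)"

definition k_additive :: "'k ring \<Rightarrow> ('o, 'k, 'a) lcat \<Rightarrow> bool" where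
  "k_additive k C \<longleftrightarrow> k_category k C \<and> (\<exists>Z. zero_object C Z) \<and>
    (\<forall>A\<in>Obj C. \<forall>B\<in>Obj C. \<exists>P. biproduct C A B P)"

definition locally_small :: "('o, 'k, 'u::grothendieck_universe) lcat \<Rightarrow> bool" where
  "locally_small C \<longleftrightarrow> (\<forall>A\<in>Obj C. \<forall>B\<in>Obj C. small (Arr C A B))"

definition op_cat :: "('o, 'k, 'a) lcat \<Rightarrow> ('o, 'k, 'a) lcat" where
  "op_cat C = \<lparr>Obj = Obj C, Hom = (\<lambda>A B. Hom C B A), Idn = Idn C,
    Comp = (\<lambda>A B D g f. Comp C D B A f g)\<rparr>"

definition full_subcat :: "('o, 'k, 'a) lcat \<Rightarrow> 'o set \<Rightarrow> ('o, 'k, 'a) lcat" where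
  "full_subcat C S = C\<lparr>Obj := S\<rparr>"

record ('o, 'a, 'p, 'b) lfun =
  fob :: "'o \<Rightarrow> 'p"
  far :: "'o \<Rightarrow> 'o \<Rightarrow> 'a \<Rightarrow> 'b"

definition k_functor ::
    "'k ring \<Rightarrow> ('o, 'k, 'a) lcat \<Rightarrow> ('p, 'k, 'b) lcat \<Rightarrow> ('o, 'a, 'p, 'b) lfun \<Rightarrow> bool" where
  "k_functor k C D F \<longleftrightarrow>
    fob F \<in> Obj C \<rightarrow> Obj D \<and>
    (\<forall>A\<in>Obj C. \<forall>B\<in>Obj C.
      far F A B \<in> lin_maps k (Hom C A B) (Hom D (fob F A) (fob F B))) \<and>
    (\<forall>A\<in>Obj C. far F A A (Idn C A) = Idn D (fob F A)) \<and>
    (\<forall>A\<in>Obj C. \<forall>B\<in>Obj C. \<forall>E\<in>Obj C. \<forall>f\<in>Arr C A B. \<forall>g\<in>Arr C B E.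
      far F A E (Comp C A B E g f) =
      Comp D (fob F A) (fob F B) (fob F E) (far F B E g) (far F A B f))"

definition fully_faithful ::
    "('o, 'k, 'a) lcat \<Rightarrow> ('p, 'k, 'b) lcat \<Rightarrow> ('o, 'a, 'p, 'b) lfun \<Rightarrow> bool" where
  "fully_faithful C D F \<longleftrightarrow>
    (\<forall>A\<in>Obj C. \<forall>B\<in>Obj C. bij_betw (far F A B) (Arr C A B) (Arr D (fob F A) (fob F B)))"

definition id_functor :: "('o, 'a, 'o, 'a) lfun" where
  "id_functor = \<lparr>fob = (\<lambda>A. A), far = (\<lambda>A B f. f)\<rparr>"

definition comp_functor ::
    "('p, 'b, 'q, 'c) lfun \<Rightarrow> ('o, 'a, 'p, 'b) lfun \<Rightarrow> ('o, 'a, 'q, 'c) lfun" where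
  "comp_functor G F = \<lparr>fob = (\<lambda>A. fob G (fob F A)),
    far = (\<lambda>A B f. far G (fob F A) (fob F B) (far F A B f))\<rparr>"

text \<open>Extensionality makes equality of natural transformations componentwise equality.\<close>

definition nat_trans ::
    "('o, 'k, 'a) lcat \<Rightarrow> ('p, 'k, 'b) lcat \<Rightarrow> ('o, 'a, 'p, 'b) lfun \<Rightarrow> ('o, 'a, 'p, 'b) lfun
      \<Rightarrow> ('o \<Rightarrow> 'b) set" where
  "nat_trans C D F G =
    {\<eta>. \<eta> \<in> extensional (Obj C) \<and>
        (\<forall>A\<in>Obj C. \<eta> A \<in> Arr D (fob F A) (fob G A)) \<and>
        (\<forall>A\<in>Obj C. \<forall>B\<in>Obj C. \<forall>f\<in>Arr C A B.
          Comp D (fob F A) (fob F B) (fob G B) (\<eta> B) (far F A B f) =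
          Comp D (fob F A) (fob G A) (fob G B) (far G A B f) (\<eta> A))}"

definition iso_arr :: "('o, 'k, 'a) lcat \<Rightarrow> 'o \<Rightarrow> 'o \<Rightarrow> 'a \<Rightarrow> bool" where
  "iso_arr C A B f \<longleftrightarrow> f \<in> Arr C A B \<and>
    (\<exists>g\<in>Arr C B A. Comp C A B A g f = Idn C A \<and> Comp C B A B f g = Idn C B)"

definition naturally_isomorphic ::
    "('o, 'k, 'a) lcat \<Rightarrow> ('p, 'k, 'b) lcat \<Rightarrow> ('o, 'a, 'p, 'b) lfun \<Rightarrow> ('o, 'a, 'p, 'b) lfun
      \<Rightarrow> bool" where
  "naturally_isomorphic C D F G \<longleftrightarrow>
    (\<exists>\<eta>\<in>nat_trans C D F G. \<forall>A\<in>Obj C. iso_arr D (fob F A) (fob G A) (\<eta> A))"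

definition k_equivalent :: "'k ring \<Rightarrow> ('o, 'k, 'a) lcat \<Rightarrow> ('p, 'k, 'b) lcat \<Rightarrow> bool" where
  "k_equivalent k C D \<longleftrightarrow>
    (\<exists>F G. k_functor k C D F \<and> k_functor k D C G \<and>
      naturally_isomorphic C C id_functor (comp_functor G F) \<and>
      naturally_isomorphic D D (comp_functor F G) id_functor)"

definition functor_cat ::
    "'k ring \<Rightarrow> ('o, 'k, 'a) lcat \<Rightarrow> ('p, 'k, 'b) lcat
      \<Rightarrow> (('o, 'a, 'p, 'b) lfun, 'k, 'o \<Rightarrow> 'b) lcat" where
  "functor_cat k C D =
    \<lparr>Obj = {F. k_functor k C D F},
     Hom = (\<lambda>F G.
       \<lparr>carrier = nat_trans C D F G, mult = undefined, one = undefined,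
        zero = (\<lambda>A\<in>Obj C. \<zero>\<^bsub>Hom D (fob F A) (fob G A)\<^esub>),
        add = (\<lambda>\<eta> \<theta>. \<lambda>A\<in>Obj C. \<eta> A \<oplus>\<^bsub>Hom D (fob F A) (fob G A)\<^esub> \<theta> A),
        smult = (\<lambda>c \<eta>. \<lambda>A\<in>Obj C. c \<odot>\<^bsub>Hom D (fob F A) (fob G A)\<^esub> \<eta> A)\<rparr>),
     Idn = (\<lambda>F. \<lambda>A\<in>Obj C. Idn D (fob F A)),
     Comp = (\<lambda>F G H \<theta> \<eta>. \<lambda>A\<in>Obj C. Comp D (fob F A) (fob G A) (fob H A) (\<theta> A) (\<eta> A))\<rparr>"

text \<open>Here \<open>P\<close> is a property of full subcategories, given by their sets of objects.\<close>

definition largest_full_subcat ::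
    "('o, 'k, 'a) lcat \<Rightarrow> ('o set \<Rightarrow> bool) \<Rightarrow> 'o set \<Rightarrow> bool" where
  "largest_full_subcat C P S \<longleftrightarrow>
    S \<subseteq> Obj C \<and> P S \<and> (\<forall>S'. S' \<subseteq> Obj C \<and> P S' \<longrightarrow> S' \<subseteq> S)"

text \<open>
  Right cancellability of \<open>e : A \<rightarrow> B\<close> against the objects of the full subcategory on \<open>S\<close>.
  The objects \<open>A\<close> and \<open>B\<close> need not belong to \<open>S\<close> themselves; it is enough that they are
  isomorphic to objects of \<open>S\<close>.
\<close>

definition epi_in :: "('o, 'k, 'a) lcat \<Rightarrow> 'o set \<Rightarrow> 'o \<Rightarrow> 'o \<Rightarrow> 'a \<Rightarrow> bool" where
  "epi_in C S A B e \<longleftrightarrow> e \<in> Arr C A B \<and>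
    (\<forall>X\<in>S. \<forall>f\<in>Arr C B X. \<forall>g\<in>Arr C B X. Comp C A B X f e = Comp C A B X g e \<longrightarrow> f = g)"


section \<open>Small vector spaces\<close>

type_synonym 'u vs = "('u, 'u) module"
type_synonym 'u vfunctor = "('u vs, 'u, 'u vs, 'u) lfun"
type_synonym 'u vtrans = "'u vs \<Rightarrow> 'u"

definition Vect :: "'u::grothendieck_universe ring \<Rightarrow> ('u vs, 'u, 'u) lcat" where
  "Vect k =
    \<lparr>Obj = {V. module k V \<and> small (carrier V)},
     Hom = (\<lambda>V W.
       \<lparr>carrier = vfun (carrier V) ` lin_maps k V W, mult = undefined, one = undefined,
        zero = vfun (carrier V) (\<lambda>x. \<zero>\<^bsub>W\<^esub>),
        add = (\<lambda>f g. vfun (carrier V) (\<lambda>x. vapp f x \<oplus>\<^bsub>W\<^esub> vapp g x)),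
        smult = (\<lambda>c f. vfun (carrier V) (\<lambda>x. c \<odot>\<^bsub>W\<^esub> vapp f x))\<rparr>),
     Idn = (\<lambda>V. vfun (carrier V) (\<lambda>x. x)),
     Comp = (\<lambda>U V W g f. vfun (carrier U) (\<lambda>x. vapp g (vapp f x)))\<rparr>"

abbreviation FunVect ::
    "'u::grothendieck_universe ring \<Rightarrow> ('u vfunctor, 'u, 'u vtrans) lcat" where
  "FunVect k \<equiv> functor_cat k (Vect k) (Vect k)"

text \<open>The base field as a vector space over itself.\<close>

definition kvs :: "'u ring \<Rightarrow> 'u vs" where
  "kvs k = \<lparr>carrier = carrier k, mult = mult k, one = one k, zero = zero k, add = add k,
    smult = mult k\<rparr>"

definition is_basis :: "'k ring \<Rightarrow> ('k, 'a) module \<Rightarrow> 'a set \<Rightarrow> bool" where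
  "is_basis k V B \<longleftrightarrow> B \<subseteq> carrier V \<and>
    (\<forall>F c. finite F \<and> F \<subseteq> B \<and> c \<in> F \<rightarrow> carrier k \<and> (\<Oplus>\<^bsub>V\<^esub>b\<in>F. c b \<odot>\<^bsub>V\<^esub> b) = \<zero>\<^bsub>V\<^esub>
      \<longrightarrow> (\<forall>b\<in>F. c b = \<zero>\<^bsub>k\<^esub>)) \<and>
    (\<forall>v\<in>carrier V. \<exists>F c. finite F \<and> F \<subseteq> B \<and> c \<in> F \<rightarrow> carrier k \<and>
      v = (\<Oplus>\<^bsub>V\<^esub>b\<in>F. c b \<odot>\<^bsub>V\<^esub> b))"

text \<open>The linear functional on \<open>V\<close> with prescribed values \<open>c\<close> on a basis \<open>B\<close>.\<close>

definition functional_on_basis ::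
    "'u::grothendieck_universe ring \<Rightarrow> 'u vs \<Rightarrow> 'u set \<Rightarrow> ('u \<Rightarrow> 'u) \<Rightarrow> 'u" where
  "functional_on_basis k V B c =
    (THE d. d \<in> Arr (Vect k) V (kvs k) \<and> (\<forall>b\<in>B. vapp d b = c b))"

definition dual_coord :: "'u::grothendieck_universe ring \<Rightarrow> 'u vs \<Rightarrow> 'u set \<Rightarrow> 'u \<Rightarrow> 'u" where
  "dual_coord k V B b = functional_on_basis k V B (\<lambda>b'. if b = b' then \<one>\<^bsub>k\<^esub> else \<zero>\<^bsub>k\<^esub>)"

text \<open>The direct sum of \<open>I\<close> copies of \<open>V\<close>: finitely supported functions from \<open>I\<close> to \<open>V\<close>.\<close>

definition copower_vs :: "'u::grothendieck_universe set \<Rightarrow> 'u vs \<Rightarrow> 'u vs" where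
  "copower_vs I V =
    \<lparr>carrier = vfun I ` {f. f \<in> I \<rightarrow> carrier V \<and> finite {i\<in>I. f i \<noteq> \<zero>\<^bsub>V\<^esub>}},
     mult = undefined, one = undefined,
     zero = vfun I (\<lambda>i. \<zero>\<^bsub>V\<^esub>),
     add = (\<lambda>f g. vfun I (\<lambda>i. vapp f i \<oplus>\<^bsub>V\<^esub> vapp g i)),
     smult = (\<lambda>c f. vfun I (\<lambda>i. c \<odot>\<^bsub>V\<^esub> vapp f i))\<rparr>"

abbreviation free_vs :: "'u::grothendieck_universe ring \<Rightarrow> 'u set \<Rightarrow> 'u vs" where
  "free_vs k I \<equiv> copower_vs I (kvs k)"

definition canonical_vec :: "'u::grothendieck_universe ring \<Rightarrow> 'u set \<Rightarrow> 'u \<Rightarrow> 'u" where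
  "canonical_vec k I i = vfun I (\<lambda>j. if i = j then \<one>\<^bsub>k\<^esub> else \<zero>\<^bsub>k\<^esub>)"

definition coord :: "'u::grothendieck_universe ring \<Rightarrow> 'u set \<Rightarrow> 'u \<Rightarrow> 'u" where
  "coord k I i = vfun (carrier (free_vs k I)) (\<lambda>x. vapp x i)"

definition sum_functional :: "'u::grothendieck_universe ring \<Rightarrow> 'u set \<Rightarrow> 'u" where
  "sum_functional k I =
    functional_on_basis k (free_vs k I) (canonical_vec k I ` I) (\<lambda>b. \<one>\<^bsub>k\<^esub>)"


section \<open>Strong vector spaces\<close>

definition Yo :: "'u::grothendieck_universe ring \<Rightarrow> 'u vs \<Rightarrow> 'u vfunctor" where
  "Yo k V = \<lparr>fob = Hom (Vect k) V,
    far = (\<lambda>W W' f. vfun (Arr (Vect k) V W) (\<lambda>g. Comp (Vect k) V W W' f g))\<rparr>"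

text \<open>The elements \<open>w\<close> of \<open>X (free_vs k I)\<close> with coordinates \<open>x\<close>.\<close>

definition gluings ::
    "'u::grothendieck_universe ring \<Rightarrow> 'u vfunctor \<Rightarrow> 'u set \<Rightarrow> ('u \<Rightarrow> 'u) \<Rightarrow> 'u set" where
  "gluings k X I x = {w\<in>carrier (fob X (free_vs k I)).
    \<forall>i\<in>I. vapp (far X (free_vs k I) (kvs k) (coord k I i)) w = x i}"

definition summable ::
    "'u::grothendieck_universe ring \<Rightarrow> 'u vfunctor \<Rightarrow> 'u set \<Rightarrow> ('u \<Rightarrow> 'u) \<Rightarrow> bool" where
  "summable k X I x \<longleftrightarrow> (\<exists>w. w \<in> gluings k X I x)"

definition is_sum ::
    "'u::grothendieck_universe ring \<Rightarrow> 'u vfunctor \<Rightarrow> 'u set \<Rightarrow> ('u \<Rightarrow> 'u) \<Rightarrow> 'u \<Rightarrow> bool" where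
  "is_sum k X I x s \<longleftrightarrow> (\<exists>w\<in>gluings k X I x.
    s = vapp (far X (free_vs k I) (kvs k) (sum_functional k I)) w)"

definition k_concrete :: "'u::grothendieck_universe ring \<Rightarrow> 'u vfunctor \<Rightarrow> bool" where
  "k_concrete k X \<longleftrightarrow>
    (\<forall>V\<in>Obj (Vect k). \<forall>f\<in>Arr (FunVect k) (Yo k V) X. \<forall>g\<in>Arr (FunVect k) (Yo k V) X.
      f = g \<longleftrightarrow> f (kvs k) = g (kvs k))"

definition strong_vs :: "'u::grothendieck_universe ring \<Rightarrow> 'u vfunctor \<Rightarrow> bool" where
  "strong_vs k X \<longleftrightarrow> X \<in> Obj (FunVect k) \<and> k_concrete k X \<and>
    (\<forall>I x. small I \<and> x \<in> I \<rightarrow> carrier (fob X (kvs k)) \<and> summable k X I x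
      \<longrightarrow> (\<exists>!s. is_sum k X I x s))"

definition SigmaVect :: "'u::grothendieck_universe ring \<Rightarrow> 'u vfunctor set" where
  "SigmaVect k = {X. strong_vs k X}"

definition A3_star :: "'u::grothendieck_universe ring \<Rightarrow> 'u vfunctor set \<Rightarrow> bool" where
  "A3_star k S \<longleftrightarrow>
    (\<forall>X\<in>S. \<forall>I x. small I \<and> x \<in> I \<rightarrow> carrier (fob X (kvs k))
      \<longrightarrow> (\<forall>w\<in>gluings k X I x. \<forall>w'\<in>gluings k X I x. w = w'))"


section \<open>Functors from the opposite of the category of vector spaces\<close>

text \<open>
  A cocone with vertex \<open>Z\<close> on the diagram sending an object \<open>(V, f : \<iota> V \<rightarrow> X)\<close> of the comma
  category to \<open>\<iota> V\<close>. An arrow from \<open>(V, f)\<close> to \<open>(V', f')\<close> of the comma category is an arrow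
  \<open>h : V \<rightarrow> V'\<close> of the opposite category with \<open>f' \<cdot> \<iota> h = f\<close>.
\<close>

definition comma_cocone ::
    "'u::grothendieck_universe ring \<Rightarrow> ('o, 'u, 'a) lcat \<Rightarrow> ('u vs, 'u, 'o, 'a) lfun
      \<Rightarrow> 'o \<Rightarrow> 'o \<Rightarrow> ('u vs \<Rightarrow> 'a \<Rightarrow> 'a) \<Rightarrow> bool" where
  "comma_cocone k C \<iota> X Z c \<longleftrightarrow>
    (\<forall>V\<in>Obj (op_cat (Vect k)). \<forall>f\<in>Arr C (fob \<iota> V) X. c V f \<in> Arr C (fob \<iota> V) Z) \<and>
    (\<forall>V\<in>Obj (op_cat (Vect k)). \<forall>f\<in>Arr C (fob \<iota> V) X.
     \<forall>V'\<in>Obj (op_cat (Vect k)). \<forall>f'\<in>Arr C (fob \<iota> V') X.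
     \<forall>h\<in>Arr (op_cat (Vect k)) V V'.
      Comp C (fob \<iota> V) (fob \<iota> V') X f' (far \<iota> V V' h) = f
      \<longrightarrow> Comp C (fob \<iota> V) (fob \<iota> V') Z (c V' f') (far \<iota> V V' h) = c V f)"

text \<open>Density: the cocone \<open>\<lambda>V f. f\<close> with vertex \<open>X\<close> is a colimit.\<close>

definition A1 ::
    "'u::grothendieck_universe ring \<Rightarrow> ('o, 'u, 'a) lcat \<Rightarrow> ('u vs, 'u, 'o, 'a) lfun \<Rightarrow> bool" where
  "A1 k C \<iota> \<longleftrightarrow>
    (\<forall>X\<in>Obj C. comma_cocone k C \<iota> X X (\<lambda>V f. f) \<and>
      (\<forall>Z\<in>Obj C. \<forall>c. comma_cocone k C \<iota> X Z c \<longrightarrow>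
        (\<exists>!u. u \<in> Arr C X Z \<and>
          (\<forall>V\<in>Obj (op_cat (Vect k)). \<forall>f\<in>Arr C (fob \<iota> V) X. Comp C (fob \<iota> V) X Z u f = c V f))))"

definition A2 ::
    "'u::grothendieck_universe ring \<Rightarrow> ('o, 'u, 'a) lcat \<Rightarrow> ('u vs, 'u, 'o, 'a) lfun \<Rightarrow> bool" where
  "A2 k C \<iota> \<longleftrightarrow>
    (\<forall>X\<in>Obj C. \<forall>Y\<in>Obj C. \<forall>f\<in>Arr C X Y. \<forall>g\<in>Arr C X Y.
      (\<forall>h\<in>Arr C (fob \<iota> (kvs k)) X.
        Comp C (fob \<iota> (kvs k)) X Y f h = Comp C (fob \<iota> (kvs k)) X Y g h) \<longrightarrow> f = g)"

definition A3 ::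
    "'u::grothendieck_universe ring \<Rightarrow> ('o, 'u, 'a) lcat \<Rightarrow> ('u vs, 'u, 'o, 'a) lfun \<Rightarrow> bool" where
  "A3 k C \<iota> \<longleftrightarrow>
    (\<forall>V\<in>Obj (Vect k). \<forall>B. is_basis k V B \<longrightarrow>
      (\<forall>X\<in>Obj C. \<forall>f\<in>Arr C (fob \<iota> V) X. \<forall>g\<in>Arr C (fob \<iota> V) X.
        (\<forall>b\<in>B.
          Comp C (fob \<iota> (kvs k)) (fob \<iota> V) X f (far \<iota> (kvs k) V (dual_coord k V B b)) =
          Comp C (fob \<iota> (kvs k)) (fob \<iota> V) X g (far \<iota> (kvs k) V (dual_coord k V B b)))
        \<longrightarrow> f = g))"


section \<open>Tensor products and copowers of functors\<close>

definition bilin_maps ::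
    "'u ring \<Rightarrow> 'u vs \<Rightarrow> 'u vs \<Rightarrow> 'u vs \<Rightarrow> ('u \<Rightarrow> 'u \<Rightarrow> 'u) set" where
  "bilin_maps k V W T =
    {\<beta>. (\<forall>v\<in>carrier V. (\<lambda>w. \<beta> v w) \<in> lin_maps k W T) \<and>
        (\<forall>w\<in>carrier W. (\<lambda>v. \<beta> v w) \<in> lin_maps k V T)}"

definition is_tensor ::
    "'u::grothendieck_universe ring \<Rightarrow> 'u vs \<Rightarrow> 'u vs \<Rightarrow> 'u vs \<Rightarrow> ('u \<Rightarrow> 'u \<Rightarrow> 'u) \<Rightarrow> bool" where
  "is_tensor k V W T \<beta> \<longleftrightarrow> T \<in> Obj (Vect k) \<and> \<beta> \<in> bilin_maps k V W T \<and>
    (\<forall>U\<in>Obj (Vect k). \<forall>\<gamma>\<in>bilin_maps k V W U.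
      \<exists>!h. h \<in> Arr (Vect k) T U \<and> (\<forall>v\<in>carrier V. \<forall>w\<in>carrier W. vapp h (\<beta> v w) = \<gamma> v w))"

text \<open>A choice of tensor products and of the universal bilinear maps.\<close>

definition tensor_choice ::
    "'u::grothendieck_universe ring \<Rightarrow> 'u vs \<Rightarrow> 'u vs \<Rightarrow> 'u vs \<times> ('u \<Rightarrow> 'u \<Rightarrow> 'u)" where
  "tensor_choice k V W = (SOME (T, \<beta>). is_tensor k V W T \<beta>)"

definition tensor_vs :: "'u::grothendieck_universe ring \<Rightarrow> 'u vs \<Rightarrow> 'u vs \<Rightarrow> 'u vs" where
  "tensor_vs k V W = fst (tensor_choice k V W)"

definition tensor_elt ::
    "'u::grothendieck_universe ring \<Rightarrow> 'u vs \<Rightarrow> 'u vs \<Rightarrow> 'u \<Rightarrow> 'u \<Rightarrow> 'u" where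
  "tensor_elt k V W = snd (tensor_choice k V W)"

definition Fin :: "'u::grothendieck_universe ring \<Rightarrow> 'u vs \<Rightarrow> 'u vfunctor" where
  "Fin k V = \<lparr>fob = tensor_vs k V,
    far = (\<lambda>W W' f. THE h. h \<in> Arr (Vect k) (tensor_vs k V W) (tensor_vs k V W') \<and>
      (\<forall>v\<in>carrier V. \<forall>w\<in>carrier W.
        vapp h (tensor_elt k V W v w) = tensor_elt k V W' v (vapp f w)))\<rparr>"

text \<open>The coproduct of \<open>I\<close> copies of \<open>X\<close> in the functor category, computed objectwise.\<close>

definition copower_functor ::
    "'u::grothendieck_universe set \<Rightarrow> 'u vfunctor \<Rightarrow> 'u vfunctor" where
  "copower_functor I X = \<lparr>fob = (\<lambda>W. copower_vs I (fob X W)),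
    far = (\<lambda>W W' f. vfun (carrier (copower_vs I (fob X W)))
      (\<lambda>x. vfun I (\<lambda>i. vapp (far X W W' f) (vapp x i))))\<rparr>"

text \<open>
  The arrow out of the coproduct whose \<open>i\<close>-th component is precomposition with the \<open>i\<close>-th
  coordinate functional.
\<close>

definition delta_arr :: "'u::grothendieck_universe ring \<Rightarrow> 'u set \<Rightarrow> 'u vtrans" where
  "delta_arr k I = (\<lambda>W\<in>Obj (Vect k).
    vfun (carrier (copower_vs I (Hom (Vect k) (kvs k) W)))
      (\<lambda>x. \<Oplus>\<^bsub>Hom (Vect k) (free_vs k I) W\<^esub>i\<in>{i\<in>I. vapp x i \<noteq> \<zero>\<^bsub>Hom (Vect k) (kvs k) W\<^esub>}.
        Comp (Vect k) (free_vs k I) (kvs k) W (vapp x i) (coord k I i)))"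

definition delta_epi :: "'u::grothendieck_universe ring \<Rightarrow> 'u vfunctor set \<Rightarrow> bool" where
  "delta_epi k S \<longleftrightarrow>
    (\<forall>I. small I \<longrightarrow>
      epi_in (FunVect k) S (copower_functor I (Yo k (kvs k))) (Yo k (free_vs k I)) (delta_arr k I))"

end

(*
A functor X with at most one gluing of every family, that is, with X(k^I) -> (Xk)^I injective for
all small I, is the same thing as a strong vector space.  If X is strong, a functional phi on k^I
is the sum functional after a diagonal endomorphism d of k^I, and X(d) sends two gluings of a family
x to gluings of one family (phi_i x_i); uniqueness of its sum makes X(phi) agree on them, and
k-concreteness identifies them.  Conversely, a basis B of V gives an isomorphism V -> k^B,
so elements of X(V) are separated by coordinate functionals.

By the Yoneda lemma, two arrows out of Y(k^I) agree after delta_I iff the corresponding elements of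
X(k^I) have the same coordinates, so the epimorphism condition is unique gluing again.  For Fin V, a
basis B of V embeds V (x) W naturally into the copower of W indexed by B, where coordinates visibly
separate elements.  For a dense embedding iota, the restricted Yoneda functor X |-> C(iota -, X) is
fully faithful, and (A3) for the canonical basis of k^I is unique gluing for C(iota -, X).
*)

theory Submission
  imports Defs
begin

section \<open>Small sets\<close>

text \<open>Both maximality claims are possible because each of the two conditions tests one functor
  X at a time: a full subcategory satisfies it exactly when every object of it has unique gluing. So
  the functors with unique gluing form the largest such subcategory, and it remains to place
  \<open>Yo\<close> and \<open>Fin\<close> among them. The obstacle in the second half is that the
  tensor product is an arbitrary choice known only through its universal property, which describes
  maps out of it and offers no means to tell two of its elements apart. Bases supply maps into
  spaces whose elements have visible entries. They also explain why a condition that mentions only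
  free spaces controls the values of X at all spaces. Linear maps are encoded by their graphs,
  elements of the universe, so that hom-spaces are again objects of \<open>Vect\<close> and
  equations between arrows can be tested on elements of carriers. Density is used in two halves:
  uniqueness of mediating arrows makes the restricted Yoneda functor faithful, their existence makes
  it full.\<close>

lemma elts_vset [simp]:
  assumes "small A" shows "elts (vset A) = A"
proof -
  obtain x where "elts x = A"
    using assms by (auto simp: small_def)
  then show ?thesis
    unfolding vset_def by (metis (mono_tags, lifting) extensionality theI)
qed

lemma vset_inject: "small A \<Longrightarrow> small B \<Longrightarrow> vset A = vset B \<longleftrightarrow> A = B"
  by (metis elts_vset)

lemma small_subset: "small A \<Longrightarrow> B \<subseteq> A \<Longrightarrow> small B"
  unfolding small_def using subset_closed by blast

lemma small_doubleton [simp]: "small {x, y}"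
  using pairing by (auto simp: small_def)

lemma small_singleton [simp]: "small {x}"
  using small_doubleton[of x x] by simp

text \<open>The axiom \<open>family_union\<close> takes families of elements of the universe,
  whereas F yields sets; replacing each \<open>F i\<close> by \<open>vset (F i)\<close> is harmless
  because \<open>F i\<close> is small for i in A.\<close>

lemma small_UN:
  fixes F :: "'u::grothendieck_universe \<Rightarrow> 'u set"
  assumes "small A" and "\<And>i. i \<in> A \<Longrightarrow> small (F i)"
  shows "small (\<Union>i\<in>A. F i)"
proof -
  obtain x where x: "elts x = A"
    using assms(1) by (auto simp: small_def)
  obtain z where "elts z = (\<Union>i\<in>elts x. elts (vset (F i)))"
    using family_union[of "\<lambda>i. vset (F i)" x] by blast
  then have "elts z = (\<Union>i\<in>A. F i)"
    using assms(2) x by simp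
  then show ?thesis
    by (auto simp: small_def)
qed

lemma small_image [simp]: "small A \<Longrightarrow> small (f ` A)"
  for f :: "'u::grothendieck_universe \<Rightarrow> 'u"
  using small_UN[of A "\<lambda>i. {f i}"] by (simp add: UNION_singleton_eq_range)

lemma small_subsets: "small A \<Longrightarrow> small {y. elts y \<subseteq> A}"
  unfolding small_def using power_set by blast

text \<open>Kuratowski's argument: \<open>vset\<close> is injective on small sets, so the equation
  reduces to one between nested unordered pairs.\<close>

lemma vpair_inject [simp]: "vpair x y = vpair x' y' \<longleftrightarrow> x = x' \<and> y = y'"
  by (auto simp: vpair_def vset_inject doubleton_eq_iff)

lemma vapp_vfun [simp]:
  assumes "small A" and "x \<in> A"
  shows "vapp (vfun A f) x = f x"
  using assms by (auto simp: vapp_def vfun_def)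

lemma vfun_eq_iff: "small A \<Longrightarrow> vfun A f = vfun A g \<longleftrightarrow> (\<forall>x\<in>A. f x = g x)"
  by (metis (no_types, lifting) image_cong vapp_vfun vfun_def)

lemma vfun_eqI: "small A \<Longrightarrow> (\<And>x. x \<in> A \<Longrightarrow> f x = g x) \<Longrightarrow> vfun A f = vfun A g"
  by (simp add: vfun_eq_iff)

lemma vfun_vapp [simp]: "small A \<Longrightarrow> vfun A (vapp (vfun A f)) = vfun A f"
  by (simp add: vfun_eq_iff)

text \<open>Every graph is a subset of the set of pairs \<open>?P\<close>, which is small as a
  double union of singletons, and the power set axiom bounds all graphs at once. This is what makes
  hom-sets and copowers small.\<close>

lemma small_vfuns:
  assumes "small A" "small B" "S \<subseteq> A \<rightarrow> B"
  shows "small (vfun A ` S)"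
proof -
  let ?P = "\<Union>a\<in>A. \<Union>b\<in>B. {vpair a b}"
  have "small ?P"
    using assms by (intro small_UN) auto
  moreover have "vfun A ` S \<subseteq> {y. elts y \<subseteq> ?P}"
    using assms by (auto simp: vfun_def Pi_iff subset_iff)
  ultimately show ?thesis
    using small_subsets small_subset by blast
qed


section \<open>Linear maps and spaces of functions\<close>

lemma lin_mapsI:
  assumes "\<And>x. x \<in> carrier V \<Longrightarrow> f x \<in> carrier W"
    and "\<And>x y. x \<in> carrier V \<Longrightarrow> y \<in> carrier V \<Longrightarrow> f (x \<oplus>\<^bsub>V\<^esub> y) = f x \<oplus>\<^bsub>W\<^esub> f y"
    and "\<And>c x. c \<in> carrier k \<Longrightarrow> x \<in> carrier V \<Longrightarrow> f (c \<odot>\<^bsub>V\<^esub> x) = c \<odot>\<^bsub>W\<^esub> f x"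
  shows "f \<in> lin_maps k V W"
  using assms by (auto simp: lin_maps_def)

lemma lin_maps_closed: "f \<in> lin_maps k V W \<Longrightarrow> x \<in> carrier V \<Longrightarrow> f x \<in> carrier W"
  by (auto simp: lin_maps_def)

lemma lin_maps_add:
  "f \<in> lin_maps k V W \<Longrightarrow> x \<in> carrier V \<Longrightarrow> y \<in> carrier V \<Longrightarrow> f (x \<oplus>\<^bsub>V\<^esub> y) = f x \<oplus>\<^bsub>W\<^esub> f y"
  by (auto simp: lin_maps_def)

lemma lin_maps_smult:
  "f \<in> lin_maps k V W \<Longrightarrow> c \<in> carrier k \<Longrightarrow> x \<in> carrier V \<Longrightarrow> f (c \<odot>\<^bsub>V\<^esub> x) = c \<odot>\<^bsub>W\<^esub> f x"
  by (auto simp: lin_maps_def)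

text \<open>Linearity only concerns values on the carrier, and the carrier of a module is closed
  under the operations. The purpose is to exchange a function for the one read back from its graph,
  which may differ from it off the carrier.\<close>

lemma lin_maps_cong:
  assumes "module k V" "\<And>x. x \<in> carrier V \<Longrightarrow> f x = g x"
  shows "f \<in> lin_maps k V W \<longleftrightarrow> g \<in> lin_maps k V W"
proof -
  interpret module k V by fact
  show ?thesis
    using assms(2) by (auto simp: lin_maps_def Pi_iff)
qed

lemma lin_maps_id: "(\<lambda>x. x) \<in> lin_maps k V V"
  by (auto simp: lin_maps_def)

lemma lin_maps_comp:
  assumes f: "f \<in> lin_maps k U V" and g: "g \<in> lin_maps k V W"
  shows "(\<lambda>x. g (f x)) \<in> lin_maps k U W"
  by (rule lin_mapsI)
    (simp_all add: lin_maps_closed[OF f] lin_maps_closed[OF g] lin_maps_add[OF f] lin_maps_add[OF g]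
      lin_maps_smult[OF f] lin_maps_smult[OF g])

lemma lin_maps_zero:
  assumes "f \<in> lin_maps k V W" "module k V" "module k W"
  shows "f \<zero>\<^bsub>V\<^esub> = \<zero>\<^bsub>W\<^esub>"
proof -
  interpret V: module k V by fact
  interpret W: module k W by fact
  have "f \<zero>\<^bsub>V\<^esub> = f (\<zero>\<^bsub>k\<^esub> \<odot>\<^bsub>V\<^esub> \<zero>\<^bsub>V\<^esub>)"
    by simp
  also have "\<dots> = \<zero>\<^bsub>W\<^esub>"
    using lin_maps_closed[OF assms(1)] by (subst lin_maps_smult[OF assms(1)]) auto
  finally show ?thesis .
qed

lemma lin_maps_const_zero: "module k W \<Longrightarrow> (\<lambda>x. \<zero>\<^bsub>W\<^esub>) \<in> lin_maps k V W"
proof -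
  assume "module k W"
  then interpret W: module k W .
  show ?thesis by (auto simp: lin_maps_def)
qed

lemma lin_maps_plus:
  assumes "f \<in> lin_maps k V W" "g \<in> lin_maps k V W" "module k W"
  shows "(\<lambda>x. f x \<oplus>\<^bsub>W\<^esub> g x) \<in> lin_maps k V W"
proof -
  interpret W: module k W by fact
  show ?thesis
    by (intro lin_mapsI)
      (simp_all add: lin_maps_add[OF assms(1)] lin_maps_add[OF assms(2)] lin_maps_smult[OF assms(1)]
        lin_maps_smult[OF assms(2)] lin_maps_closed[OF assms(1)] lin_maps_closed[OF assms(2)]
        W.a_ac W.smult_r_distr)
qed

lemma lin_maps_scale:
  assumes "f \<in> lin_maps k V W" "c \<in> carrier k" "module k W"
  shows "(\<lambda>x. c \<odot>\<^bsub>W\<^esub> f x) \<in> lin_maps k V W"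
proof -
  interpret W: module k W by fact
  show ?thesis
    using assms(2)
    by (intro lin_mapsI)
      (simp_all add: lin_maps_add[OF assms(1)] lin_maps_smult[OF assms(1)]
        lin_maps_closed[OF assms(1)] W.smult_r_distr W.R.m_comm flip: W.smult_assoc1)
qed

text \<open>\<open>lin_maps\<close> knows sums and scalar multiples but no differences, so x - y is
  formed as x + (-1) y, and negation is traded for the scalar -1 on both sides.\<close>

lemma lin_maps_inj_onI:
  assumes f: "f \<in> lin_maps k V W" and V: "module k V" and W: "module k W"
    and ker: "\<And>x. x \<in> carrier V \<Longrightarrow> f x = \<zero>\<^bsub>W\<^esub> \<Longrightarrow> x = \<zero>\<^bsub>V\<^esub>"
  shows "inj_on f (carrier V)"
proof (rule inj_onI)
  interpret V: module k V by fact
  interpret W: module k W by fact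
  fix x y assume xy: "x \<in> carrier V" "y \<in> carrier V" "f x = f y"
  define z where "z = (\<ominus>\<^bsub>k\<^esub> \<one>\<^bsub>k\<^esub>) \<odot>\<^bsub>V\<^esub> y"
  have zn: "z = \<ominus>\<^bsub>V\<^esub> y"
    using xy by (simp add: z_def V.smult_l_minus)
  have fz: "f z = \<ominus>\<^bsub>W\<^esub> f y"
    using xy by (simp add: z_def lin_maps_smult[OF f] lin_maps_closed[OF f] W.smult_l_minus)
  have "f (x \<oplus>\<^bsub>V\<^esub> z) = \<zero>\<^bsub>W\<^esub>"
    using xy zn fz by (simp add: lin_maps_add[OF f] lin_maps_closed[OF f] W.r_neg)
  then have "x \<oplus>\<^bsub>V\<^esub> \<ominus>\<^bsub>V\<^esub> y = \<zero>\<^bsub>V\<^esub>"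
    using ker[of "x \<oplus>\<^bsub>V\<^esub> z"] xy zn by simp
  then show "x = y"
    using xy V.minus_equality[of x "\<ominus>\<^bsub>V\<^esub> y"] V.minus_minus by simp
qed

lemma lin_maps_finsum:
  assumes f: "f \<in> lin_maps k V W" and V: "module k V" and W: "module k W"
    and "finite F" "g \<in> F \<rightarrow> carrier V"
  shows "f (\<Oplus>\<^bsub>V\<^esub>i\<in>F. g i) = (\<Oplus>\<^bsub>W\<^esub>i\<in>F. f (g i))"
proof -
  interpret V: module k V by fact
  interpret W: module k W by fact
  have c: "(\<lambda>i. f (g i)) \<in> F' \<rightarrow> carrier W" if "g \<in> F' \<rightarrow> carrier V" for F'
    using that by (auto simp: Pi_iff lin_maps_closed[OF f])
  show ?thesis
    using assms(4,5)
  proof (induction F)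
    case empty
    then show ?case by (simp add: lin_maps_zero[OF f V W])
  next
    case (insert i F)
    then have g: "g \<in> F \<rightarrow> carrier V" "g i \<in> carrier V"
      by auto
    have "f (\<Oplus>\<^bsub>V\<^esub>j\<in>insert i F. g j) = f (g i) \<oplus>\<^bsub>W\<^esub> f (\<Oplus>\<^bsub>V\<^esub>j\<in>F. g j)"
      using insert.hyps g by (simp add: lin_maps_add[OF f])
    then show ?case
      using insert.hyps g c[OF g(1)] insert.IH by (simp add: lin_maps_closed[OF f])
  qed
qed

text \<open>Both \<^const>\<open>copower_vs\<close> and the hom-spaces of \<^const>\<open>Vect\<close> are of this form.\<close>

definition fun_vs ::
    "'u::grothendieck_universe set \<Rightarrow> 'u vs \<Rightarrow> ('u \<Rightarrow> 'u) set \<Rightarrow> 'u vs" where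
  "fun_vs A W S =
    \<lparr>carrier = vfun A ` S, mult = undefined, one = undefined,
     zero = vfun A (\<lambda>i. \<zero>\<^bsub>W\<^esub>),
     add = (\<lambda>f g. vfun A (\<lambda>i. vapp f i \<oplus>\<^bsub>W\<^esub> vapp g i)),
     smult = (\<lambda>c f. vfun A (\<lambda>i. c \<odot>\<^bsub>W\<^esub> vapp f i))\<rparr>"

text \<open>The module axioms hold pointwise, by those of W. Additive inverses in S are obtained
  from closure under scalars, as multiples by -1.\<close>

lemma module_fun_vs:
  assumes W: "module k W" and A: "small A" and S: "S \<subseteq> A \<rightarrow> carrier W"
    and zero: "(\<lambda>i. \<zero>\<^bsub>W\<^esub>) \<in> S"
    and add: "\<And>f g. f \<in> S \<Longrightarrow> g \<in> S \<Longrightarrow> (\<lambda>i. f i \<oplus>\<^bsub>W\<^esub> g i) \<in> S"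
    and smult: "\<And>c f. c \<in> carrier k \<Longrightarrow> f \<in> S \<Longrightarrow> (\<lambda>i. c \<odot>\<^bsub>W\<^esub> f i) \<in> S"
  shows "module k (fun_vs A W S)"
proof -
  interpret W: module k W by fact
  let ?M = "fun_vs A W S"
  have car: "f i \<in> carrier W" if "f \<in> S" "i \<in> A" for f i
    using that S by auto
  have eq: "vfun A f = vfun A g" if "\<And>i. i \<in> A \<Longrightarrow> f i = g i" for f g
    using that A by (simp add: vfun_eq_iff)
  have addv: "vfun A f \<oplus>\<^bsub>?M\<^esub> vfun A g = vfun A (\<lambda>i. f i \<oplus>\<^bsub>W\<^esub> g i)" for f g
    using A by (simp add: fun_vs_def vfun_eq_iff)
  have smv: "c \<odot>\<^bsub>?M\<^esub> vfun A f = vfun A (\<lambda>i. c \<odot>\<^bsub>W\<^esub> f i)" for c f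
    using A by (simp add: fun_vs_def vfun_eq_iff)
  have cM: "carrier ?M = vfun A ` S" "\<zero>\<^bsub>?M\<^esub> = vfun A (\<lambda>i. \<zero>\<^bsub>W\<^esub>)"
    by (simp_all add: fun_vs_def)
  have neg: "(\<lambda>i. (\<ominus>\<^bsub>k\<^esub> \<one>\<^bsub>k\<^esub>) \<odot>\<^bsub>W\<^esub> f i) \<in> S" if "f \<in> S" for f
    using smult that by simp
  show ?thesis
  proof (rule moduleI)
    show "cring k" by (rule W.R.cring_axioms)
    show "abelian_group ?M"
    proof (rule abelian_groupI)
      fix x assume "x \<in> carrier ?M"
      then obtain f where f: "f \<in> S" "x = vfun A f" by (auto simp: cM)
      show "\<exists>y\<in>carrier ?M. y \<oplus>\<^bsub>?M\<^esub> x = \<zero>\<^bsub>?M\<^esub>"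
      proof
        show "vfun A (\<lambda>i. (\<ominus>\<^bsub>k\<^esub> \<one>\<^bsub>k\<^esub>) \<odot>\<^bsub>W\<^esub> f i) \<in> carrier ?M"
          using neg f by (auto simp: cM)
        show "vfun A (\<lambda>i. (\<ominus>\<^bsub>k\<^esub> \<one>\<^bsub>k\<^esub>) \<odot>\<^bsub>W\<^esub> f i) \<oplus>\<^bsub>?M\<^esub> x = \<zero>\<^bsub>?M\<^esub>"
          unfolding f(2) addv cM
          using f(1) by (intro eq) (simp add: W.smult_l_minus car W.l_neg)
      qed
    qed (use add zero in \<open>auto simp: cM addv car W.a_ac intro!: eq\<close>)
  qed (use smult in \<open>auto simp: cM addv smv car W.smult_l_distr W.smult_r_distr W.smult_assoc1
      intro!: eq\<close>)
qed

section \<open>Copowers\<close>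

text \<open>Supports vary with the vector; this allows sums over different supports to be compared
  over a common finite superset.\<close>

lemma finsum_supersetI:
  assumes W: "module k W" and "finite F" "S \<subseteq> F" "g \<in> F \<rightarrow> carrier W"
    and "\<And>i. i \<in> F - S \<Longrightarrow> g i = \<zero>\<^bsub>W\<^esub>"
  shows "(\<Oplus>\<^bsub>W\<^esub>i\<in>S. g i) = (\<Oplus>\<^bsub>W\<^esub>i\<in>F. g i)"
proof -
  interpret W: module k W by fact
  show ?thesis
    using assms by (intro W.add.finprod_mono_neutral_cong_left) auto
qed

lemma copower_vs_eq:
  "copower_vs I V = fun_vs I V {f. f \<in> I \<rightarrow> carrier V \<and> finite {i\<in>I. f i \<noteq> \<zero>\<^bsub>V\<^esub>}}"
  by (simp add: copower_vs_def fun_vs_def)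

text \<open>An element of the copower is a graph, and \<open>vapp x\<close> recovers from it the
  finitely supported function, so later arguments never have to choose a representative.\<close>

lemma copower_vs_cases:
  assumes "x \<in> carrier (copower_vs I V)" "small I"
  shows "i \<in> I \<Longrightarrow> vapp x i \<in> carrier V" "finite {i\<in>I. vapp x i \<noteq> \<zero>\<^bsub>V\<^esub>}" "x = vfun I (vapp x)"
proof -
  obtain f where "x = vfun I f" "f \<in> I \<rightarrow> carrier V" "finite {i\<in>I. f i \<noteq> \<zero>\<^bsub>V\<^esub>}"
    using assms(1) by (auto simp: copower_vs_def)
  moreover have "{i\<in>I. vapp (vfun I f) i \<noteq> \<zero>\<^bsub>V\<^esub>} = {i\<in>I. f i \<noteq> \<zero>\<^bsub>V\<^esub>}"
    using assms(2) by auto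
  ultimately show "i \<in> I \<Longrightarrow> vapp x i \<in> carrier V" "finite {i\<in>I. vapp x i \<noteq> \<zero>\<^bsub>V\<^esub>}"
      "x = vfun I (vapp x)"
    using assms(2) by auto
qed

lemma copower_vsI:
  assumes "\<And>i. i \<in> I \<Longrightarrow> f i \<in> carrier V" "finite F" "\<And>i. i \<in> I \<Longrightarrow> i \<notin> F \<Longrightarrow> f i = \<zero>\<^bsub>V\<^esub>"
  shows "vfun I f \<in> carrier (copower_vs I V)"
proof -
  have "{i\<in>I. f i \<noteq> \<zero>\<^bsub>V\<^esub>} \<subseteq> F"
    using assms(3) by auto
  then have "finite {i\<in>I. f i \<noteq> \<zero>\<^bsub>V\<^esub>}"
    using assms(2) finite_subset by blast
  then show ?thesis
    using assms(1) by (auto simp: copower_vs_def)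
qed

lemma copower_vs_eqI:
  assumes "x \<in> carrier (copower_vs I V)" "y \<in> carrier (copower_vs I V)" "small I"
    and "\<And>i. i \<in> I \<Longrightarrow> vapp x i = vapp y i"
  shows "x = y"
  using copower_vs_cases(3)[OF assms(1,3)] copower_vs_cases(3)[OF assms(2,3)] assms(3,4)
  by (metis vfun_eqI)

lemma copower_vs_vapp:
  assumes "small I" "i \<in> I"
  shows "vapp \<zero>\<^bsub>copower_vs I V\<^esub> i = \<zero>\<^bsub>V\<^esub>"
    and "vapp (x \<oplus>\<^bsub>copower_vs I V\<^esub> y) i = vapp x i \<oplus>\<^bsub>V\<^esub> vapp y i"
    and "vapp (c \<odot>\<^bsub>copower_vs I V\<^esub> x) i = c \<odot>\<^bsub>V\<^esub> vapp x i"
  using assms by (simp_all add: copower_vs_def)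

lemma module_copower_vs:
  assumes V: "module k V" and I: "small I"
  shows "module k (copower_vs I V)"
  unfolding copower_vs_eq
proof (rule module_fun_vs[OF V I])
  interpret V: module k V by fact
  fix f g c
  assume f: "f \<in> {f. f \<in> I \<rightarrow> carrier V \<and> finite {i\<in>I. f i \<noteq> \<zero>\<^bsub>V\<^esub>}}"
  {
    assume g: "g \<in> {f. f \<in> I \<rightarrow> carrier V \<and> finite {i\<in>I. f i \<noteq> \<zero>\<^bsub>V\<^esub>}}"
    have "finite {i\<in>I. f i \<oplus>\<^bsub>V\<^esub> g i \<noteq> \<zero>\<^bsub>V\<^esub>}"
      by (rule finite_subset[of _ "{i\<in>I. f i \<noteq> \<zero>\<^bsub>V\<^esub>} \<union> {i\<in>I. g i \<noteq> \<zero>\<^bsub>V\<^esub>}"]) (use f g in auto)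
    then show "(\<lambda>i. f i \<oplus>\<^bsub>V\<^esub> g i) \<in> {f. f \<in> I \<rightarrow> carrier V \<and> finite {i\<in>I. f i \<noteq> \<zero>\<^bsub>V\<^esub>}}"
      using f g by auto
  }
  assume c: "c \<in> carrier k"
  have "finite {i\<in>I. c \<odot>\<^bsub>V\<^esub> f i \<noteq> \<zero>\<^bsub>V\<^esub>}"
    by (rule finite_subset[of _ "{i\<in>I. f i \<noteq> \<zero>\<^bsub>V\<^esub>}"]) (use f c in auto)
  then show "(\<lambda>i. c \<odot>\<^bsub>V\<^esub> f i) \<in> {f. f \<in> I \<rightarrow> carrier V \<and> finite {i\<in>I. f i \<noteq> \<zero>\<^bsub>V\<^esub>}}"
    using f c by auto
next
  interpret V: module k V by fact
  show "(\<lambda>i. \<zero>\<^bsub>V\<^esub>) \<in> {f. f \<in> I \<rightarrow> carrier V \<and> finite {i\<in>I. f i \<noteq> \<zero>\<^bsub>V\<^esub>}}"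
    by auto
qed auto

lemma small_copower_vs:
  "small I \<Longrightarrow> small (carrier V) \<Longrightarrow> small (carrier (copower_vs I V))"
  unfolding copower_vs_def by (simp, rule small_vfuns[where B = "carrier V"]) auto

lemma lin_maps_copower_proj:
  assumes "small I" "i \<in> I"
  shows "(\<lambda>x. vapp x i) \<in> lin_maps k (copower_vs I V) V"
  using assms by (intro lin_mapsI) (simp_all add: copower_vs_vapp copower_vs_cases(1))

text \<open>Each \<open>f i\<close> sends zero to zero, so the support of the image is contained in
  that of x and stays finite.\<close>

lemma lin_maps_copower_map:
  assumes I: "small I" and f: "\<And>i. i \<in> I \<Longrightarrow> f i \<in> lin_maps k V W"
    and V: "module k V" and W: "module k W"
  shows "(\<lambda>x. vfun I (\<lambda>i. f i (vapp x i))) \<in> lin_maps k (copower_vs I V) (copower_vs I W)"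
proof (rule lin_mapsI)
  interpret P: module k "copower_vs I V" by (rule module_copower_vs[OF V I])
  interpret Q: module k "copower_vs I W" by (rule module_copower_vs[OF W I])
  have closed: "vfun I (\<lambda>i. f i (vapp x i)) \<in> carrier (copower_vs I W)"
    if "x \<in> carrier (copower_vs I V)" for x
  proof (rule copower_vsI[OF _ copower_vs_cases(2)[OF that I]])
    show "f i (vapp x i) \<in> carrier W" if "i \<in> I" for i
      using \<open>x \<in> _\<close> that by (intro lin_maps_closed[OF f] copower_vs_cases(1)[OF _ I])
    show "f i (vapp x i) = \<zero>\<^bsub>W\<^esub>" if "i \<in> I" "i \<notin> {i\<in>I. vapp x i \<noteq> \<zero>\<^bsub>V\<^esub>}" for i
      using that lin_maps_zero[OF f V W] by simp
  qed
  then show "x \<in> carrier (copower_vs I V) \<Longrightarrow>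
      vfun I (\<lambda>i. f i (vapp x i)) \<in> carrier (copower_vs I W)" for x .
  show "vfun I (\<lambda>i. f i (vapp (x \<oplus>\<^bsub>copower_vs I V\<^esub> y) i)) =
      vfun I (\<lambda>i. f i (vapp x i)) \<oplus>\<^bsub>copower_vs I W\<^esub> vfun I (\<lambda>i. f i (vapp y i))"
    if "x \<in> carrier (copower_vs I V)" "y \<in> carrier (copower_vs I V)" for x y
  proof (rule copower_vs_eqI[OF _ _ I])
    show "vfun I (\<lambda>i. f i (vapp x i)) \<oplus>\<^bsub>copower_vs I W\<^esub> vfun I (\<lambda>i. f i (vapp y i))
        \<in> carrier (copower_vs I W)"
      using that by (intro Q.a_closed closed)
  qed (use that in \<open>simp_all add: closed copower_vs_vapp[OF I] lin_maps_add[OF f]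
      copower_vs_cases(1)[OF _ I] I\<close>)
  show "vfun I (\<lambda>i. f i (vapp (c \<odot>\<^bsub>copower_vs I V\<^esub> x) i)) =
      c \<odot>\<^bsub>copower_vs I W\<^esub> vfun I (\<lambda>i. f i (vapp x i))"
    if "c \<in> carrier k" "x \<in> carrier (copower_vs I V)" for c x
  proof (rule copower_vs_eqI[OF _ _ I])
    show "c \<odot>\<^bsub>copower_vs I W\<^esub> vfun I (\<lambda>i. f i (vapp x i)) \<in> carrier (copower_vs I W)"
      using that by (intro Q.smult_closed closed)
  qed (use that in \<open>simp_all add: closed copower_vs_vapp[OF I] lin_maps_smult[OF f]
      copower_vs_cases(1)[OF _ I] I\<close>)
qed

section \<open>The copower as a coproduct: injections, induction on the support, copairing\<close>

definition copower_inj :: "'u::grothendieck_universe set \<Rightarrow> 'u vs \<Rightarrow> 'u \<Rightarrow> 'u \<Rightarrow> 'u" where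
  "copower_inj I V i u = vfun I (\<lambda>j. if i = j then u else \<zero>\<^bsub>V\<^esub>)"

lemma vapp_copower_inj:
  "small I \<Longrightarrow> j \<in> I \<Longrightarrow> vapp (copower_inj I V i u) j = (if i = j then u else \<zero>\<^bsub>V\<^esub>)"
  by (simp add: copower_inj_def)

lemma copower_inj_closed:
  assumes "module k V" "u \<in> carrier V"
  shows "copower_inj I V i u \<in> carrier (copower_vs I V)"
proof -
  interpret V: module k V by fact
  show ?thesis
    unfolding copower_inj_def using assms by (intro copower_vsI[where F = "{i}"]) auto
qed

lemma lin_maps_copower_inj:
  assumes V: "module k V" and I: "small I"
  shows "copower_inj I V i \<in> lin_maps k V (copower_vs I V)"
proof -
  interpret V: module k V by fact
  interpret P: module k "copower_vs I V" by (rule module_copower_vs[OF V I])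
  note closed = copower_inj_closed[OF V]
  show ?thesis
  proof (rule lin_mapsI)
    show "copower_inj I V i (x \<oplus>\<^bsub>V\<^esub> y) =
        copower_inj I V i x \<oplus>\<^bsub>copower_vs I V\<^esub> copower_inj I V i y"
      if "x \<in> carrier V" "y \<in> carrier V" for x y
      by (rule copower_vs_eqI[where V = V, OF _ _ I])
        (use that in \<open>simp_all add: closed copower_vs_vapp[OF I] vapp_copower_inj[OF I]\<close>)
    show "copower_inj I V i (c \<odot>\<^bsub>V\<^esub> x) = c \<odot>\<^bsub>copower_vs I V\<^esub> copower_inj I V i x"
      if "c \<in> carrier k" "x \<in> carrier V" for c x
      by (rule copower_vs_eqI[where V = V, OF _ _ I])
        (use that in \<open>simp_all add: closed copower_vs_vapp[OF I] vapp_copower_inj[OF I]\<close>)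
  qed (rule closed)
qed

text \<open>Induction on a finite set F containing the support, for all x supported in F at once:
  deleting the coordinate i from a vector supported in \<open>insert i F\<close> yields another
  vector, supported in F.\<close>

lemma copower_vs_induct:
  assumes V: "module k V" and I: "small I" and x: "x \<in> carrier (copower_vs I V)"
    and zero: "P \<zero>\<^bsub>copower_vs I V\<^esub>"
    and add: "\<And>i u y. i \<in> I \<Longrightarrow> u \<in> carrier V \<Longrightarrow> y \<in> carrier (copower_vs I V) \<Longrightarrow> P y \<Longrightarrow>
      P (copower_inj I V i u \<oplus>\<^bsub>copower_vs I V\<^esub> y)"
  shows "P x"
proof -
  interpret V: module k V by fact
  interpret P: module k "copower_vs I V" by (rule module_copower_vs[OF V I])
  have "\<forall>x\<in>carrier (copower_vs I V). {i\<in>I. vapp x i \<noteq> \<zero>\<^bsub>V\<^esub>} \<subseteq> F \<longrightarrow> P x" if "finite F" "F \<subseteq> I" for F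
    using that
  proof (induction F)
    case empty
    have "x = \<zero>\<^bsub>copower_vs I V\<^esub>"
      if "x \<in> carrier (copower_vs I V)" "{i\<in>I. vapp x i \<noteq> \<zero>\<^bsub>V\<^esub>} = {}" for x
      by (rule copower_vs_eqI[where V = V, OF _ _ I]) (use that in \<open>auto simp: copower_vs_vapp I\<close>)
    then show ?case
      using zero by auto
  next
    case (insert i F)
    show ?case
    proof (intro ballI impI)
      fix x assume x: "x \<in> carrier (copower_vs I V)" "{i\<in>I. vapp x i \<noteq> \<zero>\<^bsub>V\<^esub>} \<subseteq> insert i F"
      define y where "y = vfun I (\<lambda>j. if j = i then \<zero>\<^bsub>V\<^esub> else vapp x j)"
      have y: "y \<in> carrier (copower_vs I V)"
        unfolding y_def using copower_vs_cases(1)[OF x(1) I]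
        by (intro copower_vsI[OF _ copower_vs_cases(2)[OF x(1) I]]) auto
      have "{i\<in>I. vapp y i \<noteq> \<zero>\<^bsub>V\<^esub>} \<subseteq> F"
        using x(2) I by (auto simp: y_def split: if_splits)
      then have "P y"
        using insert y by auto
      have xi: "vapp x i \<in> carrier V"
        using copower_vs_cases(1)[OF x(1) I] insert by auto
      have eq: "x = copower_inj I V i (vapp x i) \<oplus>\<^bsub>copower_vs I V\<^esub> y"
      proof (rule copower_vs_eqI[OF x(1) _ I])
        show "copower_inj I V i (vapp x i) \<oplus>\<^bsub>copower_vs I V\<^esub> y \<in> carrier (copower_vs I V)"
          using y copower_inj_closed[OF V xi] by simp
        show "vapp x j = vapp (copower_inj I V i (vapp x i) \<oplus>\<^bsub>copower_vs I V\<^esub> y) j" if "j \<in> I" for j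
          using that I xi copower_vs_cases(1)[OF x(1) I that]
          by (auto simp: copower_vs_vapp vapp_copower_inj y_def)
      qed
      have "P (copower_inj I V i (vapp x i) \<oplus>\<^bsub>copower_vs I V\<^esub> y)"
        using insert.prems by (intro add xi y \<open>P y\<close>) auto
      then show "P x"
        by (rule iffD2[OF arg_cong[OF eq, of P]])
    qed
  qed
  from this[OF copower_vs_cases(2)[OF x I]] show ?thesis
    using x by auto
qed

text \<open>The uniqueness half of the universal property of the coproduct: vectors supported at one
  index generate the copower under addition.\<close>

lemma lin_maps_copower_eqI:
  assumes V: "module k V" and I: "small I" and W: "module k W"
    and f: "f \<in> lin_maps k (copower_vs I V) W" and g: "g \<in> lin_maps k (copower_vs I V) W"
    and eq: "\<And>i u. i \<in> I \<Longrightarrow> u \<in> carrier V \<Longrightarrow> f (copower_inj I V i u) = g (copower_inj I V i u)"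
    and x: "x \<in> carrier (copower_vs I V)"
  shows "f x = g x"
proof (rule copower_vs_induct[OF V I x])
  note M = module_copower_vs[OF V I]
  show "f \<zero>\<^bsub>copower_vs I V\<^esub> = g \<zero>\<^bsub>copower_vs I V\<^esub>"
    by (simp add: lin_maps_zero[OF f M W] lin_maps_zero[OF g M W])
  show "f (copower_inj I V i u \<oplus>\<^bsub>copower_vs I V\<^esub> y) = g (copower_inj I V i u \<oplus>\<^bsub>copower_vs I V\<^esub> y)"
    if "i \<in> I" "u \<in> carrier V" "y \<in> carrier (copower_vs I V)" "f y = g y" for i u y
    using that copower_inj_closed[OF V that(2)]
    by (simp add: lin_maps_add[OF f] lin_maps_add[OF g] eq)
qed

text \<open>The arrow out of the coproduct with components \<open>a i\<close>. Summing over the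
  support of x makes sense of a possibly infinite family, at the price of an index set that depends
  on x.\<close>

definition copair ::
    "'u::grothendieck_universe set \<Rightarrow> 'u vs \<Rightarrow> 'u vs \<Rightarrow> ('u \<Rightarrow> 'u \<Rightarrow> 'u) \<Rightarrow> 'u \<Rightarrow> 'u" where
  "copair I V W a x = (\<Oplus>\<^bsub>W\<^esub>i\<in>{i\<in>I. vapp x i \<noteq> \<zero>\<^bsub>V\<^esub>}. a i (vapp x i))"

text \<open>The components send zero to zero, so enlarging the index set adds only zero terms. This
  frees the sum from the support of x.\<close>

lemma copair_eq_finsum:
  assumes V: "module k V" and I: "small I" and W: "module k W"
    and a: "\<And>i. i \<in> I \<Longrightarrow> a i \<in> lin_maps k V W"
    and x: "x \<in> carrier (copower_vs I V)"
    and F: "finite F" "F \<subseteq> I" "\<And>i. i \<in> I \<Longrightarrow> i \<notin> F \<Longrightarrow> vapp x i = \<zero>\<^bsub>V\<^esub>"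
  shows "copair I V W a x = (\<Oplus>\<^bsub>W\<^esub>i\<in>F. a i (vapp x i))"
  unfolding copair_def
proof (rule finsum_supersetI[OF W F(1)])
  show "{i \<in> I. vapp x i \<noteq> \<zero>\<^bsub>V\<^esub>} \<subseteq> F"
    using F by auto
  show "(\<lambda>i. a i (vapp x i)) \<in> F \<rightarrow> carrier W"
    using F lin_maps_closed[OF a] copower_vs_cases(1)[OF x I] by auto
  show "i \<in> F - {i \<in> I. vapp x i \<noteq> \<zero>\<^bsub>V\<^esub>} \<Longrightarrow> a i (vapp x i) = \<zero>\<^bsub>W\<^esub>" for i
    using F lin_maps_zero[OF a V W] by auto
qed

lemma lin_maps_copair:
  assumes V: "module k V" and I: "small I" and W: "module k W"
    and a: "\<And>i. i \<in> I \<Longrightarrow> a i \<in> lin_maps k V W"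
  shows "copair I V W a \<in> lin_maps k (copower_vs I V) W"
proof (rule lin_mapsI)
  interpret W: module k W by fact
  interpret V: module k V by fact
  interpret P: module k "copower_vs I V" by (rule module_copower_vs[OF V I])
  note eq = copair_eq_finsum[OF V I W a]
  let ?s = "\<lambda>x. {i\<in>I. vapp x i \<noteq> \<zero>\<^bsub>V\<^esub>}"
  have pi: "(\<lambda>i. a i (vapp x i)) \<in> F \<rightarrow> carrier W" if "x \<in> carrier (copower_vs I V)" "F \<subseteq> I" for x F
    using that lin_maps_closed[OF a] copower_vs_cases(1)[OF _ I] by auto
  show "copair I V W a x \<in> carrier W" if "x \<in> carrier (copower_vs I V)" for x
    unfolding copair_def using pi[OF that, of "?s x"] by simp
  show "copair I V W a (x \<oplus>\<^bsub>copower_vs I V\<^esub> y) = copair I V W a x \<oplus>\<^bsub>W\<^esub> copair I V W a y"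
    if x: "x \<in> carrier (copower_vs I V)" and y: "y \<in> carrier (copower_vs I V)" for x y
  proof -
    \<comment> \<open>The supports of x, y and x + y differ, since cancellation may shrink the last
      one; all three sums are taken over this union.\<close>
    let ?F = "?s x \<union> ?s y"
    have F: "finite ?F" "?F \<subseteq> I"
      using copower_vs_cases(2)[OF _ I] x y by auto
    have "copair I V W a (x \<oplus>\<^bsub>copower_vs I V\<^esub> y) = (\<Oplus>\<^bsub>W\<^esub>i\<in>?F. a i (vapp (x \<oplus>\<^bsub>copower_vs I V\<^esub> y) i))"
      using x y F I by (intro eq) (auto simp: copower_vs_vapp)
    also have "\<dots> = (\<Oplus>\<^bsub>W\<^esub>i\<in>?F. a i (vapp x i) \<oplus>\<^bsub>W\<^esub> a i (vapp y i))"
      using pi[OF x F(2)] pi[OF y F(2)] copower_vs_cases(1)[OF x I] copower_vs_cases(1)[OF y I]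
      by (intro W.finsum_cong') (auto simp: copower_vs_vapp I lin_maps_add[OF a])
    also have "\<dots> = (\<Oplus>\<^bsub>W\<^esub>i\<in>?F. a i (vapp x i)) \<oplus>\<^bsub>W\<^esub> (\<Oplus>\<^bsub>W\<^esub>i\<in>?F. a i (vapp y i))"
      using pi[OF x F(2)] pi[OF y F(2)] by (intro W.finsum_addf)
    also have "(\<Oplus>\<^bsub>W\<^esub>i\<in>?F. a i (vapp x i)) = copair I V W a x"
      using x F by (intro eq[symmetric]) auto
    also have "(\<Oplus>\<^bsub>W\<^esub>i\<in>?F. a i (vapp y i)) = copair I V W a y"
      using y F by (intro eq[symmetric]) auto
    finally show ?thesis .
  qed
  show "copair I V W a (c \<odot>\<^bsub>copower_vs I V\<^esub> x) = c \<odot>\<^bsub>W\<^esub> copair I V W a x"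
    if c: "c \<in> carrier k" and x: "x \<in> carrier (copower_vs I V)" for c x
  proof -
    have F: "finite (?s x)" "?s x \<subseteq> I"
      using copower_vs_cases(2)[OF x I] by auto
    have "copair I V W a (c \<odot>\<^bsub>copower_vs I V\<^esub> x) = (\<Oplus>\<^bsub>W\<^esub>i\<in>?s x. a i (vapp (c \<odot>\<^bsub>copower_vs I V\<^esub> x) i))"
      using c x F I by (intro eq) (auto simp: copower_vs_vapp)
    also have "\<dots> = (\<Oplus>\<^bsub>W\<^esub>i\<in>?s x. c \<odot>\<^bsub>W\<^esub> a i (vapp x i))"
      using pi[OF x F(2)] c copower_vs_cases(1)[OF x I]
      by (intro W.finsum_cong') (auto simp: copower_vs_vapp I lin_maps_smult[OF a])
    also have "\<dots> = c \<odot>\<^bsub>W\<^esub> (\<Oplus>\<^bsub>W\<^esub>i\<in>?s x. a i (vapp x i))"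
      using F pi[OF x F(2)] c by (intro W.finsum_smult_ldistr[symmetric])
    finally show ?thesis
      by (simp add: copair_def)
  qed
qed

lemma copair_inj:
  assumes V: "module k V" and I: "small I" and W: "module k W"
    and a: "\<And>i. i \<in> I \<Longrightarrow> a i \<in> lin_maps k V W"
    and i: "i \<in> I" "u \<in> carrier V"
  shows "copair I V W a (copower_inj I V i u) = a i u"
proof -
  interpret W: module k W by fact
  have "copair I V W a (copower_inj I V i u) = (\<Oplus>\<^bsub>W\<^esub>j\<in>{i}. a j (vapp (copower_inj I V i u) j))"
    using i I copower_inj_closed[OF V i(2)]
    by (intro copair_eq_finsum[OF V I W a]) (auto simp: vapp_copower_inj)
  also have "\<dots> = a i u"
    using i I lin_maps_closed[OF a, of i u] by (simp add: vapp_copower_inj)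
  finally show ?thesis .
qed

section \<open>Bases\<close>

lemma kvs_simps [simp]:
  "carrier (kvs k) = carrier k" "\<zero>\<^bsub>kvs k\<^esub> = \<zero>\<^bsub>k\<^esub>" "x \<oplus>\<^bsub>kvs k\<^esub> y = x \<oplus>\<^bsub>k\<^esub> y" "c \<odot>\<^bsub>kvs k\<^esub> x = c \<otimes>\<^bsub>k\<^esub> x"
  by (simp_all add: kvs_def)

lemma lin_maps_line:
  assumes "module k V" "x \<in> carrier V"
  shows "(\<lambda>c. c \<odot>\<^bsub>V\<^esub> x) \<in> lin_maps k (kvs k) V"
proof -
  interpret V: module k V by fact
  show ?thesis
    using assms(2) by (intro lin_mapsI) (auto simp: V.smult_l_distr V.smult_assoc1)
qed

locale small_field = field k for k :: "'u::grothendieck_universe ring" (structure) +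
  assumes small_carrier: "small (carrier k)"
begin

text \<open>Zorn's lemma gives a maximal independent set B. If v lies outside B, maximality yields a
  nontrivial relation on B together with v, and its coefficient at v can be divided out.\<close>

lemma exists_basis:
  fixes V :: "('u, 'v) module"
  assumes "module k V"
  shows "\<exists>B. is_basis k V B"
proof -
  interpret V: module k V by fact
  define indep where "indep B \<longleftrightarrow> B \<subseteq> carrier V \<and>
    (\<forall>F c. finite F \<and> F \<subseteq> B \<and> c \<in> F \<rightarrow> carrier k \<and> (\<Oplus>\<^bsub>V\<^esub>b\<in>F. c b \<odot>\<^bsub>V\<^esub> b) = \<zero>\<^bsub>V\<^esub>
      \<longrightarrow> (\<forall>b\<in>F. c b = \<zero>))" for B
  have "\<exists>B\<in>{B. indep B}. \<forall>X\<in>{B. indep B}. B \<subseteq> X \<longrightarrow> X = B"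
  proof (rule subset_Zorn_nonempty)
    show "{B. indep B} \<noteq> {}"
      by (auto simp: indep_def intro!: exI[of _ "{}"])
    fix \<C> assume \<C>: "\<C> \<noteq> {}" "subset.chain {B. indep B} \<C>"
    then have ind: "\<And>B. B \<in> \<C> \<Longrightarrow> indep B"
      by (auto simp: subset.chain_def)
    have "\<forall>b\<in>F. c b = \<zero>" if "finite F" "F \<subseteq> \<Union>\<C>" "c \<in> F \<rightarrow> carrier k"
      "(\<Oplus>\<^bsub>V\<^esub>b\<in>F. c b \<odot>\<^bsub>V\<^esub> b) = \<zero>\<^bsub>V\<^esub>" for F c
    proof -
      \<comment> \<open>A linear relation involves finitely many vectors, and a finite subset of the
        union of a chain lies in a single member.\<close>
      obtain B where "B \<in> \<C>" "F \<subseteq> B"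
        using finite_subset_Union_chain[OF \<open>finite F\<close> \<open>F \<subseteq> \<Union>\<C>\<close> \<C>] by blast
      then show ?thesis
        using ind[of B] that unfolding indep_def by blast
    qed
    moreover have "\<Union>\<C> \<subseteq> carrier V"
      using ind by (auto simp: indep_def)
    ultimately show "\<Union>\<C> \<in> {B. indep B}"
      unfolding indep_def by blast
  qed
  then obtain B where B: "indep B" and max: "\<And>X. indep X \<Longrightarrow> B \<subseteq> X \<Longrightarrow> X = B"
    by blast
  have BV: "B \<subseteq> carrier V"
    using B by (simp add: indep_def)
  have span: "\<exists>F c. finite F \<and> F \<subseteq> B \<and> c \<in> F \<rightarrow> carrier k \<and> v = (\<Oplus>\<^bsub>V\<^esub>b\<in>F. c b \<odot>\<^bsub>V\<^esub> b)"
    if v: "v \<in> carrier V" for v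
  proof (cases "v \<in> B")
    case True
    then show ?thesis
      using v by (intro exI[of _ "{v}"] exI[of _ "\<lambda>_. \<one>"]) auto
  next
    case False
    then have "\<not> indep (insert v B)"
      using max by blast
    then obtain F c b where F: "finite F" "F \<subseteq> insert v B" "c \<in> F \<rightarrow> carrier k"
        "(\<Oplus>\<^bsub>V\<^esub>b\<in>F. c b \<odot>\<^bsub>V\<^esub> b) = \<zero>\<^bsub>V\<^esub>" "b \<in> F" "c b \<noteq> \<zero>"
      using v BV unfolding indep_def by blast
    let ?G = "F - {v}"
    let ?s = "\<Oplus>\<^bsub>V\<^esub>b\<in>?G. c b \<odot>\<^bsub>V\<^esub> b"
    have G: "finite ?G" "?G \<subseteq> B" "c \<in> ?G \<rightarrow> carrier k"
      using F by auto
    have cG: "(\<lambda>b. c b \<odot>\<^bsub>V\<^esub> b) \<in> ?G \<rightarrow> carrier V"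
      using G BV by (auto simp: Pi_iff subset_iff)
    then have s: "?s \<in> carrier V"
      by simp
    \<comment> \<open>If the part of the relation away from v vanishes by itself, independence of B
      kills its coefficients. This is used twice: to see that v occurs in F, and that its
      coefficient is nonzero.\<close>
    have indB: "\<forall>b\<in>?G. c b = \<zero>" if "?s = \<zero>\<^bsub>V\<^esub>"
      using B G that unfolding indep_def by blast
    have vF: "v \<in> F"
      using indB F by (metis Diff_empty Diff_insert0)
    have cv: "c v \<in> carrier k"
      using F(3) vF by auto
    have "(\<Oplus>\<^bsub>V\<^esub>b\<in>insert v ?G. c b \<odot>\<^bsub>V\<^esub> b) = c v \<odot>\<^bsub>V\<^esub> v \<oplus>\<^bsub>V\<^esub> ?s"
      using G cG cv v by (intro V.finsum_insert) auto
    then have sum: "c v \<odot>\<^bsub>V\<^esub> v \<oplus>\<^bsub>V\<^esub> ?s = \<zero>\<^bsub>V\<^esub>"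
      using F(4) vF by (simp add: insert_absorb)
    have cv0: "c v \<noteq> \<zero>"
    proof
      assume "c v = \<zero>"
      then have "?s = \<zero>\<^bsub>V\<^esub>"
        using sum v s by simp
      then show False
        using indB F(5,6) \<open>c v = \<zero>\<close> by auto
    qed
    then have inv: "inv c v \<in> carrier k" "inv c v \<otimes> c v = \<one>"
      using cv by (auto simp: field_Units)
    have "c v \<odot>\<^bsub>V\<^esub> v = \<ominus>\<^bsub>V\<^esub> ?s"
      using sum s cv v by (metis V.minus_equality V.smult_closed V.M.minus_minus V.M.a_inv_closed)
    also have "\<dots> = (\<ominus> \<one>) \<odot>\<^bsub>V\<^esub> ?s"
      using s by (simp add: V.smult_l_minus)
    finally have "inv c v \<odot>\<^bsub>V\<^esub> (c v \<odot>\<^bsub>V\<^esub> v) = inv c v \<odot>\<^bsub>V\<^esub> ((\<ominus> \<one>) \<odot>\<^bsub>V\<^esub> ?s)"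
      by simp
    then have "v = (inv c v \<otimes> \<ominus> \<one>) \<odot>\<^bsub>V\<^esub> ?s"
      using inv cv v s by (simp flip: V.smult_assoc1)
    also have "\<dots> = (\<Oplus>\<^bsub>V\<^esub>b\<in>?G. (inv c v \<otimes> \<ominus> \<one>) \<odot>\<^bsub>V\<^esub> (c b \<odot>\<^bsub>V\<^esub> b))"
      using G cG inv by (intro V.finsum_smult_ldistr) auto
    also have "\<dots> = (\<Oplus>\<^bsub>V\<^esub>b\<in>?G. (inv c v \<otimes> \<ominus> \<one> \<otimes> c b) \<odot>\<^bsub>V\<^esub> b)"
      using G cG inv BV by (intro V.finsum_cong') (auto simp: Pi_iff subset_iff V.smult_assoc1)
    finally show ?thesis
      using G inv by (intro exI[of _ ?G] exI[of _ "\<lambda>b. inv c v \<otimes> \<ominus> \<one> \<otimes> c b"]) auto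
  qed
  have "is_basis k V B"
    unfolding is_basis_def
    by (intro conjI ballI span B[unfolded indep_def, THEN conjunct1] B[unfolded indep_def, THEN conjunct2])
  then show ?thesis ..
qed

lemma module_kvs: "module k (kvs k)"
proof (rule moduleI)
  show "abelian_group (kvs k)"
  proof (rule abelian_groupI)
    fix x assume "x \<in> carrier (kvs k)"
    then show "\<exists>y\<in>carrier (kvs k). y \<oplus>\<^bsub>kvs k\<^esub> x = \<zero>\<^bsub>kvs k\<^esub>"
      using l_neg by (intro bexI[of _ "\<ominus> x"]) auto
  qed (simp_all add: a_ac)
qed (auto simp: l_distr r_distr m_assoc intro: cring_axioms)

lemma module_free: "small I \<Longrightarrow> module k (free_vs k I)"
  by (rule module_copower_vs[OF module_kvs])

lemma canonical_vec_eq: "canonical_vec k I i = copower_inj I (kvs k) i \<one>"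
  by (simp add: canonical_vec_def copower_inj_def cong: if_cong)

lemma canonical_vec_closed: "canonical_vec k I i \<in> carrier (free_vs k I)"
  unfolding canonical_vec_eq by (rule copower_inj_closed[OF module_kvs]) simp

lemma vapp_canonical_vec:
  "small I \<Longrightarrow> j \<in> I \<Longrightarrow> vapp (canonical_vec k I i) j = (if i = j then \<one> else \<zero>)"
  by (simp add: canonical_vec_def)

lemma copower_inj_eq_canonical:
  assumes I: "small I" and c: "c \<in> carrier k"
  shows "copower_inj I (kvs k) i c = c \<odot>\<^bsub>free_vs k I\<^esub> canonical_vec k I i"
  unfolding canonical_vec_eq
  using lin_maps_smult[OF lin_maps_copower_inj[OF module_kvs I], of c \<one> i] c by simp

lemma inj_on_canonical_vec: "small I \<Longrightarrow> inj_on (canonical_vec k I) I"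
  by (metis inj_onI one_not_zero vapp_canonical_vec)

text \<open>Independence follows by applying the i-th coordinate to a relation. Spanning comes from
  writing the identity as the copairing of the injections, which at each vector is a finite
  sum.\<close>

lemma is_basis_free:
  assumes I: "small I"
  shows "is_basis k (free_vs k I) (canonical_vec k I ` I)"
  unfolding is_basis_def
proof (intro conjI allI impI ballI)
  interpret M: module k "free_vs k I" by (rule module_free[OF I])
  interpret K: module k "kvs k" by (rule module_kvs)
  let ?e = "canonical_vec k I"
  show "?e ` I \<subseteq> carrier (free_vs k I)"
    using canonical_vec_closed by auto
  show "c b = \<zero>" if A: "finite F \<and> F \<subseteq> ?e ` I \<and> c \<in> F \<rightarrow> carrier k \<and>
      (\<Oplus>\<^bsub>free_vs k I\<^esub>b\<in>F. c b \<odot>\<^bsub>free_vs k I\<^esub> b) = \<zero>\<^bsub>free_vs k I\<^esub>" and b: "b \<in> F" for F c b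
  proof -
    have F: "finite F" "F \<subseteq> ?e ` I" "c \<in> F \<rightarrow> carrier k"
        "(\<Oplus>\<^bsub>free_vs k I\<^esub>b\<in>F. c b \<odot>\<^bsub>free_vs k I\<^esub> b) = \<zero>\<^bsub>free_vs k I\<^esub>"
      using A by auto
    obtain i where i: "i \<in> I" "b = ?e i"
      using b F by auto
    note proj = lin_maps_copower_proj[OF I i(1), where V = "kvs k" and k = k]
    have pi: "(\<lambda>b. c b \<odot>\<^bsub>free_vs k I\<^esub> b) \<in> F \<rightarrow> carrier (free_vs k I)"
      using F canonical_vec_closed by (auto simp: Pi_iff subset_iff image_iff intro!: M.smult_closed)
    have "vapp (\<Oplus>\<^bsub>free_vs k I\<^esub>b\<in>F. c b \<odot>\<^bsub>free_vs k I\<^esub> b) i = (\<Oplus>\<^bsub>kvs k\<^esub>x\<in>F. vapp (c x \<odot>\<^bsub>free_vs k I\<^esub> x) i)"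
      by (rule lin_maps_finsum[OF proj module_free[OF I] module_kvs F(1) pi])
    also have "\<dots> = (\<Oplus>\<^bsub>kvs k\<^esub>x\<in>F. if b = x then c x else \<zero>\<^bsub>kvs k\<^esub>)"
    proof (rule K.finsum_cong')
      show "(\<lambda>x. if b = x then c x else \<zero>\<^bsub>kvs k\<^esub>) \<in> F \<rightarrow> carrier (kvs k)"
        using F(3) by auto
      fix x assume x: "x \<in> F"
      then obtain j where j: "j \<in> I" "x = ?e j"
        using F(2) by auto
      have "c x \<in> carrier k" "b = x \<longleftrightarrow> i = j"
        using x F(3) inj_on_eq_iff[OF inj_on_canonical_vec[OF I]] i j by auto
      then show "vapp (c x \<odot>\<^bsub>free_vs k I\<^esub> x) i = (if b = x then c x else \<zero>\<^bsub>kvs k\<^esub>)"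
        using i j I by (auto simp: copower_vs_vapp vapp_canonical_vec)
    qed simp
    also have "\<dots> = c b"
      using F(1,3) b by (intro K.finsum_singleton) auto
    finally show ?thesis
      using F(4) i I by (simp add: copower_vs_vapp)
  qed
  show "\<exists>F c. finite F \<and> F \<subseteq> ?e ` I \<and> c \<in> F \<rightarrow> carrier k \<and>
      x = (\<Oplus>\<^bsub>free_vs k I\<^esub>b\<in>F. c b \<odot>\<^bsub>free_vs k I\<^esub> b)"
    if x: "x \<in> carrier (free_vs k I)" for x
  proof -
    let ?s = "{i\<in>I. vapp x i \<noteq> \<zero>}"
    \<comment> \<open>Coefficients in \<open>is_basis\<close> are indexed by basis vectors and not
      by I, so the index is recovered from the vector by inverting
      \<open>canonical_vec\<close>.\<close>
    let ?c = "\<lambda>b. vapp x (the_inv_into I ?e b)"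
    have s: "finite ?s"
      using copower_vs_cases(2)[OF x I] by simp
    have inv: "the_inv_into I ?e (?e i) = i" if "i \<in> I" for i
      using that inj_on_canonical_vec[OF I] by (simp add: the_inv_into_f_f)
    have c: "?c \<in> ?e ` ?s \<rightarrow> carrier k"
      using copower_vs_cases(1)[OF x I] by (auto simp: inv)
    have pi: "(\<lambda>b. ?c b \<odot>\<^bsub>free_vs k I\<^esub> b) \<in> ?e ` ?s \<rightarrow> carrier (free_vs k I)"
      using c canonical_vec_closed by (auto simp: Pi_iff intro!: M.smult_closed)
    have "x = copair I (kvs k) (free_vs k I) (copower_inj I (kvs k)) x"
      by (rule lin_maps_copower_eqI[OF module_kvs I module_free[OF I] lin_maps_id
            lin_maps_copair[OF module_kvs I module_free[OF I] lin_maps_copower_inj[OF module_kvs I]] _ x])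
        (simp add: copair_inj[OF module_kvs I module_free[OF I] lin_maps_copower_inj[OF module_kvs I]])
    also have "\<dots> = (\<Oplus>\<^bsub>free_vs k I\<^esub>i\<in>?s. ?c (?e i) \<odot>\<^bsub>free_vs k I\<^esub> ?e i)"
      unfolding copair_def using pi copower_vs_cases(1)[OF x I]
      by (intro M.finsum_cong') (auto simp: inv copower_inj_eq_canonical[OF I] Pi_iff)
    also have "\<dots> = (\<Oplus>\<^bsub>free_vs k I\<^esub>b\<in>?e ` ?s. ?c b \<odot>\<^bsub>free_vs k I\<^esub> b)"
      using pi inj_on_canonical_vec[OF I]
      by (intro M.finsum_reindex[symmetric]) (auto intro: inj_on_subset)
    finally show ?thesis
      using s c by (intro exI[of _ "?e ` ?s"] exI[of _ ?c]) auto
  qed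
qed

section \<open>Linear extension from a basis and the coordinate isomorphism\<close>

lemma is_basisD:
  assumes "is_basis k V B"
  shows "B \<subseteq> carrier V"
    and "finite F \<Longrightarrow> F \<subseteq> B \<Longrightarrow> c \<in> F \<rightarrow> carrier k \<Longrightarrow> (\<Oplus>\<^bsub>V\<^esub>b\<in>F. c b \<odot>\<^bsub>V\<^esub> b) = \<zero>\<^bsub>V\<^esub> \<Longrightarrow>
      b \<in> F \<Longrightarrow> c b = \<zero>"
    and "v \<in> carrier V \<Longrightarrow> \<exists>F c. finite F \<and> F \<subseteq> B \<and> c \<in> F \<rightarrow> carrier k \<and>
      v = (\<Oplus>\<^bsub>V\<^esub>b\<in>F. c b \<odot>\<^bsub>V\<^esub> b)"
proof -
  show "B \<subseteq> carrier V"
    using assms by (simp add: is_basis_def)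
  show "finite F \<Longrightarrow> F \<subseteq> B \<Longrightarrow> c \<in> F \<rightarrow> carrier k \<Longrightarrow> (\<Oplus>\<^bsub>V\<^esub>b\<in>F. c b \<odot>\<^bsub>V\<^esub> b) = \<zero>\<^bsub>V\<^esub> \<Longrightarrow>
      b \<in> F \<Longrightarrow> c b = \<zero>"
    using assms unfolding is_basis_def by blast
  show "v \<in> carrier V \<Longrightarrow> \<exists>F c. finite F \<and> F \<subseteq> B \<and> c \<in> F \<rightarrow> carrier k \<and>
      v = (\<Oplus>\<^bsub>V\<^esub>b\<in>F. c b \<odot>\<^bsub>V\<^esub> b)"
    using assms unfolding is_basis_def by blast
qed

text \<open>Extension by linearity of a map a on B: the linear map out of the free space on B that
  sends the basis vector of b to \<open>a b\<close>. Written as a copairing of lines, it inherits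
  linearity and its values from the coproduct.\<close>

definition lin_comb :: "'u vs \<Rightarrow> 'u set \<Rightarrow> ('u \<Rightarrow> 'u) \<Rightarrow> 'u \<Rightarrow> 'u" where
  "lin_comb V B a = copair B (kvs k) V (\<lambda>b c. c \<odot>\<^bsub>V\<^esub> a b)"

lemma lin_maps_lin_comb:
  assumes "module k V" "small B" "\<And>b. b \<in> B \<Longrightarrow> a b \<in> carrier V"
  shows "lin_comb V B a \<in> lin_maps k (free_vs k B) V"
  unfolding lin_comb_def
  by (rule lin_maps_copair[OF module_kvs assms(2,1) lin_maps_line[OF assms(1) assms(3)]])

lemma lin_comb_canonical:
  assumes "module k V" "small B" "\<And>b. b \<in> B \<Longrightarrow> a b \<in> carrier V" "b \<in> B"
  shows "lin_comb V B a (canonical_vec k B b) = a b"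
proof -
  interpret V: module k V by fact
  show ?thesis
    unfolding canonical_vec_eq lin_comb_def
    using copair_inj[where u = \<one>, OF module_kvs assms(2,1) lin_maps_line[OF assms(1) assms(3)] assms(4)]
      assms by simp
qed

text \<open>Injectivity is the independence of B and surjectivity its spanning property, read off
  from the sum to which \<open>lin_comb\<close> unfolds.\<close>

lemma lin_comb_bij:
  assumes V: "module k V" and B: "is_basis k V B" "small B"
  shows "bij_betw (lin_comb V B (\<lambda>b. b)) (carrier (free_vs k B)) (carrier V)"
proof -
  interpret V: module k V by fact
  have line: "\<And>b. b \<in> B \<Longrightarrow> (\<lambda>c. c \<odot>\<^bsub>V\<^esub> b) \<in> lin_maps k (kvs k) V"
    using is_basisD(1)[OF B(1)] by (auto intro: lin_maps_line[OF V])
  have lin: "lin_comb V B (\<lambda>b. b) \<in> lin_maps k (free_vs k B) V"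
    by (rule lin_maps_lin_comb) (use V B(2) is_basisD(1)[OF B(1)] in auto)
  have "inj_on (lin_comb V B (\<lambda>b. b)) (carrier (free_vs k B))"
  proof (rule lin_maps_inj_onI[OF lin module_free[OF B(2)] V])
    fix x assume x: "x \<in> carrier (free_vs k B)" and "lin_comb V B (\<lambda>b. b) x = \<zero>\<^bsub>V\<^esub>"
    then have "(\<Oplus>\<^bsub>V\<^esub>b\<in>{b\<in>B. vapp x b \<noteq> \<zero>}. vapp x b \<odot>\<^bsub>V\<^esub> b) = \<zero>\<^bsub>V\<^esub>"
      by (simp add: lin_comb_def copair_def)
    then have "\<And>b. b \<in> {b\<in>B. vapp x b \<noteq> \<zero>} \<Longrightarrow> vapp x b = \<zero>"
      using copower_vs_cases(1,2)[OF x B(2)]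
      by (intro is_basisD(2)[OF B(1)]) auto
    then have "vapp x b = \<zero>" if "b \<in> B" for b
      using that by blast
    then show "x = \<zero>\<^bsub>free_vs k B\<^esub>"
      using module_free[OF B(2)] x
      by (intro copower_vs_eqI[OF x _ B(2)]) (auto simp: copower_vs_vapp B(2) module_def abelian_group_def abelian_monoid.zero_closed)
  qed
  moreover have "lin_comb V B (\<lambda>b. b) ` carrier (free_vs k B) = carrier V"
  proof
    show "lin_comb V B (\<lambda>b. b) ` carrier (free_vs k B) \<subseteq> carrier V"
      using lin_maps_closed[OF lin] by auto
    show "carrier V \<subseteq> lin_comb V B (\<lambda>b. b) ` carrier (free_vs k B)"
    proof
      fix v assume "v \<in> carrier V"
      then obtain F c where F: "finite F" "F \<subseteq> B" "c \<in> F \<rightarrow> carrier k" "v = (\<Oplus>\<^bsub>V\<^esub>b\<in>F. c b \<odot>\<^bsub>V\<^esub> b)"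
        using is_basisD(3)[OF B(1)] by blast
      \<comment> \<open>The coefficients on F, extended by zero to all of B, form a vector of the
        free space.\<close>
      define x where "x = vfun B (\<lambda>b. if b \<in> F then c b else \<zero>)"
      have x: "x \<in> carrier (free_vs k B)"
        unfolding x_def by (intro copower_vsI[where F = F]) (use F in auto)
      have pi: "(\<lambda>b. c b \<odot>\<^bsub>V\<^esub> b) \<in> F \<rightarrow> carrier V"
        using F is_basisD(1)[OF B(1)] by (auto simp: Pi_iff subset_iff)
      have "lin_comb V B (\<lambda>b. b) x = (\<Oplus>\<^bsub>V\<^esub>b\<in>F. vapp x b \<odot>\<^bsub>V\<^esub> b)"
        unfolding lin_comb_def
        by (rule copair_eq_finsum[OF module_kvs B(2) V line x F(1,2)]) (use B(2) in \<open>auto simp: x_def\<close>)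
      also have "\<dots> = v"
        unfolding F(4) using pi F(2) B(2) by (intro V.finsum_cong') (auto simp: x_def)
      finally show "v \<in> lin_comb V B (\<lambda>b. b) ` carrier (free_vs k B)"
        using x by blast
    qed
  qed
  ultimately show ?thesis
    by (simp add: bij_betw_def)
qed

text \<open>Coordinates are the inverse of a bijection, with no choice of coefficients, and their
  linearity is inherited from \<open>lin_comb\<close>.\<close>

definition basis_coords :: "'u vs \<Rightarrow> 'u set \<Rightarrow> 'u \<Rightarrow> 'u" where
  "basis_coords V B = the_inv_into (carrier (free_vs k B)) (lin_comb V B (\<lambda>b. b))"

lemma basis_coords_props:
  assumes V: "module k V" and B: "is_basis k V B" "small B"
  shows lin_maps_basis_coords: "basis_coords V B \<in> lin_maps k V (free_vs k B)"
    and lin_comb_basis_coords: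
      "v \<in> carrier V \<Longrightarrow> lin_comb V B (\<lambda>b. b) (basis_coords V B v) = v"
    and basis_coords_lin_comb:
      "x \<in> carrier (free_vs k B) \<Longrightarrow> basis_coords V B (lin_comb V B (\<lambda>b. b) x) = x"
proof -
  interpret V: module k V by fact
  interpret M: module k "free_vs k B" by (rule module_free[OF B(2)])
  note bij = lin_comb_bij[OF assms]
  let ?l = "lin_comb V B (\<lambda>b. b)"
  have lin: "?l \<in> lin_maps k (free_vs k B) V"
    by (rule lin_maps_lin_comb) (use V B(2) is_basisD(1)[OF B(1)] in auto)
  show 1: "v \<in> carrier V \<Longrightarrow> ?l (basis_coords V B v) = v" for v
    using bij unfolding basis_coords_def bij_betw_def by (simp add: f_the_inv_into_f)
  show 2: "x \<in> carrier (free_vs k B) \<Longrightarrow> basis_coords V B (?l x) = x" for x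
    using bij unfolding basis_coords_def bij_betw_def by (simp add: the_inv_into_f_f)
  have closed: "basis_coords V B v \<in> carrier (free_vs k B)" if "v \<in> carrier V" for v
    using bij that unfolding basis_coords_def bij_betw_def
    by (metis order_refl the_inv_into_into)
  show "basis_coords V B \<in> lin_maps k V (free_vs k B)"
  proof (rule lin_mapsI)
    show "basis_coords V B (x \<oplus>\<^bsub>V\<^esub> y) = basis_coords V B x \<oplus>\<^bsub>free_vs k B\<^esub> basis_coords V B y"
      if "x \<in> carrier V" "y \<in> carrier V" for x y
      using that lin_maps_add[OF lin closed closed, of x y] 2[OF M.a_closed[OF closed closed], of x y]
      by (simp add: 1)
    show "basis_coords V B (c \<odot>\<^bsub>V\<^esub> x) = c \<odot>\<^bsub>free_vs k B\<^esub> basis_coords V B x"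
      if "c \<in> carrier k" "x \<in> carrier V" for c x
      using that lin_maps_smult[OF lin _ closed, of c x] 2[OF M.smult_closed[OF _ closed], of c x]
      by (simp add: 1)
  qed (rule closed)
qed

lemma basis_coords_basis:
  assumes V: "module k V" and B: "is_basis k V B" "small B" and b: "b \<in> B"
  shows "basis_coords V B b = canonical_vec k B b"
  using basis_coords_lin_comb[OF assms(1-3) canonical_vec_closed] lin_comb_canonical[OF V B(2) _ b]
    is_basisD(1)[OF B(1)] by (metis subsetD)

lemma lin_maps_basis_eqI:
  assumes V: "module k V" and W: "module k W" and B: "is_basis k V B"
    and f: "f \<in> lin_maps k V W" and g: "g \<in> lin_maps k V W"
    and eq: "\<And>b. b \<in> B \<Longrightarrow> f b = g b" and v: "v \<in> carrier V"
  shows "f v = g v"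
proof -
  interpret V: module k V by fact
  interpret W: module k W by fact
  obtain F c where F: "finite F" "F \<subseteq> B" "c \<in> F \<rightarrow> carrier k" "v = (\<Oplus>\<^bsub>V\<^esub>b\<in>F. c b \<odot>\<^bsub>V\<^esub> b)"
    using is_basisD(3)[OF B v] by blast
  have FB: "c b \<in> carrier k" "b \<in> carrier V" "b \<in> B" if "b \<in> F" for b
    using that F is_basisD(1)[OF B] by auto
  have pi: "(\<lambda>b. c b \<odot>\<^bsub>V\<^esub> b) \<in> F \<rightarrow> carrier V"
    using FB by auto
  have "f v = (\<Oplus>\<^bsub>W\<^esub>b\<in>F. f (c b \<odot>\<^bsub>V\<^esub> b))"
    unfolding F(4) by (rule lin_maps_finsum[OF f V W F(1) pi])
  also have "\<dots> = (\<Oplus>\<^bsub>W\<^esub>b\<in>F. g (c b \<odot>\<^bsub>V\<^esub> b))"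
    using FB by (intro W.finsum_cong')
      (auto simp: lin_maps_smult[OF f] lin_maps_smult[OF g] eq lin_maps_closed[OF g])
  also have "\<dots> = g v"
    unfolding F(4) by (rule lin_maps_finsum[OF g V W F(1) pi, symmetric])
  finally show ?thesis .
qed

end

section \<open>The category of small vector spaces\<close>

lemma Obj_Vect: "V \<in> Obj (Vect k) \<longleftrightarrow> module k V \<and> small (carrier V)"
  by (simp add: Vect_def)

lemma Hom_Vect: "Hom (Vect k) V W = fun_vs (carrier V) W (lin_maps k V W)"
  by (simp add: Vect_def fun_vs_def)

lemma Arr_VectI: "f \<in> lin_maps k V W \<Longrightarrow> vfun (carrier V) f \<in> Arr (Vect k) V W"
  by (simp add: Hom_Vect fun_vs_def)

lemma lin_maps_Arr_Vect:
  assumes "f \<in> Arr (Vect k) V W" "V \<in> Obj (Vect k)"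
  shows "vapp f \<in> lin_maps k V W"
proof -
  obtain g where "f = vfun (carrier V) g" "g \<in> lin_maps k V W"
    using assms(1) by (auto simp: Hom_Vect fun_vs_def)
  then show ?thesis
    using assms(2) lin_maps_cong[of k V "vapp f" g W] by (simp add: Obj_Vect)
qed

lemma vfun_Arr_Vect:
  assumes "f \<in> Arr (Vect k) V W" "V \<in> Obj (Vect k)"
  shows "vfun (carrier V) (vapp f) = f"
  using assms by (auto simp: Hom_Vect fun_vs_def Obj_Vect)

lemma Arr_Vect_closed:
  "f \<in> Arr (Vect k) V W \<Longrightarrow> V \<in> Obj (Vect k) \<Longrightarrow> x \<in> carrier V \<Longrightarrow> vapp f x \<in> carrier W"
  using lin_maps_closed[OF lin_maps_Arr_Vect] by blast

text \<open>A graph records nothing outside the carrier, so arrows are equal as soon as they agree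
  on elements. Equations between composites are reduced to this throughout.\<close>

lemma Arr_Vect_eqI:
  assumes "f \<in> Arr (Vect k) V W" "g \<in> Arr (Vect k) V W" "V \<in> Obj (Vect k)"
    and "\<And>x. x \<in> carrier V \<Longrightarrow> vapp f x = vapp g x"
  shows "f = g"
  using assms vfun_Arr_Vect[OF assms(1,3)] vfun_Arr_Vect[OF assms(2,3)]
  by (metis Obj_Vect vfun_eqI)

lemma vapp_Comp_Vect:
  "U \<in> Obj (Vect k) \<Longrightarrow> x \<in> carrier U \<Longrightarrow> vapp (Comp (Vect k) U V W g f) x = vapp g (vapp f x)"
  by (simp add: Vect_def)

lemma Comp_Vect_closed:
  assumes "f \<in> Arr (Vect k) U V" "g \<in> Arr (Vect k) V W" "U \<in> Obj (Vect k)" "V \<in> Obj (Vect k)"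
  shows "Comp (Vect k) U V W g f \<in> Arr (Vect k) U W"
  using Arr_VectI[OF lin_maps_comp[OF lin_maps_Arr_Vect lin_maps_Arr_Vect], OF assms(1,3,2,4)]
  by (simp add: Vect_def)

lemma Idn_Vect_closed: "Idn (Vect k) V \<in> Arr (Vect k) V V"
  using Arr_VectI[OF lin_maps_id] by (simp add: Vect_def)

lemma vapp_Idn_Vect: "V \<in> Obj (Vect k) \<Longrightarrow> x \<in> carrier V \<Longrightarrow> vapp (Idn (Vect k) V) x = x"
  by (simp add: Vect_def)

lemma Comp_Idn_Vect:
  assumes "f \<in> Arr (Vect k) V W" "V \<in> Obj (Vect k)" "W \<in> Obj (Vect k)"
  shows "Comp (Vect k) V V W f (Idn (Vect k) V) = f" "Comp (Vect k) V W W (Idn (Vect k) W) f = f"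
  using assms
  by (auto intro!: Arr_Vect_eqI[OF Comp_Vect_closed _ assms(2)] Idn_Vect_closed
      simp: vapp_Comp_Vect vapp_Idn_Vect Arr_Vect_closed)

lemma Comp_Vect_assoc:
  assumes "f \<in> Arr (Vect k) U V" "U \<in> Obj (Vect k)" "V \<in> Obj (Vect k)"
  shows "Comp (Vect k) U W Z h (Comp (Vect k) U V W g f) = Comp (Vect k) U V Z (Comp (Vect k) V W Z h g) f"
  using assms Arr_Vect_closed[OF assms(1,2)]
  by (auto simp: Vect_def vfun_eq_iff)

lemma vapp_Hom_Vect:
  assumes "V \<in> Obj (Vect k)" "x \<in> carrier V"
  shows "vapp (f \<oplus>\<^bsub>Hom (Vect k) V W\<^esub> g) x = vapp f x \<oplus>\<^bsub>W\<^esub> vapp g x"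
    and "vapp (c \<odot>\<^bsub>Hom (Vect k) V W\<^esub> f) x = c \<odot>\<^bsub>W\<^esub> vapp f x"
    and "vapp \<zero>\<^bsub>Hom (Vect k) V W\<^esub> x = \<zero>\<^bsub>W\<^esub>"
  using assms by (simp_all add: Vect_def)

lemma module_Hom_Vect:
  assumes "V \<in> Obj (Vect k)" "W \<in> Obj (Vect k)"
  shows "module k (Hom (Vect k) V W)"
  unfolding Hom_Vect
proof (rule module_fun_vs)
  show "module k W" "small (carrier V)"
    using assms by (simp_all add: Obj_Vect)
  then show "(\<lambda>i. \<zero>\<^bsub>W\<^esub>) \<in> lin_maps k V W"
      "f \<in> lin_maps k V W \<Longrightarrow> g \<in> lin_maps k V W \<Longrightarrow> (\<lambda>i. f i \<oplus>\<^bsub>W\<^esub> g i) \<in> lin_maps k V W"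
      "c \<in> carrier k \<Longrightarrow> f \<in> lin_maps k V W \<Longrightarrow> (\<lambda>i. c \<odot>\<^bsub>W\<^esub> f i) \<in> lin_maps k V W" for f g c
    by (simp_all add: lin_maps_const_zero lin_maps_plus lin_maps_scale)
qed (auto simp: lin_maps_def)

text \<open>Linear maps are graphs between small sets and hence form a small set, so the hom-space
  is itself a small vector space. This lets representable functors take values in
  \<open>Vect\<close>.\<close>

lemma Hom_Vect_Obj:
  assumes "V \<in> Obj (Vect k)" "W \<in> Obj (Vect k)"
  shows "Hom (Vect k) V W \<in> Obj (Vect k)"
proof -
  have "small (Arr (Vect k) V W)"
    unfolding Vect_def
    by (simp, rule small_vfuns[where B = "carrier W"]) (use assms in \<open>auto simp: Obj_Vect lin_maps_def\<close>)
  then show ?thesis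
    using module_Hom_Vect[OF assms] by (simp add: Obj_Vect)
qed

lemma lin_maps_eval:
  assumes "V \<in> Obj (Vect k)" "x \<in> carrier V"
  shows "(\<lambda>f. vapp f x) \<in> lin_maps k (Hom (Vect k) V W) W"
  by (rule lin_mapsI) (simp_all add: vapp_Hom_Vect assms Arr_Vect_closed)

lemma lin_maps_post_Comp:
  assumes "g \<in> Arr (Vect k) V W" "U \<in> Obj (Vect k)" "V \<in> Obj (Vect k)" "W \<in> Obj (Vect k)"
  shows "Comp (Vect k) U V W g \<in> lin_maps k (Hom (Vect k) U V) (Hom (Vect k) U W)"
proof -
  note C = Comp_Vect_closed[OF _ assms(1-3)]
  interpret UV: module k "Hom (Vect k) U V" by (rule module_Hom_Vect) (use assms in auto)
  interpret UW: module k "Hom (Vect k) U W" by (rule module_Hom_Vect) (use assms in auto)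
  show ?thesis
  proof (rule lin_mapsI)
    show "Comp (Vect k) U V W g (x \<oplus>\<^bsub>Hom (Vect k) U V\<^esub> y) =
        Comp (Vect k) U V W g x \<oplus>\<^bsub>Hom (Vect k) U W\<^esub> Comp (Vect k) U V W g y"
      if "x \<in> Arr (Vect k) U V" "y \<in> Arr (Vect k) U V" for x y
      by (rule Arr_Vect_eqI[OF C UW.a_closed[OF C C] assms(2)])
        (use that assms in \<open>simp_all add: vapp_Comp_Vect vapp_Hom_Vect Arr_Vect_closed
          lin_maps_add[OF lin_maps_Arr_Vect[OF assms(1)]]\<close>)
    show "Comp (Vect k) U V W g (c \<odot>\<^bsub>Hom (Vect k) U V\<^esub> x) =
        c \<odot>\<^bsub>Hom (Vect k) U W\<^esub> Comp (Vect k) U V W g x"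
      if "c \<in> carrier k" "x \<in> Arr (Vect k) U V" for x c
      by (rule Arr_Vect_eqI[OF C UW.smult_closed[OF _ C] assms(2)])
        (use that assms in \<open>simp_all add: vapp_Comp_Vect vapp_Hom_Vect Arr_Vect_closed
          lin_maps_smult[OF lin_maps_Arr_Vect[OF assms(1)]]\<close>)
  qed (rule C)
qed

lemma lin_maps_pre_Comp:
  assumes "f \<in> Arr (Vect k) U V" "U \<in> Obj (Vect k)" "V \<in> Obj (Vect k)" "W \<in> Obj (Vect k)"
  shows "(\<lambda>g. Comp (Vect k) U V W g f) \<in> lin_maps k (Hom (Vect k) V W) (Hom (Vect k) U W)"
proof -
  note C = Comp_Vect_closed[OF assms(1) _ assms(2,3)]
  interpret VW: module k "Hom (Vect k) V W" by (rule module_Hom_Vect) (use assms in auto)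
  interpret UW: module k "Hom (Vect k) U W" by (rule module_Hom_Vect) (use assms in auto)
  show ?thesis
  proof (rule lin_mapsI)
    show "Comp (Vect k) U V W (x \<oplus>\<^bsub>Hom (Vect k) V W\<^esub> y) f =
        Comp (Vect k) U V W x f \<oplus>\<^bsub>Hom (Vect k) U W\<^esub> Comp (Vect k) U V W y f"
      if "x \<in> Arr (Vect k) V W" "y \<in> Arr (Vect k) V W" for x y
      by (rule Arr_Vect_eqI[OF C UW.a_closed[OF C C] assms(2)])
        (use that assms in \<open>simp_all add: vapp_Comp_Vect vapp_Hom_Vect Arr_Vect_closed[OF assms(1)]\<close>)
    show "Comp (Vect k) U V W (c \<odot>\<^bsub>Hom (Vect k) V W\<^esub> x) f =
        c \<odot>\<^bsub>Hom (Vect k) U W\<^esub> Comp (Vect k) U V W x f"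
      if "c \<in> carrier k" "x \<in> Arr (Vect k) V W" for x c
      by (rule Arr_Vect_eqI[OF C UW.smult_closed[OF _ C] assms(2)])
        (use that assms in \<open>simp_all add: vapp_Comp_Vect vapp_Hom_Vect Arr_Vect_closed[OF assms(1)]\<close>)
  qed (rule C)
qed

lemma copower_vs_Obj:
  "small I \<Longrightarrow> V \<in> Obj (Vect k) \<Longrightarrow> copower_vs I V \<in> Obj (Vect k)"
  by (simp add: Obj_Vect module_copower_vs small_copower_vs)

section \<open>The base field, free spaces and linear functionals inside \<open>Vect\<close>\<close>

context small_field
begin

lemma kvs_Obj: "kvs k \<in> Obj (Vect k)"
  by (simp add: Obj_Vect module_kvs small_carrier)

lemma free_Obj: "small I \<Longrightarrow> free_vs k I \<in> Obj (Vect k)"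
  by (rule copower_vs_Obj[OF _ kvs_Obj])

lemma coord_Arr:
  assumes "small I" "i \<in> I"
  shows "coord k I i \<in> Arr (Vect k) (free_vs k I) (kvs k)"
  unfolding coord_def by (rule Arr_VectI[OF lin_maps_copower_proj[OF assms]])

lemma vapp_coord:
  "small I \<Longrightarrow> x \<in> carrier (free_vs k I) \<Longrightarrow> vapp (coord k I i) x = vapp x i"
  using free_Obj by (simp add: coord_def Obj_Vect)

lemma basis_small: "is_basis k V B \<Longrightarrow> V \<in> Obj (Vect k) \<Longrightarrow> small B"
  using is_basisD(1) small_subset by (metis Obj_Vect)

text \<open>For existence, extend c linearly to the free space on B and precompose with the
  coordinates of V. For uniqueness, linear maps agreeing on a basis are equal. Together they give
  the definite description its value.\<close>

lemma functional_on_basis: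
  assumes V: "V \<in> Obj (Vect k)" and B: "is_basis k V B" and c: "c \<in> B \<rightarrow> carrier k"
  shows functional_on_basis_Arr: "functional_on_basis k V B c \<in> Arr (Vect k) V (kvs k)"
    and vapp_functional_on_basis:
      "b \<in> B \<Longrightarrow> vapp (functional_on_basis k V B c) b = c b"
    and functional_on_basis_eqI:
      "d \<in> Arr (Vect k) V (kvs k) \<Longrightarrow> (\<And>b. b \<in> B \<Longrightarrow> vapp d b = c b) \<Longrightarrow>
        functional_on_basis k V B c = d"
proof -
  note BV = is_basisD(1)[OF B]
  have mV: "module k V" and sV: "small (carrier V)"
    using V by (simp_all add: Obj_Vect)
  have sB: "small B" by (rule basis_small[OF B V])
  have cB: "\<And>b. b \<in> B \<Longrightarrow> c b \<in> carrier (kvs k)" using c by auto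
  let ?h = "\<lambda>v. lin_comb (kvs k) B c (basis_coords V B v)"
  let ?P = "\<lambda>d. d \<in> Arr (Vect k) V (kvs k) \<and> (\<forall>b\<in>B. vapp d b = c b)"
  have ex: "?P (vfun (carrier V) ?h)"
  proof (intro conjI ballI)
    show "vfun (carrier V) ?h \<in> Arr (Vect k) V (kvs k)"
      by (rule Arr_VectI[OF lin_maps_comp[OF lin_maps_basis_coords[OF mV B sB]
            lin_maps_lin_comb[OF module_kvs sB cB]]])
    show "vapp (vfun (carrier V) ?h) b = c b" if "b \<in> B" for b
      using that BV basis_coords_basis[OF mV B sB that] lin_comb_canonical[OF module_kvs sB cB that]
      by (simp add: sV subsetD)
  qed
  have uniq: "d = d'" if "?P d" "?P d'" for d d'
  proof (rule Arr_Vect_eqI[OF _ _ V])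
    show dd: "d \<in> Arr (Vect k) V (kvs k)" "d' \<in> Arr (Vect k) V (kvs k)"
      using that by auto
    show "vapp d v = vapp d' v" if "v \<in> carrier V" for v
      by (rule lin_maps_basis_eqI[OF mV module_kvs B lin_maps_Arr_Vect[OF dd(1) V]
            lin_maps_Arr_Vect[OF dd(2) V] _ that]) (use \<open>?P d\<close> \<open>?P d'\<close> in auto)
  qed
  have the: "?P (THE d. ?P d)"
    by (rule theI[where P = ?P, OF ex uniq[OF _ ex]])
  then show "functional_on_basis k V B c \<in> Arr (Vect k) V (kvs k)"
      "b \<in> B \<Longrightarrow> vapp (functional_on_basis k V B c) b = c b"
    by (simp_all add: functional_on_basis_def)
  show "d \<in> Arr (Vect k) V (kvs k) \<Longrightarrow> (\<And>b. b \<in> B \<Longrightarrow> vapp d b = c b) \<Longrightarrow>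
      functional_on_basis k V B c = d"
    unfolding functional_on_basis_def using the uniq by (intro uniq) auto
qed

lemma dual_coord_Arr:
  "V \<in> Obj (Vect k) \<Longrightarrow> is_basis k V B \<Longrightarrow> dual_coord k V B b \<in> Arr (Vect k) V (kvs k)"
  unfolding dual_coord_def by (rule functional_on_basis_Arr) auto

text \<open>The link between (A3), phrased with the functionals dual to a basis, and gluing, phrased
  with the coordinates of a free space: for the canonical basis the two families coincide.\<close>

lemma dual_coord_free:
  assumes "small I" "i \<in> I"
  shows "dual_coord k (free_vs k I) (canonical_vec k I ` I) (canonical_vec k I i) = coord k I i"
  unfolding dual_coord_def
  by (rule functional_on_basis_eqI[OF free_Obj is_basis_free _ coord_Arr])
    (use assms inj_on_eq_iff[OF inj_on_canonical_vec] in
      \<open>auto simp: vapp_coord canonical_vec_closed vapp_canonical_vec\<close>)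

lemma sum_functional_Arr:
  "small I \<Longrightarrow> sum_functional k I \<in> Arr (Vect k) (free_vs k I) (kvs k)"
  unfolding sum_functional_def by (rule functional_on_basis_Arr[OF free_Obj is_basis_free]) auto

lemma vapp_sum_functional:
  "small I \<Longrightarrow> i \<in> I \<Longrightarrow> vapp (sum_functional k I) (canonical_vec k I i) = \<one>"
  unfolding sum_functional_def
  by (rule vapp_functional_on_basis[OF free_Obj is_basis_free]) auto

text \<open>Exhibits V as a retract of the free space on a basis. Functors preserve this one-sided
  inverse, so X(V) embeds into the value of X at the free space.\<close>

lemma basis_iso:
  assumes V: "V \<in> Obj (Vect k)" and B: "is_basis k V B"
  shows "vfun (carrier V) (basis_coords V B) \<in> Arr (Vect k) V (free_vs k B)"
    and "vfun (carrier (free_vs k B)) (lin_comb V B (\<lambda>b. b)) \<in> Arr (Vect k) (free_vs k B) V"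
    and "Comp (Vect k) V (free_vs k B) V (vfun (carrier (free_vs k B)) (lin_comb V B (\<lambda>b. b)))
      (vfun (carrier V) (basis_coords V B)) = Idn (Vect k) V"
proof -
  have mV: "module k V" and sV: "small (carrier V)"
    using V by (simp_all add: Obj_Vect)
  have sB: "small B" by (rule basis_small[OF B V])
  have lin: "lin_comb V B (\<lambda>b. b) \<in> lin_maps k (free_vs k B) V"
    by (rule lin_maps_lin_comb[OF mV sB]) (use is_basisD(1)[OF B] in auto)
  note lin' = lin_maps_basis_coords[OF mV B sB]
  show 1: "vfun (carrier V) (basis_coords V B) \<in> Arr (Vect k) V (free_vs k B)"
    by (rule Arr_VectI[OF lin'])
  show 2: "vfun (carrier (free_vs k B)) (lin_comb V B (\<lambda>b. b)) \<in> Arr (Vect k) (free_vs k B) V"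
    by (rule Arr_VectI[OF lin])
  show "Comp (Vect k) V (free_vs k B) V (vfun (carrier (free_vs k B)) (lin_comb V B (\<lambda>b. b)))
      (vfun (carrier V) (basis_coords V B)) = Idn (Vect k) V"
    by (rule Arr_Vect_eqI[OF Comp_Vect_closed[OF 1 2 V free_Obj[OF sB]] Idn_Vect_closed V])
      (use free_Obj[OF sB] in \<open>simp add: vapp_Comp_Vect[OF V] vapp_Idn_Vect[OF V] sV Obj_Vect
        lin_maps_closed[OF lin'] lin_comb_basis_coords[OF mV B sB]\<close>)
qed

end

section \<open>Linear functors and the Yoneda lemma\<close>

lemma functor_cat_simps [simp]:
  "Obj (functor_cat k C D) = {F. k_functor k C D F}"
  "Arr (functor_cat k C D) F G = nat_trans C D F G"
  "Idn (functor_cat k C D) F = (\<lambda>A\<in>Obj C. Idn D (fob F A))"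
  "Comp (functor_cat k C D) F G H \<theta> \<eta> =
    (\<lambda>A\<in>Obj C. Comp D (fob F A) (fob G A) (fob H A) (\<theta> A) (\<eta> A))"
  by (simp_all add: functor_cat_def)

abbreviation vect_functor :: "'u::grothendieck_universe ring \<Rightarrow> 'u vfunctor \<Rightarrow> bool" where
  "vect_functor k \<equiv> k_functor k (Vect k) (Vect k)"

lemma vect_functor_fob: "vect_functor k X \<Longrightarrow> V \<in> Obj (Vect k) \<Longrightarrow> fob X V \<in> Obj (Vect k)"
  by (auto simp: k_functor_def)

lemma vect_functor_far:
  "vect_functor k X \<Longrightarrow> V \<in> Obj (Vect k) \<Longrightarrow> W \<in> Obj (Vect k) \<Longrightarrow>
    far X V W \<in> lin_maps k (Hom (Vect k) V W) (Hom (Vect k) (fob X V) (fob X W))"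
  by (simp add: k_functor_def)

lemma vect_functor_Arr:
  "vect_functor k X \<Longrightarrow> V \<in> Obj (Vect k) \<Longrightarrow> W \<in> Obj (Vect k) \<Longrightarrow> f \<in> Arr (Vect k) V W \<Longrightarrow>
    far X V W f \<in> Arr (Vect k) (fob X V) (fob X W)"
  by (rule lin_maps_closed[OF vect_functor_far])

lemma vect_functor_lin:
  "vect_functor k X \<Longrightarrow> V \<in> Obj (Vect k) \<Longrightarrow> W \<in> Obj (Vect k) \<Longrightarrow> f \<in> Arr (Vect k) V W \<Longrightarrow>
    vapp (far X V W f) \<in> lin_maps k (fob X V) (fob X W)"
  by (rule lin_maps_Arr_Vect[OF vect_functor_Arr vect_functor_fob])

lemma vect_functor_closed:
  "vect_functor k X \<Longrightarrow> V \<in> Obj (Vect k) \<Longrightarrow> W \<in> Obj (Vect k) \<Longrightarrow> f \<in> Arr (Vect k) V W \<Longrightarrow>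
    x \<in> carrier (fob X V) \<Longrightarrow> vapp (far X V W f) x \<in> carrier (fob X W)"
  by (rule lin_maps_closed[OF vect_functor_lin])

lemma vect_functor_Idn:
  assumes "vect_functor k X" "V \<in> Obj (Vect k)" "x \<in> carrier (fob X V)"
  shows "vapp (far X V V (Idn (Vect k) V)) x = x"
proof -
  have "far X V V (Idn (Vect k) V) = Idn (Vect k) (fob X V)"
    using assms by (simp add: k_functor_def)
  then show ?thesis
    using assms by (simp add: vapp_Idn_Vect vect_functor_fob)
qed

lemma vect_functor_Comp:
  assumes "vect_functor k X" "U \<in> Obj (Vect k)" "V \<in> Obj (Vect k)" "W \<in> Obj (Vect k)"
    "f \<in> Arr (Vect k) U V" "g \<in> Arr (Vect k) V W" "x \<in> carrier (fob X U)"
  shows "vapp (far X V W g) (vapp (far X U V f) x) = vapp (far X U W (Comp (Vect k) U V W g f)) x"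
proof -
  have "far X U W (Comp (Vect k) U V W g f) =
      Comp (Vect k) (fob X U) (fob X V) (fob X W) (far X V W g) (far X U V f)"
    using assms by (simp add: k_functor_def)
  then show ?thesis
    using assms by (simp add: vapp_Comp_Vect vect_functor_fob)
qed

lemma lin_maps_vect_functor_eval:
  assumes "vect_functor k X" "V \<in> Obj (Vect k)" "W \<in> Obj (Vect k)" "x \<in> carrier (fob X V)"
  shows "(\<lambda>g. vapp (far X V W g) x) \<in> lin_maps k (Hom (Vect k) V W) (fob X W)"
  using lin_maps_comp[OF vect_functor_far lin_maps_eval] assms vect_functor_fob by blast

text \<open>Composites are graphs over the carrier of \<open>fob F V\<close>, so the naturality
  square is an equation on elements. Of F just the objects are asked to lie in \<open>Vect\<close>,
  so the criterion applies to the copower functor once its values on objects are known.\<close>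

lemma nat_trans_Vect_iff:
  assumes F: "\<And>V. V \<in> Obj (Vect k) \<Longrightarrow> fob F V \<in> Obj (Vect k)"
  shows "\<eta> \<in> nat_trans (Vect k) (Vect k) F G \<longleftrightarrow>
    \<eta> \<in> extensional (Obj (Vect k)) \<and>
    (\<forall>V\<in>Obj (Vect k). \<eta> V \<in> Arr (Vect k) (fob F V) (fob G V)) \<and>
    (\<forall>V\<in>Obj (Vect k). \<forall>W\<in>Obj (Vect k). \<forall>f\<in>Arr (Vect k) V W. \<forall>x\<in>carrier (fob F V).
      vapp (\<eta> W) (vapp (far F V W f) x) = vapp (far G V W f) (vapp (\<eta> V) x))"
proof -
  have comp: "Comp (Vect k) (fob F V) A B h g = Comp (Vect k) (fob F V) A' B' h' g' \<longleftrightarrow>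
      (\<forall>x\<in>carrier (fob F V). vapp h (vapp g x) = vapp h' (vapp g' x))"
    if "V \<in> Obj (Vect k)" for V A B h g A' B' h' g'
    using F[OF that] by (simp add: Vect_def vfun_eq_iff)
  show ?thesis
    by (auto simp: nat_trans_def comp)
qed

lemma nat_trans_eqI:
  assumes "\<eta> \<in> nat_trans C D F G" "\<theta> \<in> nat_trans C D F G" "\<And>A. A \<in> Obj C \<Longrightarrow> \<eta> A = \<theta> A"
  shows "\<eta> = \<theta>"
  using assms by (auto simp: nat_trans_def intro: extensionalityI)

section \<open>Representable functors and the Yoneda correspondence\<close>

lemma Yo_simps [simp]: "fob (Yo k V) W = Hom (Vect k) V W"
  by (simp add: Yo_def)

lemma vapp_far_Yo:
  "V \<in> Obj (Vect k) \<Longrightarrow> W \<in> Obj (Vect k) \<Longrightarrow> g \<in> Arr (Vect k) V W \<Longrightarrow>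
    vapp (far (Yo k V) W W' f) g = Comp (Vect k) V W W' f g"
  using Hom_Vect_Obj[of V k W] by (simp add: Yo_def Obj_Vect)

text \<open>All laws are given on elements. Linearity of \<open>far\<close> in the arrow is stated
  at each fixed x, because sums and scalar multiples in a hom-space are computed pointwise.\<close>

lemma vect_functorI:
  assumes fob: "\<And>V. V \<in> Obj (Vect k) \<Longrightarrow> fob X V \<in> Obj (Vect k)"
    and Arr: "\<And>V W f. V \<in> Obj (Vect k) \<Longrightarrow> W \<in> Obj (Vect k) \<Longrightarrow> f \<in> Arr (Vect k) V W \<Longrightarrow>
      far X V W f \<in> Arr (Vect k) (fob X V) (fob X W)"
    and lin: "\<And>V W x. V \<in> Obj (Vect k) \<Longrightarrow> W \<in> Obj (Vect k) \<Longrightarrow> x \<in> carrier (fob X V) \<Longrightarrow>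
      (\<lambda>f. vapp (far X V W f) x) \<in> lin_maps k (Hom (Vect k) V W) (fob X W)"
    and Idn: "\<And>V x. V \<in> Obj (Vect k) \<Longrightarrow> x \<in> carrier (fob X V) \<Longrightarrow>
      vapp (far X V V (Idn (Vect k) V)) x = x"
    and Comp: "\<And>U V W f g x. U \<in> Obj (Vect k) \<Longrightarrow> V \<in> Obj (Vect k) \<Longrightarrow> W \<in> Obj (Vect k) \<Longrightarrow>
      f \<in> Arr (Vect k) U V \<Longrightarrow> g \<in> Arr (Vect k) V W \<Longrightarrow> x \<in> carrier (fob X U) \<Longrightarrow>
      vapp (far X U W (Comp (Vect k) U V W g f)) x = vapp (far X V W g) (vapp (far X U V f) x)"
  shows "vect_functor k X"
  unfolding k_functor_def
proof (intro conjI ballI)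
  show "fob X \<in> Obj (Vect k) \<rightarrow> Obj (Vect k)"
    using fob by auto
next
  fix V W assume V: "V \<in> Obj (Vect k)" and W: "W \<in> Obj (Vect k)"
  interpret VW: module k "Hom (Vect k) V W" by (rule module_Hom_Vect[OF V W])
  interpret XX: module k "Hom (Vect k) (fob X V) (fob X W)"
    by (rule module_Hom_Vect[OF fob[OF V] fob[OF W]])
  note eqI = Arr_Vect_eqI[OF Arr[OF V W] _ fob[OF V]]
  show "far X V W \<in> lin_maps k (Hom (Vect k) V W) (Hom (Vect k) (fob X V) (fob X W))"
  proof (rule lin_mapsI)
    show "far X V W (f \<oplus>\<^bsub>Hom (Vect k) V W\<^esub> g) =
        far X V W f \<oplus>\<^bsub>Hom (Vect k) (fob X V) (fob X W)\<^esub> far X V W g"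
      if "f \<in> Arr (Vect k) V W" "g \<in> Arr (Vect k) V W" for f g
      by (rule eqI[OF VW.a_closed XX.a_closed])
        (use that V W in \<open>simp_all add: Arr vapp_Hom_Vect fob lin_maps_add[OF lin]\<close>)
    show "far X V W (c \<odot>\<^bsub>Hom (Vect k) V W\<^esub> f) = c \<odot>\<^bsub>Hom (Vect k) (fob X V) (fob X W)\<^esub> far X V W f"
      if "c \<in> carrier k" "f \<in> Arr (Vect k) V W" for c f
      by (rule eqI[OF VW.smult_closed XX.smult_closed])
        (use that V W in \<open>simp_all add: Arr vapp_Hom_Vect fob lin_maps_smult[OF lin]\<close>)
  qed (rule Arr[OF V W])
next
  fix V assume V: "V \<in> Obj (Vect k)"
  show "far X V V (Idn (Vect k) V) = Idn (Vect k) (fob X V)"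
    by (rule Arr_Vect_eqI[OF Arr[OF V V Idn_Vect_closed] Idn_Vect_closed fob[OF V]])
      (simp add: Idn V vapp_Idn_Vect fob)
next
  fix U V W f g
  assume *: "U \<in> Obj (Vect k)" "V \<in> Obj (Vect k)" "W \<in> Obj (Vect k)"
    "f \<in> Arr (Vect k) U V" "g \<in> Arr (Vect k) V W"
  show "far X U W (Comp (Vect k) U V W g f) =
      Comp (Vect k) (fob X U) (fob X V) (fob X W) (far X V W g) (far X U V f)"
    by (rule Arr_Vect_eqI[OF Arr[OF *(1,3) Comp_Vect_closed[OF *(4,5,1,2)]]
          Comp_Vect_closed[OF Arr[OF *(1,2,4)] Arr[OF *(2,3,5)] fob[OF *(1)] fob[OF *(2)]] fob[OF *(1)]])
      (simp add: Comp * vapp_Comp_Vect fob)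
qed

lemma vect_functor_Yo:
  assumes V: "V \<in> Obj (Vect k)"
  shows "vect_functor k (Yo k V)"
proof (rule vect_functorI)
  show "fob (Yo k V) W \<in> Obj (Vect k)" if "W \<in> Obj (Vect k)" for W
    using Hom_Vect_Obj[OF V that] by simp
  show "far (Yo k V) W W' f \<in> Arr (Vect k) (fob (Yo k V) W) (fob (Yo k V) W')"
    if "W \<in> Obj (Vect k)" "W' \<in> Obj (Vect k)" "f \<in> Arr (Vect k) W W'" for W W' f
    using Arr_VectI[OF lin_maps_post_Comp[OF that(3) V that(1,2)]] by (simp add: Yo_def)
  show "(\<lambda>f. vapp (far (Yo k V) W W' f) x) \<in> lin_maps k (Hom (Vect k) W W') (fob (Yo k V) W')"
    if "W \<in> Obj (Vect k)" "W' \<in> Obj (Vect k)" "x \<in> carrier (fob (Yo k V) W)" for W W' x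
    using lin_maps_pre_Comp[of x k V W W'] V that by (simp add: vapp_far_Yo)
qed (simp_all add: V vapp_far_Yo Comp_Idn_Vect Idn_Vect_closed Comp_Vect_assoc Comp_Vect_closed)

text \<open>The Yoneda correspondence from elements of X(V) to arrows; its inverse evaluates at the
  identity of V. Restricting to \<open>Obj (Vect k)\<close> gives the extensional function that a
  natural transformation is required to be.\<close>

definition yoneda_arr ::
    "'u::grothendieck_universe ring \<Rightarrow> 'u vfunctor \<Rightarrow> 'u vs \<Rightarrow> 'u \<Rightarrow> 'u vtrans" where
  "yoneda_arr k X V x =
    (\<lambda>W\<in>Obj (Vect k). vfun (Arr (Vect k) V W) (\<lambda>g. vapp (far X V W g) x))"

lemma vapp_yoneda_arr:
  assumes "V \<in> Obj (Vect k)" "W \<in> Obj (Vect k)" "g \<in> Arr (Vect k) V W"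
  shows "vapp (yoneda_arr k X V x W) g = vapp (far X V W g) x"
  using Hom_Vect_Obj[OF assms(1,2)] assms by (simp add: yoneda_arr_def Obj_Vect)

lemma yoneda_arr_nat_trans:
  assumes X: "vect_functor k X" and V: "V \<in> Obj (Vect k)" and x: "x \<in> carrier (fob X V)"
  shows "yoneda_arr k X V x \<in> nat_trans (Vect k) (Vect k) (Yo k V) X"
proof (subst nat_trans_Vect_iff, goal_cases)
  case (1 W)
  then show ?case by (rule vect_functor_fob[OF vect_functor_Yo[OF V]])
next
  case 2
  show ?case
  proof (intro conjI ballI)
    show "yoneda_arr k X V x \<in> extensional (Obj (Vect k))"
      by (simp add: yoneda_arr_def)
    show "yoneda_arr k X V x W \<in> Arr (Vect k) (fob (Yo k V) W) (fob X W)" if "W \<in> Obj (Vect k)" for W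
      using Arr_VectI[OF lin_maps_vect_functor_eval[OF X V that x]] that by (simp add: yoneda_arr_def)
    show "vapp (yoneda_arr k X V x W') (vapp (far (Yo k V) W W' f) g) =
        vapp (far X W W' f) (vapp (yoneda_arr k X V x W) g)"
      if "W \<in> Obj (Vect k)" "W' \<in> Obj (Vect k)" "f \<in> Arr (Vect k) W W'" "g \<in> carrier (fob (Yo k V) W)"
      for W W' f g
      using that V x
      by (simp add: vapp_far_Yo vapp_yoneda_arr Comp_Vect_closed vect_functor_Comp[OF X])
  qed
qed

text \<open>Naturality along g, evaluated at the identity of V.\<close>

lemma nat_trans_Yo_eval:
  assumes "f \<in> nat_trans (Vect k) (Vect k) (Yo k V) X" "V \<in> Obj (Vect k)" "W \<in> Obj (Vect k)"
    "g \<in> Arr (Vect k) V W"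
  shows "vapp (f W) g = vapp (far X V W g) (vapp (f V) (Idn (Vect k) V))"
proof -
  have "vapp (f W) (vapp (far (Yo k V) V W g) (Idn (Vect k) V)) =
      vapp (far X V W g) (vapp (f V) (Idn (Vect k) V))"
    using assms Idn_Vect_closed[of k V]
    by (subst (asm) nat_trans_Vect_iff) (auto simp: Hom_Vect_Obj)
  then show ?thesis
    using assms by (simp add: vapp_far_Yo Idn_Vect_closed Comp_Idn_Vect)
qed

lemma nat_trans_Yo_closed:
  assumes "f \<in> nat_trans (Vect k) (Vect k) (Yo k V) X" "V \<in> Obj (Vect k)"
  shows "vapp (f V) (Idn (Vect k) V) \<in> carrier (fob X V)"
proof -
  have "f V \<in> Arr (Vect k) (Hom (Vect k) V V) (fob X V)"
    using assms by (simp add: nat_trans_def)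
  then show ?thesis
    using assms Arr_Vect_closed[OF _ Hom_Vect_Obj Idn_Vect_closed] by blast
qed

lemma nat_trans_Yo_eqI:
  assumes f: "f \<in> nat_trans (Vect k) (Vect k) (Yo k V) X" and g: "g \<in> nat_trans (Vect k) (Vect k) (Yo k V) X"
    and V: "V \<in> Obj (Vect k)" and eq: "vapp (f V) (Idn (Vect k) V) = vapp (g V) (Idn (Vect k) V)"
  shows "f = g"
proof (rule nat_trans_eqI[OF f g])
  fix W assume W: "W \<in> Obj (Vect k)"
  show "f W = g W"
    by (rule Arr_Vect_eqI[of _ k "Hom (Vect k) V W" "fob X W"])
      (use f g V W eq in \<open>auto simp: nat_trans_def Hom_Vect_Obj nat_trans_Yo_eval\<close>)
qed

section \<open>Unique gluing\<close>

text \<open>\<open>A3_star\<close> for a single functor with the prescribed family eliminated: the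
  coordinates of w serve as the family, so the condition becomes injectivity.\<close>

definition unique_gluing :: "'u::grothendieck_universe ring \<Rightarrow> 'u vfunctor \<Rightarrow> bool" where
  "unique_gluing k X \<longleftrightarrow>
    (\<forall>I. small I \<longrightarrow> (\<forall>w\<in>carrier (fob X (free_vs k I)). \<forall>w'\<in>carrier (fob X (free_vs k I)).
      (\<forall>i\<in>I. vapp (far X (free_vs k I) (kvs k) (coord k I i)) w =
        vapp (far X (free_vs k I) (kvs k) (coord k I i)) w') \<longrightarrow> w = w'))"

lemma unique_gluingD:
  assumes "unique_gluing k X" "small I" "w \<in> carrier (fob X (free_vs k I))"
    "w' \<in> carrier (fob X (free_vs k I))"
    "\<And>i. i \<in> I \<Longrightarrow> vapp (far X (free_vs k I) (kvs k) (coord k I i)) w =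
      vapp (far X (free_vs k I) (kvs k) (coord k I i)) w'"
  shows "w = w'"
  using assms by (simp add: unique_gluing_def)

text \<open>By Yoneda an arrow out of \<open>Yo k V\<close> is an element x of X(V), and its
  component at k is the function that sends a functional \<phi> to X(\<phi>)(x). So k-concreteness
  says that functionals separate the elements of X(V).\<close>

lemma k_concrete_iff:
  assumes X: "vect_functor k X" and K: "kvs k \<in> Obj (Vect k)"
  shows "k_concrete k X \<longleftrightarrow>
    (\<forall>V\<in>Obj (Vect k). \<forall>x\<in>carrier (fob X V). \<forall>y\<in>carrier (fob X V).
      (\<forall>\<phi>\<in>Arr (Vect k) V (kvs k). vapp (far X V (kvs k) \<phi>) x = vapp (far X V (kvs k) \<phi>) y) \<longrightarrow> x = y)"
    (is "_ \<longleftrightarrow> ?sep")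
proof
  assume conc: "k_concrete k X"
  show ?sep
  proof (intro ballI impI)
    fix V x y
    assume V: "V \<in> Obj (Vect k)" and xy: "x \<in> carrier (fob X V)" "y \<in> carrier (fob X V)"
      and eq: "\<forall>\<phi>\<in>Arr (Vect k) V (kvs k). vapp (far X V (kvs k) \<phi>) x = vapp (far X V (kvs k) \<phi>) y"
    have "yoneda_arr k X V x (kvs k) = yoneda_arr k X V y (kvs k)"
      using eq K Hom_Vect_Obj[OF V K] by (simp add: yoneda_arr_def vfun_eq_iff Obj_Vect)
    then have "yoneda_arr k X V x = yoneda_arr k X V y"
      using conc V yoneda_arr_nat_trans[OF X V] xy by (auto simp: k_concrete_def)
    then show "x = y"
      using vapp_yoneda_arr[OF V V Idn_Vect_closed] vect_functor_Idn[OF X V] xy by metis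
  qed
next
  assume sep: ?sep
  have "f = g" if V: "V \<in> Obj (Vect k)" and f: "f \<in> nat_trans (Vect k) (Vect k) (Yo k V) X"
    and g: "g \<in> nat_trans (Vect k) (Vect k) (Yo k V) X" and "f (kvs k) = g (kvs k)" for V f g
    using sep V nat_trans_Yo_closed[OF f V] nat_trans_Yo_closed[OF g V]
      nat_trans_Yo_eval[OF f V K] nat_trans_Yo_eval[OF g V K] that(4)
    by (intro nat_trans_Yo_eqI[OF f g V]) metis
  then show "k_concrete k X"
    by (auto simp: k_concrete_def)
qed

section \<open>Strong vector spaces are the functors with unique gluing\<close>

context small_field
begin

lemma A3_star_iff:
  assumes "\<And>X. X \<in> S \<Longrightarrow> vect_functor k X"
  shows "A3_star k S \<longleftrightarrow> (\<forall>X\<in>S. unique_gluing k X)"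
proof
  assume A3: "A3_star k S"
  show "\<forall>X\<in>S. unique_gluing k X"
    unfolding unique_gluing_def
  proof (intro ballI allI impI)
    fix X I w w'
    assume *: "X \<in> S" "small I" "w \<in> carrier (fob X (free_vs k I))" "w' \<in> carrier (fob X (free_vs k I))"
      "\<forall>i\<in>I. vapp (far X (free_vs k I) (kvs k) (coord k I i)) w =
        vapp (far X (free_vs k I) (kvs k) (coord k I i)) w'"
    \<comment> \<open>\<open>A3_star\<close> quantifies over families in X(k). The coordinates of w
      form such a family, and both w and w' glue it.\<close>
    let ?x = "\<lambda>i. vapp (far X (free_vs k I) (kvs k) (coord k I i)) w"
    have "?x \<in> I \<rightarrow> carrier (fob X (kvs k))"
      using vect_functor_closed[OF assms free_Obj kvs_Obj coord_Arr] * by auto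
    moreover have "w \<in> gluings k X I ?x" "w' \<in> gluings k X I ?x"
      using * by (auto simp: gluings_def)
    ultimately show "w = w'"
      using A3 * unfolding A3_star_def by blast
  qed
next
  assume "\<forall>X\<in>S. unique_gluing k X"
  then show "A3_star k S"
    by (auto simp: A3_star_def gluings_def intro: unique_gluingD)
qed

text \<open>
  The functional \<open>\<phi>\<close> factors as the sum functional after the diagonal endomorphism with entries
  \<open>\<phi> e\<^sub>i\<close>, so a strong vector space that cannot tell apart two gluings by their coordinates
  cannot tell them apart by any functional.
\<close>

lemma diagonal_factorization:
  assumes I: "small I" and \<phi>: "\<phi> \<in> Arr (Vect k) (free_vs k I) (kvs k)"
  shows "\<exists>d\<in>Arr (Vect k) (free_vs k I) (free_vs k I).
    (\<forall>i\<in>I. Comp (Vect k) (free_vs k I) (free_vs k I) (kvs k) (coord k I i) d =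
      vapp \<phi> (canonical_vec k I i) \<odot>\<^bsub>Hom (Vect k) (free_vs k I) (kvs k)\<^esub> coord k I i) \<and>
    Comp (Vect k) (free_vs k I) (free_vs k I) (kvs k) (sum_functional k I) d = \<phi>"
proof -
  let ?F = "free_vs k I"
  note FO = free_Obj[OF I]
  note mF = module_free[OF I]
  have sF: "small (carrier ?F)"
    using FO by (simp add: Obj_Vect)
  interpret H: module k "Hom (Vect k) ?F (kvs k)" by (rule module_Hom_Vect[OF FO kvs_Obj])
  interpret F: module k ?F by (rule mF)
  have \<phi>e: "vapp \<phi> (canonical_vec k I i) \<in> carrier k" for i
    using Arr_Vect_closed[OF \<phi> FO canonical_vec_closed] by simp
  \<comment> \<open>Infinitely many of the scalars \<phi>(e_i) may be nonzero, but each vector has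
    finite support, so scaling its coordinates by them stays inside the free space.\<close>
  let ?D = "\<lambda>x. vfun I (\<lambda>i. vapp \<phi> (canonical_vec k I i) \<otimes> vapp x i)"
  have "(\<lambda>x. vapp \<phi> (canonical_vec k I i) \<otimes> x) \<in> lin_maps k (kvs k) (kvs k)" for i
    using lin_maps_scale[OF lin_maps_id \<phi>e module_kvs, of i] by simp
  then have D: "?D \<in> lin_maps k ?F ?F"
    by (intro lin_maps_copower_map[OF I _ module_kvs module_kvs])
  let ?d = "vfun (carrier ?F) ?D"
  have d: "?d \<in> Arr (Vect k) ?F ?F"
    by (rule Arr_VectI[OF D])
  note comp = Comp_Vect_closed[OF d _ FO FO]
  have 1: "Comp (Vect k) ?F ?F (kvs k) (coord k I i) ?d =
      vapp \<phi> (canonical_vec k I i) \<odot>\<^bsub>Hom (Vect k) ?F (kvs k)\<^esub> coord k I i" if i: "i \<in> I" for i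
    by (rule Arr_Vect_eqI[OF comp[OF coord_Arr[OF I i]] H.smult_closed[OF \<phi>e coord_Arr[OF I i]] FO])
      (simp add: vapp_Comp_Vect[OF FO] vapp_Hom_Vect[OF FO] vapp_coord[OF I] sF lin_maps_closed[OF D] I i)
  have 2: "Comp (Vect k) ?F ?F (kvs k) (sum_functional k I) ?d = \<phi>"
  proof (rule Arr_Vect_eqI[OF comp[OF sum_functional_Arr[OF I]] \<phi> FO])
    note comp' = comp[OF sum_functional_Arr[OF I]]
    have *: "vapp (Comp (Vect k) ?F ?F (kvs k) (sum_functional k I) ?d) (canonical_vec k I i) =
        vapp \<phi> (canonical_vec k I i)" if i: "i \<in> I" for i
    proof -
      \<comment> \<open>Basis vectors are eigenvectors of the diagonal map, and the sum functional
        takes the value 1 on each of them, which leaves \<phi>(e_i).\<close>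
      have "?D (canonical_vec k I i) = vapp \<phi> (canonical_vec k I i) \<odot>\<^bsub>?F\<^esub> canonical_vec k I i"
      proof (rule copower_vs_eqI[OF lin_maps_closed[OF D canonical_vec_closed]
            F.smult_closed[OF \<phi>e canonical_vec_closed] I])
        show "vapp (?D (canonical_vec k I i)) j =
            vapp (vapp \<phi> (canonical_vec k I i) \<odot>\<^bsub>?F\<^esub> canonical_vec k I i) j" if "j \<in> I" for j
          using that I \<phi>e by (simp add: copower_vs_vapp vapp_canonical_vec)
      qed
      then show ?thesis
        using lin_maps_smult[OF lin_maps_Arr_Vect[OF sum_functional_Arr[OF I] FO] \<phi>e canonical_vec_closed] \<phi>e
        by (simp add: vapp_Comp_Vect[OF FO] canonical_vec_closed sF vapp_sum_functional[OF I i])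
    qed
    show "vapp (Comp (Vect k) ?F ?F (kvs k) (sum_functional k I) ?d) x = vapp \<phi> x" if "x \<in> carrier ?F" for x
      by (rule lin_maps_basis_eqI[OF mF module_kvs is_basis_free[OF I] lin_maps_Arr_Vect[OF comp' FO]
            lin_maps_Arr_Vect[OF \<phi> FO] _ that]) (auto simp: *)
  qed
  show ?thesis
    using d 1 2 by blast
qed

lemma strong_vs_imp_unique_gluing:
  assumes "strong_vs k X"
  shows "unique_gluing k X"
  unfolding unique_gluing_def
proof (intro allI impI ballI)
  fix I w w'
  let ?F = "free_vs k I"
  assume I: "small I" and w: "w \<in> carrier (fob X ?F)" "w' \<in> carrier (fob X ?F)"
    and eq: "\<forall>i\<in>I. vapp (far X ?F (kvs k) (coord k I i)) w = vapp (far X ?F (kvs k) (coord k I i)) w'"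
  have X: "vect_functor k X" and conc: "k_concrete k X"
    and sums: "\<And>I x. small I \<Longrightarrow> x \<in> I \<rightarrow> carrier (fob X (kvs k)) \<Longrightarrow> summable k X I x \<Longrightarrow>
      \<exists>!s. is_sum k X I x s"
    using assms by (auto simp: strong_vs_def)
  note FO = free_Obj[OF I]
  note cA = coord_Arr[OF I]
  have "vapp (far X ?F (kvs k) \<phi>) w = vapp (far X ?F (kvs k) \<phi>) w'"
    if \<phi>: "\<phi> \<in> Arr (Vect k) ?F (kvs k)" for \<phi>
  proof -
    obtain d where d: "d \<in> Arr (Vect k) ?F ?F"
      and coord_d: "\<And>i. i \<in> I \<Longrightarrow> Comp (Vect k) ?F ?F (kvs k) (coord k I i) d =
          vapp \<phi> (canonical_vec k I i) \<odot>\<^bsub>Hom (Vect k) ?F (kvs k)\<^esub> coord k I i"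
      and sum_d: "Comp (Vect k) ?F ?F (kvs k) (sum_functional k I) d = \<phi>"
      using diagonal_factorization[OF I \<phi>] by blast
    \<comment> \<open>Defined through w alone. By \<open>eq\<close> the same family results from w',
      which is why the images of w and w' under X(d) are gluings of one family.\<close>
    define x where "x i = vapp \<phi> (canonical_vec k I i) \<odot>\<^bsub>fob X (kvs k)\<^esub>
      vapp (far X ?F (kvs k) (coord k I i)) w" for i
    have \<phi>e: "vapp \<phi> (canonical_vec k I i) \<in> carrier k" for i
      using Arr_Vect_closed[OF \<phi> FO canonical_vec_closed] by simp
    \<comment> \<open>The k-linearity of X on arrows enters here: it turns the i-th coordinate of
      X(d)(v) into \<phi>(e_i) times the i-th coordinate of v.\<close>
    have coord_dv: "vapp (far X ?F (kvs k) (coord k I i)) (vapp (far X ?F ?F d) v) =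
        vapp \<phi> (canonical_vec k I i) \<odot>\<^bsub>fob X (kvs k)\<^esub> vapp (far X ?F (kvs k) (coord k I i)) v"
      if "i \<in> I" "v \<in> carrier (fob X ?F)" for i v
      using that lin_maps_smult[OF lin_maps_vect_functor_eval[OF X FO kvs_Obj that(2)] \<phi>e cA[OF that(1)]]
      by (simp add: vect_functor_Comp[OF X FO FO kvs_Obj d cA] coord_d)
    have gl: "vapp (far X ?F ?F d) w \<in> gluings k X I x" "vapp (far X ?F ?F d) w' \<in> gluings k X I x"
      using w eq vect_functor_closed[OF X FO FO d] by (auto simp: gluings_def coord_dv x_def)
    have "x \<in> I \<rightarrow> carrier (fob X (kvs k))"
    proof
      fix i assume i: "i \<in> I"
      then have "x i = vapp (far X ?F (kvs k) (coord k I i)) (vapp (far X ?F ?F d) w)"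
        using gl(1) by (simp add: gluings_def)
      then show "x i \<in> carrier (fob X (kvs k))"
        using vect_functor_closed[OF X FO kvs_Obj cA[OF i]] vect_functor_closed[OF X FO FO d] w(1) by simp
    qed
    moreover have "summable k X I x"
      using gl by (auto simp: summable_def)
    ultimately have "\<exists>!s. is_sum k X I x s"
      by (rule sums[OF I])
    moreover have "is_sum k X I x (vapp (far X ?F (kvs k) (sum_functional k I)) (vapp (far X ?F ?F d) w))"
        "is_sum k X I x (vapp (far X ?F (kvs k) (sum_functional k I)) (vapp (far X ?F ?F d) w'))"
      unfolding is_sum_def using gl by blast+
    ultimately have "vapp (far X ?F (kvs k) (sum_functional k I)) (vapp (far X ?F ?F d) w) =
        vapp (far X ?F (kvs k) (sum_functional k I)) (vapp (far X ?F ?F d) w')"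
      by blast
    then show ?thesis
      by (simp add: vect_functor_Comp[OF X FO FO kvs_Obj d sum_functional_Arr[OF I]] w sum_d)
  qed
  then show "w = w'"
    using conc FO w unfolding k_concrete_iff[OF X kvs_Obj] by blast
qed

lemma unique_gluing_imp_strong_vs:
  assumes X: "vect_functor k X" and glue: "unique_gluing k X"
  shows "strong_vs k X"
proof -
  have "x = y" if V: "V \<in> Obj (Vect k)" and xy: "x \<in> carrier (fob X V)" "y \<in> carrier (fob X V)"
    and eq: "\<forall>\<phi>\<in>Arr (Vect k) V (kvs k). vapp (far X V (kvs k) \<phi>) x = vapp (far X V (kvs k) \<phi>) y" for V x y
  proof -
    obtain B where B: "is_basis k V B"
      using V exists_basis[of V] by (auto simp: Obj_Vect)
    have sB: "small B" by (rule basis_small[OF B V])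
    note FO = free_Obj[OF sB]
    let ?F = "free_vs k B"
    let ?e = "vfun (carrier V) (basis_coords V B)"
    let ?r = "vfun (carrier ?F) (lin_comb V B (\<lambda>b. b))"
    note e = basis_iso(1)[OF V B] and r = basis_iso(2)[OF V B] and re = basis_iso(3)[OF V B]
    \<comment> \<open>Each coordinate of the map \<open>?e\<close> is a functional on V, and by
      \<open>eq\<close> functionals on V do not tell x and y apart.\<close>
    have "vapp (far X V ?F ?e) x = vapp (far X V ?F ?e) y"
    proof (rule unique_gluingD[OF glue sB])
      fix b assume "b \<in> B"
      note c = coord_Arr[OF sB this]
      show "vapp (far X ?F (kvs k) (coord k B b)) (vapp (far X V ?F ?e) x) =
          vapp (far X ?F (kvs k) (coord k B b)) (vapp (far X V ?F ?e) y)"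
        using eq Comp_Vect_closed[OF e c V FO]
        by (simp add: vect_functor_Comp[OF X V FO kvs_Obj e c] xy)
    qed (use vect_functor_closed[OF X V FO e] xy in auto)
    \<comment> \<open>\<open>?r\<close> is a left inverse of \<open>?e\<close>, so applying X to it
      cancels X(\<open>?e\<close>).\<close>
    then have "vapp (far X ?F V ?r) (vapp (far X V ?F ?e) x) = vapp (far X ?F V ?r) (vapp (far X V ?F ?e) y)"
      by simp
    then show ?thesis
      using xy by (simp add: vect_functor_Comp[OF X V FO V e r] re vect_functor_Idn[OF X V])
  qed
  then have conc: "k_concrete k X"
    unfolding k_concrete_iff[OF X kvs_Obj] by blast
  have sums: "\<exists>!s. is_sum k X I x s" if I: "small I" and x: "summable k X I x" for I x
  proof -
    obtain w where w: "w \<in> gluings k X I x"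
      using x by (auto simp: summable_def)
    have "w' = w" if "w' \<in> gluings k X I x" for w'
      by (rule unique_gluingD[OF glue I]) (use w that in \<open>auto simp: gluings_def\<close>)
    then show ?thesis
      unfolding is_sum_def using w by blast
  qed
  show ?thesis
    unfolding strong_vs_def functor_cat_simps
    by (intro conjI allI impI CollectI X conc) (elim conjE, rule sums)
qed

lemma SigmaVect_iff: "X \<in> SigmaVect k \<longleftrightarrow> vect_functor k X \<and> unique_gluing k X"
proof -
  have "vect_functor k X" if "strong_vs k X"
    using that by (simp only: strong_vs_def functor_cat_simps mem_Collect_eq)
  then show ?thesis
    using strong_vs_imp_unique_gluing unique_gluing_imp_strong_vs
    unfolding SigmaVect_def mem_Collect_eq by blast
qed

text \<open>An arrow from V to the free space on I is determined by its composites with the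
  coordinates, because a vector of the free space is determined by its entries.\<close>

lemma Yo_SigmaVect:
  assumes V: "V \<in> Obj (Vect k)"
  shows "Yo k V \<in> SigmaVect k"
  unfolding SigmaVect_iff unique_gluing_def
proof (intro conjI allI ballI impI)
  show "vect_functor k (Yo k V)"
    by (rule vect_functor_Yo[OF V])
  fix I w w'
  let ?F = "free_vs k I"
  assume I: "small I" and "w \<in> carrier (fob (Yo k V) ?F)" "w' \<in> carrier (fob (Yo k V) ?F)"
    and eq: "\<forall>i\<in>I. vapp (far (Yo k V) ?F (kvs k) (coord k I i)) w =
      vapp (far (Yo k V) ?F (kvs k) (coord k I i)) w'"
  then have w: "w \<in> Arr (Vect k) V ?F" "w' \<in> Arr (Vect k) V ?F"
    by simp_all
  show "w = w'"
  proof (rule Arr_Vect_eqI[OF w V])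
    fix x assume x: "x \<in> carrier V"
    show "vapp w x = vapp w' x"
    proof (rule copower_vs_eqI[OF _ _ I])
      show wx: "vapp w x \<in> carrier ?F" "vapp w' x \<in> carrier ?F"
        using w V x by (simp_all add: Arr_Vect_closed)
      fix i assume i: "i \<in> I"
      have "vapp (Comp (Vect k) V ?F (kvs k) (coord k I i) w) x =
          vapp (Comp (Vect k) V ?F (kvs k) (coord k I i) w') x"
        using eq i w V free_Obj[OF I] by (simp add: vapp_far_Yo)
      then show "vapp (vapp w x) i = vapp (vapp w' x) i"
        using wx x V I by (simp add: vapp_Comp_Vect vapp_coord)
    qed
  qed
qed

section \<open>Maximality with respect to \<open>A3_star\<close>\<close>

lemma SigmaVect_largest_A3_star:
  "largest_full_subcat (FunVect k) (\<lambda>S. A3_star k S \<and> (\<forall>V\<in>Obj (Vect k). Yo k V \<in> S)) (SigmaVect k)"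
  unfolding largest_full_subcat_def
proof (intro conjI allI impI ballI)
  show "SigmaVect k \<subseteq> Obj (FunVect k)"
    by (auto simp: SigmaVect_iff)
  show "A3_star k (SigmaVect k)"
    by (subst A3_star_iff) (auto simp: SigmaVect_iff)
  show "V \<in> Obj (Vect k) \<Longrightarrow> Yo k V \<in> SigmaVect k" for V
    by (rule Yo_SigmaVect)
  fix S assume "S \<subseteq> Obj (FunVect k) \<and> A3_star k S \<and> (\<forall>V\<in>Obj (Vect k). Yo k V \<in> S)"
  then have "\<And>X. X \<in> S \<Longrightarrow> vect_functor k X" "A3_star k S"
    by auto
  then show "S \<subseteq> SigmaVect k"
    using A3_star_iff[of S] by (auto simp: SigmaVect_iff)
qed


section \<open>The canonical arrow out of the copower\<close>

lemma coord_pre_Comp: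
  assumes I: "small I" and "i \<in> I" and W: "W \<in> Obj (Vect k)"
  shows "(\<lambda>g. Comp (Vect k) (free_vs k I) (kvs k) W g (coord k I i))
    \<in> lin_maps k (Hom (Vect k) (kvs k) W) (Hom (Vect k) (free_vs k I) W)"
  by (rule lin_maps_pre_Comp[OF coord_Arr[OF assms(1,2)] free_Obj[OF I] kvs_Obj W])

text \<open>Recognizes the sum over the support as a copairing, so that linearity and values on
  generators come from the coproduct.\<close>

lemma delta_arr_eq_copair:
  "W \<in> Obj (Vect k) \<Longrightarrow> delta_arr k I W = vfun (carrier (copower_vs I (Hom (Vect k) (kvs k) W)))
    (copair I (Hom (Vect k) (kvs k) W) (Hom (Vect k) (free_vs k I) W)
      (\<lambda>i g. Comp (Vect k) (free_vs k I) (kvs k) W g (coord k I i)))"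
  by (simp add: delta_arr_def copair_def[abs_def])

lemma delta_arr_Arr:
  assumes I: "small I" and W: "W \<in> Obj (Vect k)"
  shows "delta_arr k I W \<in>
    Arr (Vect k) (copower_vs I (Hom (Vect k) (kvs k) W)) (Hom (Vect k) (free_vs k I) W)"
  unfolding delta_arr_eq_copair[OF W]
  by (rule Arr_VectI[OF lin_maps_copair[OF module_Hom_Vect[OF kvs_Obj W] I
          module_Hom_Vect[OF free_Obj[OF I] W] coord_pre_Comp[OF I _ W]]])

lemma vapp_delta_arr_inj:
  assumes I: "small I" and W: "W \<in> Obj (Vect k)" and "i \<in> I" "u \<in> Arr (Vect k) (kvs k) W"
  shows "vapp (delta_arr k I W) (copower_inj I (Hom (Vect k) (kvs k) W) i u) =
    Comp (Vect k) (free_vs k I) (kvs k) W u (coord k I i)"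
proof -
  have "small (carrier (copower_vs I (Hom (Vect k) (kvs k) W)))"
    using copower_vs_Obj[OF I Hom_Vect_Obj[OF kvs_Obj W]] by (simp add: Obj_Vect)
  then show ?thesis
    unfolding delta_arr_eq_copair[OF W]
    using copair_inj[OF module_Hom_Vect[OF kvs_Obj W] I
        module_Hom_Vect[OF free_Obj[OF I] W] coord_pre_Comp[OF I _ W] assms(3,4)]
      copower_inj_closed[OF module_Hom_Vect[OF kvs_Obj W] assms(4)]
    by simp
qed

lemma copower_Yo_Obj:
  "small I \<Longrightarrow> W \<in> Obj (Vect k) \<Longrightarrow> fob (copower_functor I (Yo k (kvs k))) W \<in> Obj (Vect k)"
  by (simp add: copower_functor_def copower_vs_Obj Hom_Vect_Obj kvs_Obj)

lemma vapp_far_copower_Yo: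
  assumes "small I" "W \<in> Obj (Vect k)" "x \<in> carrier (copower_vs I (Hom (Vect k) (kvs k) W))"
  shows "vapp (far (copower_functor I (Yo k (kvs k))) W W' f) x =
    vfun I (\<lambda>i. Comp (Vect k) (kvs k) W W' f (vapp x i))"
proof -
  have "small (carrier (copower_vs I (Hom (Vect k) (kvs k) W)))"
    using copower_vs_Obj[OF assms(1) Hom_Vect_Obj[OF kvs_Obj assms(2)]] by (simp add: Obj_Vect)
  then show ?thesis
    using assms copower_vs_cases(1)[OF assms(3,1)]
    by (simp add: copower_functor_def vfun_eq_iff vapp_far_Yo kvs_Obj)
qed

lemma lin_maps_copower_Yo:
  assumes "small I" "W \<in> Obj (Vect k)" "W' \<in> Obj (Vect k)" "f \<in> Arr (Vect k) W W'"
  shows "(\<lambda>x. vfun I (\<lambda>i. Comp (Vect k) (kvs k) W W' f (vapp x i))) \<in> lin_maps k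
    (copower_vs I (Hom (Vect k) (kvs k) W)) (copower_vs I (Hom (Vect k) (kvs k) W'))"
  using assms kvs_Obj by (intro lin_maps_copower_map lin_maps_post_Comp module_Hom_Vect)

text \<open>Both sides of the naturality square are linear in x, so it suffices to compare them on
  vectors supported at one index, where the square is associativity of composition.\<close>

lemma delta_arr_nat_trans:
  assumes I: "small I"
  shows "delta_arr k I \<in>
    nat_trans (Vect k) (Vect k) (copower_functor I (Yo k (kvs k))) (Yo k (free_vs k I))"
proof (subst nat_trans_Vect_iff[OF copower_Yo_Obj[OF I]], assumption, intro conjI ballI)
  show "delta_arr k I \<in> extensional (Obj (Vect k))"
    by (simp add: delta_arr_def)
  show "delta_arr k I W \<in> Arr (Vect k) (fob (copower_functor I (Yo k (kvs k))) W) (fob (Yo k (free_vs k I)) W)"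
    if "W \<in> Obj (Vect k)" for W
    using delta_arr_Arr[OF I that] by (simp add: copower_functor_def)
  fix W W' f x
  assume W: "W \<in> Obj (Vect k)" and W': "W' \<in> Obj (Vect k)" and f: "f \<in> Arr (Vect k) W W'"
    and "x \<in> carrier (fob (copower_functor I (Yo k (kvs k))) W)"
  then have x: "x \<in> carrier (copower_vs I (Hom (Vect k) (kvs k) W))"
    by (simp add: copower_functor_def)
  let ?F = "free_vs k I"
  let ?H = "Hom (Vect k) (kvs k)"
  let ?m = "\<lambda>x. vfun I (\<lambda>i. Comp (Vect k) (kvs k) W W' f (vapp x i))"
  note PO = copower_vs_Obj[OF I Hom_Vect_Obj[OF kvs_Obj W]]
  note PO' = copower_vs_Obj[OF I Hom_Vect_Obj[OF kvs_Obj W']]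
  note FO = free_Obj[OF I]
  have 1: "(\<lambda>x. vapp (delta_arr k I W') (?m x)) \<in> lin_maps k (copower_vs I (?H W)) (Hom (Vect k) ?F W')"
    by (rule lin_maps_comp[OF lin_maps_copower_Yo[OF I W W' f] lin_maps_Arr_Vect[OF delta_arr_Arr[OF I W'] PO']])
  have 2: "(\<lambda>x. Comp (Vect k) ?F W W' f (vapp (delta_arr k I W) x)) \<in>
      lin_maps k (copower_vs I (?H W)) (Hom (Vect k) ?F W')"
    by (rule lin_maps_comp[OF lin_maps_Arr_Vect[OF delta_arr_Arr[OF I W] PO] lin_maps_post_Comp[OF f FO W W']])
  have "vapp (delta_arr k I W') (?m x) = Comp (Vect k) ?F W W' f (vapp (delta_arr k I W) x)"
  proof (rule lin_maps_copower_eqI[OF module_Hom_Vect[OF kvs_Obj W] I module_Hom_Vect[OF FO W'] 1 2 _ x])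
    fix i u assume i: "i \<in> I" and u: "u \<in> carrier (?H W)"
    have fu: "Comp (Vect k) (kvs k) W W' f u \<in> carrier (?H W')"
      by (rule Comp_Vect_closed[OF u f kvs_Obj W])
    \<comment> \<open>The entries off i are zero maps, and composing them with f keeps them
      zero.\<close>
    have "?m (copower_inj I (?H W) i u) = copower_inj I (?H W') i (Comp (Vect k) (kvs k) W W' f u)"
      unfolding copower_inj_def[of I "?H W'"] using I
        lin_maps_zero[OF lin_maps_post_Comp[OF f kvs_Obj W W']
          module_Hom_Vect[OF kvs_Obj W] module_Hom_Vect[OF kvs_Obj W']]
      by (auto simp: vfun_eq_iff vapp_copower_inj)
    then show "vapp (delta_arr k I W') (?m (copower_inj I (?H W) i u)) =
        Comp (Vect k) ?F W W' f (vapp (delta_arr k I W) (copower_inj I (?H W) i u))"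
      using Comp_Vect_assoc[OF coord_Arr[OF I i] FO kvs_Obj]
      by (simp add: vapp_delta_arr_inj[OF I W i u] vapp_delta_arr_inj[OF I W' i fu])
  qed
  then show "vapp (delta_arr k I W') (vapp (far (copower_functor I (Yo k (kvs k))) W W' f) x) =
      vapp (far (Yo k ?F) W W' f) (vapp (delta_arr k I W) x)"
    using Arr_Vect_closed[OF delta_arr_Arr[OF I W] PO x]
    by (simp add: vapp_far_copower_Yo[OF I W x] vapp_far_Yo[OF FO W])
qed

text \<open>Let x and y be the elements that Yoneda assigns to f and g. Left to right, evaluate at W
  = k on the identity placed at index i: \<open>delta_arr\<close> sends it to the i-th coordinate
  functional, whose images under f and g are the i-th coordinates of x and y. Right to left, both
  sides are linear, and on u placed at index i they are X(u) applied to the i-th coordinates of x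
  and y.\<close>

lemma Comp_delta_arr_eq_iff:
  assumes I: "small I" and X: "vect_functor k X"
    and f: "f \<in> nat_trans (Vect k) (Vect k) (Yo k (free_vs k I)) X"
    and g: "g \<in> nat_trans (Vect k) (Vect k) (Yo k (free_vs k I)) X"
  defines "P \<equiv> copower_functor I (Yo k (kvs k))"
  shows "Comp (FunVect k) P (Yo k (free_vs k I)) X f (delta_arr k I) =
      Comp (FunVect k) P (Yo k (free_vs k I)) X g (delta_arr k I) \<longleftrightarrow>
    (\<forall>i\<in>I. vapp (far X (free_vs k I) (kvs k) (coord k I i)) (vapp (f (free_vs k I)) (Idn (Vect k) (free_vs k I))) =
      vapp (far X (free_vs k I) (kvs k) (coord k I i)) (vapp (g (free_vs k I)) (Idn (Vect k) (free_vs k I))))"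
    (is "?L \<longleftrightarrow> ?R")
proof -
  let ?F = "free_vs k I"
  let ?H = "\<lambda>W. Hom (Vect k) (kvs k) W"
  note FO = free_Obj[OF I]
  note fe = nat_trans_Yo_eval[OF f FO] and ge = nat_trans_Yo_eval[OF g FO]
  note fc = nat_trans_Yo_closed[OF f FO] and gc = nat_trans_Yo_closed[OF g FO]
  have P: "fob P W = copower_vs I (?H W)" for W
    by (simp add: P_def copower_functor_def)
  have PO: "copower_vs I (?H W) \<in> Obj (Vect k)" if "W \<in> Obj (Vect k)" for W
    by (rule copower_vs_Obj[OF I Hom_Vect_Obj[OF kvs_Obj that]])
  have "?L \<longleftrightarrow> (\<forall>W\<in>Obj (Vect k).
      Comp (Vect k) (fob P W) (Hom (Vect k) ?F W) (fob X W) (f W) (delta_arr k I W) =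
      Comp (Vect k) (fob P W) (Hom (Vect k) ?F W) (fob X W) (g W) (delta_arr k I W))"
    by (auto simp: restrict_def fun_eq_iff)
  also have "\<dots> \<longleftrightarrow> (\<forall>W\<in>Obj (Vect k). \<forall>x\<in>carrier (copower_vs I (?H W)).
      vapp (f W) (vapp (delta_arr k I W) x) = vapp (g W) (vapp (delta_arr k I W) x))" (is "_ \<longleftrightarrow> ?M")
    using PO by (auto simp: Vect_def vfun_eq_iff P)
  finally have LM: "?L \<longleftrightarrow> ?M" .
  show ?thesis
    unfolding LM
  proof
    assume M: ?M
    show ?R
    proof
      fix i assume i: "i \<in> I"
      note inj = copower_inj_closed[OF module_Hom_Vect[OF kvs_Obj kvs_Obj] Idn_Vect_closed, of I i]
      show "vapp (far X ?F (kvs k) (coord k I i)) (vapp (f ?F) (Idn (Vect k) ?F)) =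
          vapp (far X ?F (kvs k) (coord k I i)) (vapp (g ?F) (Idn (Vect k) ?F))"
        using bspec[OF bspec[OF M kvs_Obj] inj] fe[OF kvs_Obj coord_Arr[OF I i]] ge[OF kvs_Obj coord_Arr[OF I i]]
        by (simp add: vapp_delta_arr_inj[OF I kvs_Obj i Idn_Vect_closed]
            Comp_Idn_Vect(2)[OF coord_Arr[OF I i] FO kvs_Obj])
    qed
  next
    assume R: ?R
    show ?M
    proof (intro ballI)
      fix W x assume W: "W \<in> Obj (Vect k)" and x: "x \<in> carrier (copower_vs I (?H W))"
      have lin: "(\<lambda>x. vapp (h W) (vapp (delta_arr k I W) x)) \<in> lin_maps k (copower_vs I (?H W)) (fob X W)"
        if h: "h \<in> nat_trans (Vect k) (Vect k) (Yo k ?F) X" for h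
      proof -
        have "h W \<in> Arr (Vect k) (Hom (Vect k) ?F W) (fob X W)"
          using h W by (simp add: nat_trans_def)
        then show ?thesis
          by (rule lin_maps_comp[OF lin_maps_Arr_Vect[OF delta_arr_Arr[OF I W] PO[OF W]]
                lin_maps_Arr_Vect[OF _ Hom_Vect_Obj[OF FO W]]])
      qed
      have mX: "module k (fob X W)"
        using vect_functor_fob[OF X W] by (simp add: Obj_Vect)
      show "vapp (f W) (vapp (delta_arr k I W) x) = vapp (g W) (vapp (delta_arr k I W) x)"
      proof (rule lin_maps_copower_eqI[OF module_Hom_Vect[OF kvs_Obj W] I mX lin[OF f] lin[OF g] _ x])
        fix i u assume i: "i \<in> I" and u: "u \<in> carrier (?H W)"
        note c = coord_Arr[OF I i]
        note uc = Comp_Vect_closed[OF c u FO kvs_Obj]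
        show "vapp (f W) (vapp (delta_arr k I W) (copower_inj I (?H W) i u)) =
            vapp (g W) (vapp (delta_arr k I W) (copower_inj I (?H W) i u))"
          using R i
          by (simp add: vapp_delta_arr_inj[OF I W i u] fe[OF W uc] ge[OF W uc]
              vect_functor_Comp[OF X FO kvs_Obj W c u, symmetric] fc gc)
      qed
    qed
  qed
qed

text \<open>For w and w' with equal coordinates, \<open>delta_arr\<close> is cancelled from the
  arrows that Yoneda assigns to them; conversely, two arrows are compared through their values at
  the identity.\<close>

lemma delta_epi_iff:
  assumes S: "\<And>X. X \<in> S \<Longrightarrow> vect_functor k X"
  shows "delta_epi k S \<longleftrightarrow> (\<forall>X\<in>S. unique_gluing k X)"
proof
  assume epi: "delta_epi k S"
  show "\<forall>X\<in>S. unique_gluing k X"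
    unfolding unique_gluing_def
  proof (intro ballI allI impI)
    fix X I w w'
    let ?F = "free_vs k I"
    assume X: "X \<in> S" and I: "small I" and w: "w \<in> carrier (fob X ?F)" "w' \<in> carrier (fob X ?F)"
      and eq: "\<forall>i\<in>I. vapp (far X ?F (kvs k) (coord k I i)) w =
        vapp (far X ?F (kvs k) (coord k I i)) w'"
    note FO = free_Obj[OF I]
    have ev: "vapp (yoneda_arr k X ?F v ?F) (Idn (Vect k) ?F) = v" if "v \<in> carrier (fob X ?F)" for v
      using vapp_yoneda_arr[OF FO FO Idn_Vect_closed] vect_functor_Idn[OF S[OF X] FO that] by simp
    note y = yoneda_arr_nat_trans[OF S[OF X] FO w(1)] yoneda_arr_nat_trans[OF S[OF X] FO w(2)]
    have "yoneda_arr k X ?F w = yoneda_arr k X ?F w'"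
      using epi I X y Comp_delta_arr_eq_iff[OF I S[OF X] y] eq w
      unfolding delta_epi_def epi_in_def by (simp add: ev del: functor_cat_simps(4))
    then show "w = w'"
      using ev w by metis
  qed
next
  assume glue: "\<forall>X\<in>S. unique_gluing k X"
  show "delta_epi k S"
    unfolding delta_epi_def epi_in_def
  proof (intro allI impI conjI ballI)
    fix I :: "'u set" assume I: "small I"
    let ?F = "free_vs k I"
    note FO = free_Obj[OF I]
    show "delta_arr k I \<in> Arr (FunVect k) (copower_functor I (Yo k (kvs k))) (Yo k ?F)"
      using delta_arr_nat_trans[OF I] by simp
    fix X f g
    assume X: "X \<in> S" and "f \<in> Arr (FunVect k) (Yo k ?F) X" "g \<in> Arr (FunVect k) (Yo k ?F) X"
      and eq: "Comp (FunVect k) (copower_functor I (Yo k (kvs k))) (Yo k ?F) X f (delta_arr k I) =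
        Comp (FunVect k) (copower_functor I (Yo k (kvs k))) (Yo k ?F) X g (delta_arr k I)"
    then have f: "f \<in> nat_trans (Vect k) (Vect k) (Yo k ?F) X"
      and g: "g \<in> nat_trans (Vect k) (Vect k) (Yo k ?F) X"
      by simp_all
    show "f = g"
    proof (rule nat_trans_Yo_eqI[OF f g FO])
      show "vapp (f ?F) (Idn (Vect k) ?F) = vapp (g ?F) (Idn (Vect k) ?F)"
        by (rule unique_gluingD[OF bspec[OF glue X] I nat_trans_Yo_closed[OF f FO] nat_trans_Yo_closed[OF g FO]])
          (use eq in \<open>simp only: Comp_delta_arr_eq_iff[OF I S[OF X] f g]\<close>)
    qed
  qed
qed

end

section \<open>Tensor products\<close>

lemma bilin_mapsD:
  assumes "\<beta> \<in> bilin_maps k V W T"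
  shows "v \<in> carrier V \<Longrightarrow> \<beta> v \<in> lin_maps k W T"
    and "w \<in> carrier W \<Longrightarrow> (\<lambda>v. \<beta> v w) \<in> lin_maps k V T"
    and "v \<in> carrier V \<Longrightarrow> w \<in> carrier W \<Longrightarrow> \<beta> v w \<in> carrier T"
proof -
  show 1: "v \<in> carrier V \<Longrightarrow> \<beta> v \<in> lin_maps k W T"
    using assms by (simp add: bilin_maps_def)
  show "w \<in> carrier W \<Longrightarrow> (\<lambda>v. \<beta> v w) \<in> lin_maps k V T"
    using assms by (simp add: bilin_maps_def)
  show "v \<in> carrier V \<Longrightarrow> w \<in> carrier W \<Longrightarrow> \<beta> v w \<in> carrier T"
    using lin_maps_closed[OF 1] by blast
qed

lemma bilin_mapsI:
  assumes "\<And>v. v \<in> carrier V \<Longrightarrow> \<beta> v \<in> lin_maps k W T"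
    and "\<And>w. w \<in> carrier W \<Longrightarrow> (\<lambda>v. \<beta> v w) \<in> lin_maps k V T"
  shows "\<beta> \<in> bilin_maps k V W T"
  using assms by (simp add: bilin_maps_def)

lemma bilin_maps_comp_lin:
  assumes \<beta>: "\<beta> \<in> bilin_maps k V W T" and f: "f \<in> lin_maps k T U"
  shows "(\<lambda>v w. f (\<beta> v w)) \<in> bilin_maps k V W U"
  using bilin_mapsD(1,2)[OF \<beta>] lin_maps_comp[OF _ f] by (intro bilin_mapsI) auto

lemma is_tensorD:
  assumes "is_tensor k V W T \<beta>"
  shows "T \<in> Obj (Vect k)" and "\<beta> \<in> bilin_maps k V W T"
    and "U \<in> Obj (Vect k) \<Longrightarrow> \<gamma> \<in> bilin_maps k V W U \<Longrightarrow>
      \<exists>!h. h \<in> Arr (Vect k) T U \<and> (\<forall>v\<in>carrier V. \<forall>w\<in>carrier W. vapp h (\<beta> v w) = \<gamma> v w)"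
proof -
  show "T \<in> Obj (Vect k)" "\<beta> \<in> bilin_maps k V W T"
    using assms by (simp_all add: is_tensor_def)
  show "U \<in> Obj (Vect k) \<Longrightarrow> \<gamma> \<in> bilin_maps k V W U \<Longrightarrow>
      \<exists>!h. h \<in> Arr (Vect k) T U \<and> (\<forall>v\<in>carrier V. \<forall>w\<in>carrier W. vapp h (\<beta> v w) = \<gamma> v w)"
    using assms unfolding is_tensor_def by blast
qed

text \<open>Uniqueness in the universal property, applied to the bilinear map that sends (v, w) to
  \<open>f (\<beta> v w)\<close>. Since f and g are plain functions, the comparison runs through
  their graphs, which are arrows.\<close>

lemma is_tensor_eqI:
  assumes T: "is_tensor k V W T \<beta>" and U: "U \<in> Obj (Vect k)"
    and f: "f \<in> lin_maps k T U" and g: "g \<in> lin_maps k T U"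
    and eq: "\<And>v w. v \<in> carrier V \<Longrightarrow> w \<in> carrier W \<Longrightarrow> f (\<beta> v w) = g (\<beta> v w)"
    and x: "x \<in> carrier T"
  shows "f x = g x"
proof -
  have sT: "small (carrier T)"
    using is_tensorD(1)[OF T] by (simp add: Obj_Vect)
  let ?P = "\<lambda>h. h \<in> Arr (Vect k) T U \<and> (\<forall>v\<in>carrier V. \<forall>w\<in>carrier W. vapp h (\<beta> v w) = f (\<beta> v w))"
  have "?P (vfun (carrier T) f)" "?P (vfun (carrier T) g)"
    using Arr_VectI[OF f] Arr_VectI[OF g] eq bilin_mapsD(3)[OF is_tensorD(2)[OF T]] sT by auto
  then have "vfun (carrier T) f = vfun (carrier T) g"
    using is_tensorD(3)[OF T U bilin_maps_comp_lin[OF is_tensorD(2)[OF T] f]] by blast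
  then show ?thesis
    using sT x by (simp add: vfun_eq_iff)
qed

section \<open>Tensor products modelled on copowers over a basis\<close>

context small_field
begin

text \<open>A model of the universal bilinear map with target the copower of W over B: the b-th
  entry at (v, w) is the b-th coordinate of v times w. In particular (b, w) with b in B goes to w
  placed at index b.\<close>

definition basis_tensor :: "'u vs \<Rightarrow> 'u set \<Rightarrow> 'u vs \<Rightarrow> 'u \<Rightarrow> 'u \<Rightarrow> 'u" where
  "basis_tensor V B W v w = vfun B (\<lambda>b. vapp (basis_coords V B v) b \<odot>\<^bsub>W\<^esub> w)"

lemma basis_tensor_bilin:
  assumes V: "V \<in> Obj (Vect k)" and W: "W \<in> Obj (Vect k)" and B: "is_basis k V B"
  shows "basis_tensor V B W \<in> bilin_maps k V W (copower_vs B W)"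
proof -
  have sB: "small B" by (rule basis_small[OF B V])
  have mV: "module k V" and mW: "module k W"
    using V W by (simp_all add: Obj_Vect)
  interpret W: module k W by (rule mW)
  interpret P: module k "copower_vs B W" by (rule module_copower_vs[OF mW sB])
  note c = lin_maps_basis_coords[OF mV B sB]
  note cc = lin_maps_closed[OF c]
  have ck: "vapp (basis_coords V B v) b \<in> carrier k" if "v \<in> carrier V" "b \<in> B" for v b
    using copower_vs_cases(1)[OF cc sB] that by simp
  have val: "vapp (basis_tensor V B W v w) b = vapp (basis_coords V B v) b \<odot>\<^bsub>W\<^esub> w" if "b \<in> B" for v w b
    using sB that by (simp add: basis_tensor_def)
  have closed: "basis_tensor V B W v w \<in> carrier (copower_vs B W)"
    if "v \<in> carrier V" "w \<in> carrier W" for v w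
    unfolding basis_tensor_def using that ck
    by (intro copower_vsI[OF _ copower_vs_cases(2)[OF cc[OF that(1)] sB]]) auto
  note eqI = copower_vs_eqI[where V = W, OF _ _ sB]
  show ?thesis
  proof (rule bilin_mapsI)
    show "basis_tensor V B W v \<in> lin_maps k W (copower_vs B W)" if v: "v \<in> carrier V" for v
    proof (rule lin_mapsI)
      show "basis_tensor V B W v (x \<oplus>\<^bsub>W\<^esub> y) = basis_tensor V B W v x \<oplus>\<^bsub>copower_vs B W\<^esub> basis_tensor V B W v y"
        if "x \<in> carrier W" "y \<in> carrier W" for x y
        by (rule eqI[OF closed P.a_closed[OF closed closed]])
          (use that v in \<open>simp_all add: copower_vs_vapp[OF sB] val ck W.smult_r_distr\<close>)
      show "basis_tensor V B W v (a \<odot>\<^bsub>W\<^esub> x) = a \<odot>\<^bsub>copower_vs B W\<^esub> basis_tensor V B W v x"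
        if "a \<in> carrier k" "x \<in> carrier W" for a x
        by (rule eqI[OF closed P.smult_closed[OF _ closed]])
          (use that v in \<open>simp_all add: copower_vs_vapp[OF sB] val ck m_comm flip: W.smult_assoc1\<close>)
    qed (rule closed[OF v])
    show "(\<lambda>v. basis_tensor V B W v w) \<in> lin_maps k V (copower_vs B W)" if w: "w \<in> carrier W" for w
    proof (rule lin_mapsI)
      show "basis_tensor V B W (x \<oplus>\<^bsub>V\<^esub> y) w = basis_tensor V B W x w \<oplus>\<^bsub>copower_vs B W\<^esub> basis_tensor V B W y w"
        if "x \<in> carrier V" "y \<in> carrier V" for x y
      proof (rule eqI[OF closed P.a_closed[OF closed closed]])
        interpret V: module k V by (rule mV)
        show "x \<oplus>\<^bsub>V\<^esub> y \<in> carrier V" using that by simp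
      qed (use that w in \<open>simp_all add: copower_vs_vapp[OF sB] val ck W.smult_l_distr lin_maps_add[OF c]\<close>)
      show "basis_tensor V B W (a \<odot>\<^bsub>V\<^esub> x) w = a \<odot>\<^bsub>copower_vs B W\<^esub> basis_tensor V B W x w"
        if "a \<in> carrier k" "x \<in> carrier V" for a x
      proof (rule eqI[OF closed P.smult_closed[OF _ closed]])
        interpret V: module k V by (rule mV)
        show "a \<odot>\<^bsub>V\<^esub> x \<in> carrier V" using that by simp
      qed (use that w in \<open>simp_all add: copower_vs_vapp[OF sB] val ck W.smult_assoc1 lin_maps_smult[OF c]\<close>)
    qed (rule closed[OF _ w])
  qed
qed

text \<open>Pairs (b, w) with b in B go to w placed at index b, so a bilinear \<gamma> factors
  through the copairing of the maps \<open>\<gamma> b\<close>. Agreement at general v follows by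
  linearity in v, and uniqueness holds because those images generate the copower.\<close>

lemma is_tensor_basis_tensor:
  assumes V: "V \<in> Obj (Vect k)" and W: "W \<in> Obj (Vect k)" and B: "is_basis k V B"
  shows "is_tensor k V W (copower_vs B W) (basis_tensor V B W)"
  unfolding is_tensor_def
proof (intro conjI ballI)
  have sB: "small B" by (rule basis_small[OF B V])
  have mV: "module k V" and mW: "module k W"
    using V W by (simp_all add: Obj_Vect)
  interpret W: module k W by (rule mW)
  note BV = is_basisD(1)[OF B]
  show P: "copower_vs B W \<in> Obj (Vect k)"
    by (rule copower_vs_Obj[OF sB W])
  show bil: "basis_tensor V B W \<in> bilin_maps k V W (copower_vs B W)"
    by (rule basis_tensor_bilin[OF V W B])
  fix U \<gamma> assume U: "U \<in> Obj (Vect k)" and \<gamma>: "\<gamma> \<in> bilin_maps k V W U"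
  have mU: "module k U" and sP: "small (carrier (copower_vs B W))"
    using U P by (simp_all add: Obj_Vect)
  have inj: "basis_tensor V B W b w = copower_inj B W b w" if "b \<in> B" "w \<in> carrier W" for b w
    using that sB basis_coords_basis[OF mV B sB that(1)]
    by (auto simp: basis_tensor_def copower_inj_def vfun_eq_iff vapp_canonical_vec)
  have a: "\<gamma> b \<in> lin_maps k W U" if "b \<in> B" for b
    using bilin_mapsD(1)[OF \<gamma>] BV that by auto
  let ?h = "copair B W U \<gamma>"
  have h: "?h \<in> lin_maps k (copower_vs B W) U"
    by (rule lin_maps_copair[OF mW sB mU a])
  have "?h (basis_tensor V B W v w) = \<gamma> v w" if v: "v \<in> carrier V" and w: "w \<in> carrier W" for v w
  proof (rule lin_maps_basis_eqI[OF mV mU B lin_maps_comp[OF bilin_mapsD(2)[OF bil w] h] bilin_mapsD(2)[OF \<gamma> w] _ v])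
    show "?h (basis_tensor V B W b w) = \<gamma> b w" if "b \<in> B" for b
      by (simp add: inj[OF that w] copair_inj[OF mW sB mU a that w])
  qed
  then have "\<exists>h. h \<in> Arr (Vect k) (copower_vs B W) U \<and>
      (\<forall>v\<in>carrier V. \<forall>w\<in>carrier W. vapp h (basis_tensor V B W v w) = \<gamma> v w)"
    using Arr_VectI[OF h] bilin_mapsD(3)[OF bil] sP
    by (intro exI[of _ "vfun (carrier (copower_vs B W)) ?h"]) auto
  moreover have "h = h'"
    if h: "h \<in> Arr (Vect k) (copower_vs B W) U" "\<forall>v\<in>carrier V. \<forall>w\<in>carrier W. vapp h (basis_tensor V B W v w) = \<gamma> v w"
      and h': "h' \<in> Arr (Vect k) (copower_vs B W) U" "\<forall>v\<in>carrier V. \<forall>w\<in>carrier W. vapp h' (basis_tensor V B W v w) = \<gamma> v w"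
    for h h'
  proof (rule Arr_Vect_eqI[OF h(1) h'(1) P])
    show "vapp h x = vapp h' x" if "x \<in> carrier (copower_vs B W)" for x
    proof (rule lin_maps_copower_eqI[OF mW sB mU lin_maps_Arr_Vect[OF h(1) P] lin_maps_Arr_Vect[OF h'(1) P] _ that])
      fix b w assume bw: "b \<in> B" "w \<in> carrier W"
      then show "vapp h (copower_inj B W b w) = vapp h' (copower_inj B W b w)"
        using h(2) h'(2) BV by (simp add: inj[symmetric] subsetD)
    qed
  qed
  ultimately show "\<exists>!h. h \<in> Arr (Vect k) (copower_vs B W) U \<and>
      (\<forall>v\<in>carrier V. \<forall>w\<in>carrier W. vapp h (basis_tensor V B W v w) = \<gamma> v w)"
    by blast
qed

text \<open>The copower over a basis is the witness that makes the choice of a tensor product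
  meaningful. From here on only the universal property of the chosen one is available.\<close>

lemma is_tensor_tensor_vs:
  assumes "V \<in> Obj (Vect k)" "W \<in> Obj (Vect k)"
  shows "is_tensor k V W (tensor_vs k V W) (tensor_elt k V W)"
proof -
  obtain B where "is_basis k V B"
    using exists_basis[of V] assms(1) by (auto simp: Obj_Vect)
  then have "\<exists>p. case p of (T, \<beta>) \<Rightarrow> is_tensor k V W T \<beta>"
    using is_tensor_basis_tensor[OF assms] by auto
  then have "case tensor_choice k V W of (T, \<beta>) \<Rightarrow> is_tensor k V W T \<beta>"
    unfolding tensor_choice_def by (rule someI_ex)
  then show ?thesis
    by (simp add: tensor_vs_def tensor_elt_def split: prod.splits)
qed

lemma tensor_vs_Obj:
  "V \<in> Obj (Vect k) \<Longrightarrow> W \<in> Obj (Vect k) \<Longrightarrow> tensor_vs k V W \<in> Obj (Vect k)"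
  by (rule is_tensorD(1)[OF is_tensor_tensor_vs])

lemma tensor_elt_bilin:
  "V \<in> Obj (Vect k) \<Longrightarrow> W \<in> Obj (Vect k) \<Longrightarrow> tensor_elt k V W \<in> bilin_maps k V W (tensor_vs k V W)"
  by (rule is_tensorD(2)[OF is_tensor_tensor_vs])

section \<open>The functors \<open>Fin\<close> and their embedding into copowers\<close>

lemma far_Fin:
  assumes V: "V \<in> Obj (Vect k)" and W: "W \<in> Obj (Vect k)" and W': "W' \<in> Obj (Vect k)"
    and f: "f \<in> Arr (Vect k) W W'"
  shows far_Fin_Arr: "far (Fin k V) W W' f \<in> Arr (Vect k) (tensor_vs k V W) (tensor_vs k V W')"
    and vapp_far_Fin: "v \<in> carrier V \<Longrightarrow> w \<in> carrier W \<Longrightarrow>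
      vapp (far (Fin k V) W W' f) (tensor_elt k V W v w) = tensor_elt k V W' v (vapp f w)"
proof -
  note bil = tensor_elt_bilin[OF V W']
  \<comment> \<open>Bilinearity of this map is what gives the definite description in
    \<open>Fin\<close> its value.\<close>
  have "(\<lambda>v w. tensor_elt k V W' v (vapp f w)) \<in> bilin_maps k V W (tensor_vs k V W')"
    using bilin_mapsD(1,2)[OF bil] lin_maps_comp[OF lin_maps_Arr_Vect[OF f W]] Arr_Vect_closed[OF f W]
    by (intro bilin_mapsI) auto
  from theI'[OF is_tensorD(3)[OF is_tensor_tensor_vs[OF V W] tensor_vs_Obj[OF V W'] this]]
  show "far (Fin k V) W W' f \<in> Arr (Vect k) (tensor_vs k V W) (tensor_vs k V W')"
    "v \<in> carrier V \<Longrightarrow> w \<in> carrier W \<Longrightarrow>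
      vapp (far (Fin k V) W W' f) (tensor_elt k V W v w) = tensor_elt k V W' v (vapp f w)"
    by (simp_all add: Fin_def)
qed

text \<open>Every law compares two linear maps out of a tensor product, so
  \<open>is_tensor_eqI\<close> reduces it to pure tensors. There linearity in the arrow becomes
  linearity of \<open>tensor_elt\<close> in its second argument.\<close>

lemma vect_functor_Fin:
  assumes V: "V \<in> Obj (Vect k)"
  shows "vect_functor k (Fin k V)"
proof (rule vect_functorI)
  have fob: "fob (Fin k V) W = tensor_vs k V W" for W
    by (simp add: Fin_def)
  show "fob (Fin k V) W \<in> Obj (Vect k)" if "W \<in> Obj (Vect k)" for W
    unfolding fob by (rule tensor_vs_Obj[OF V that])
  show "far (Fin k V) W W' f \<in> Arr (Vect k) (fob (Fin k V) W) (fob (Fin k V) W')"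
    if "W \<in> Obj (Vect k)" "W' \<in> Obj (Vect k)" "f \<in> Arr (Vect k) W W'" for W W' f
    unfolding fob by (rule far_Fin_Arr[OF V that])
  have lin: "vapp (far (Fin k V) W W' f) \<in> lin_maps k (tensor_vs k V W) (tensor_vs k V W')"
    if "W \<in> Obj (Vect k)" "W' \<in> Obj (Vect k)" "f \<in> Arr (Vect k) W W'" for W W' f
    by (rule lin_maps_Arr_Vect[OF far_Fin_Arr[OF V that] tensor_vs_Obj[OF V that(1)]])
  show "(\<lambda>f. vapp (far (Fin k V) W W' f) x) \<in> lin_maps k (Hom (Vect k) W W') (fob (Fin k V) W')"
    if W: "W \<in> Obj (Vect k)" and W': "W' \<in> Obj (Vect k)" and "x \<in> carrier (fob (Fin k V) W)" for W W' x
    unfolding fob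
  proof (rule lin_mapsI)
    have x: "x \<in> carrier (tensor_vs k V W)"
      using that(3) by (simp add: fob)
    interpret H: module k "Hom (Vect k) W W'" by (rule module_Hom_Vect[OF W W'])
    have mT: "module k (tensor_vs k V W')"
      using tensor_vs_Obj[OF V W'] by (simp add: Obj_Vect)
    note eqI = is_tensor_eqI[OF is_tensor_tensor_vs[OF V W] tensor_vs_Obj[OF V W'] _ _ _ x]
    note lin = lin[OF W W']
    note fin = vapp_far_Fin[OF V W W']
    note bil = bilin_mapsD(1)[OF tensor_elt_bilin[OF V W']]
    show "vapp (far (Fin k V) W W' f) x \<in> carrier (tensor_vs k V W')" if "f \<in> Arr (Vect k) W W'" for f
      by (rule lin_maps_closed[OF lin[OF that] x])
    show "vapp (far (Fin k V) W W' (f \<oplus>\<^bsub>Hom (Vect k) W W'\<^esub> g)) x =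
        vapp (far (Fin k V) W W' f) x \<oplus>\<^bsub>tensor_vs k V W'\<^esub> vapp (far (Fin k V) W W' g) x"
      if f: "f \<in> Arr (Vect k) W W'" and g: "g \<in> Arr (Vect k) W W'" for f g
      by (rule eqI[OF lin[OF H.a_closed[OF f g]] lin_maps_plus[OF lin[OF f] lin[OF g] mT]])
        (use f g in \<open>simp add: fin[OF f] fin[OF g] fin[OF H.a_closed[OF f g]] vapp_Hom_Vect[OF W]
          lin_maps_add[OF bil] Arr_Vect_closed[OF f W] Arr_Vect_closed[OF g W]\<close>)
    show "vapp (far (Fin k V) W W' (c \<odot>\<^bsub>Hom (Vect k) W W'\<^esub> f)) x =
        c \<odot>\<^bsub>tensor_vs k V W'\<^esub> vapp (far (Fin k V) W W' f) x"
      if c: "c \<in> carrier k" and f: "f \<in> Arr (Vect k) W W'" for c f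
      by (rule eqI[OF lin[OF H.smult_closed[OF c f]] lin_maps_scale[OF lin[OF f] c mT]])
        (use c f in \<open>simp add: fin[OF f] fin[OF H.smult_closed[OF c f]] vapp_Hom_Vect[OF W]
          lin_maps_smult[OF bil] Arr_Vect_closed[OF f W]\<close>)
  qed
  show "vapp (far (Fin k V) W W (Idn (Vect k) W)) x = x"
    if W: "W \<in> Obj (Vect k)" and "x \<in> carrier (fob (Fin k V) W)" for W x
    by (rule is_tensor_eqI[OF is_tensor_tensor_vs[OF V W] tensor_vs_Obj[OF V W]
          lin[OF W W Idn_Vect_closed] lin_maps_id])
      (use that in \<open>simp_all add: vapp_far_Fin[OF V W W Idn_Vect_closed] vapp_Idn_Vect fob\<close>)
  show "vapp (far (Fin k V) U W (Comp (Vect k) U U' W g f)) x =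
      vapp (far (Fin k V) U' W g) (vapp (far (Fin k V) U U' f) x)"
    if U: "U \<in> Obj (Vect k)" and U': "U' \<in> Obj (Vect k)" and W: "W \<in> Obj (Vect k)"
      and f: "f \<in> Arr (Vect k) U U'" and g: "g \<in> Arr (Vect k) U' W"
      and x: "x \<in> carrier (fob (Fin k V) U)" for U U' W f g x
  proof -
    note gf = Comp_Vect_closed[OF f g U U']
    show ?thesis
      by (rule is_tensor_eqI[OF is_tensor_tensor_vs[OF V U] tensor_vs_Obj[OF V W]
            lin[OF U W gf] lin_maps_comp[OF lin[OF U U' f] lin[OF U' W g]]])
        (use x in \<open>simp_all add: vapp_far_Fin[OF V U W gf] vapp_far_Fin[OF V U U' f] vapp_far_Fin[OF V U' W g]
          Arr_Vect_closed[OF f U] vapp_Comp_Vect[OF U] fob\<close>)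
  qed
qed

text \<open>The universal properties of the chosen tensor product and of the basis model give maps
  both ways. One composite fixes pure tensors and is therefore the identity, so h has a left
  inverse. Through h the elements of the chosen tensor product acquire entries.\<close>

lemma tensor_vs_embedding:
  assumes V: "V \<in> Obj (Vect k)" and W: "W \<in> Obj (Vect k)" and B: "is_basis k V B"
  shows "\<exists>h\<in>lin_maps k (tensor_vs k V W) (copower_vs B W). inj_on h (carrier (tensor_vs k V W)) \<and>
    (\<forall>v\<in>carrier V. \<forall>w\<in>carrier W. h (tensor_elt k V W v w) = basis_tensor V B W v w)"
proof -
  note T = is_tensor_tensor_vs[OF V W] and P = is_tensor_basis_tensor[OF V W B]
  note TO = is_tensorD(1)[OF T] and PO = is_tensorD(1)[OF P]
  obtain h where h: "h \<in> Arr (Vect k) (tensor_vs k V W) (copower_vs B W)"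
      "\<forall>v\<in>carrier V. \<forall>w\<in>carrier W. vapp h (tensor_elt k V W v w) = basis_tensor V B W v w"
    using is_tensorD(3)[OF T PO is_tensorD(2)[OF P]] by blast
  obtain g where g: "g \<in> Arr (Vect k) (copower_vs B W) (tensor_vs k V W)"
      "\<forall>v\<in>carrier V. \<forall>w\<in>carrier W. vapp g (basis_tensor V B W v w) = tensor_elt k V W v w"
    using is_tensorD(3)[OF P TO is_tensorD(2)[OF T]] by blast
  have "vapp g (vapp h x) = x" if "x \<in> carrier (tensor_vs k V W)" for x
    by (rule is_tensor_eqI[OF T TO lin_maps_comp[OF lin_maps_Arr_Vect[OF h(1) TO]
            lin_maps_Arr_Vect[OF g(1) PO]] lin_maps_id _ that])
      (use g(2) h(2) in simp)
  then have "inj_on (vapp h) (carrier (tensor_vs k V W))"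
    by (rule inj_on_inverseI)
  then show ?thesis
    using h(2) lin_maps_Arr_Vect[OF h(1) TO] by blast
qed

lemma Fin_SigmaVect:
  assumes V: "V \<in> Obj (Vect k)"
  shows "Fin k V \<in> SigmaVect k"
  unfolding SigmaVect_iff unique_gluing_def
proof (intro conjI allI ballI impI)
  show "vect_functor k (Fin k V)"
    by (rule vect_functor_Fin[OF V])
  fix I w w'
  let ?F = "free_vs k I"
  assume I: "small I" and "w \<in> carrier (fob (Fin k V) ?F)" "w' \<in> carrier (fob (Fin k V) ?F)"
    and eq: "\<forall>i\<in>I. vapp (far (Fin k V) ?F (kvs k) (coord k I i)) w =
      vapp (far (Fin k V) ?F (kvs k) (coord k I i)) w'"
  then have w: "w \<in> carrier (tensor_vs k V ?F)" "w' \<in> carrier (tensor_vs k V ?F)"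
    by (simp_all add: Fin_def)
  note FO = free_Obj[OF I]
  note mF = module_free[OF I]
  have mV: "module k V" using V by (simp add: Obj_Vect)
  obtain B where B: "is_basis k V B"
    using exists_basis[OF mV] by blast
  have sB: "small B" by (rule basis_small[OF B V])
  note TF = is_tensor_tensor_vs[OF V FO]
  obtain h where h: "h \<in> lin_maps k (tensor_vs k V ?F) (copower_vs B ?F)"
      "inj_on h (carrier (tensor_vs k V ?F))"
      "\<forall>v\<in>carrier V. \<forall>w\<in>carrier ?F. h (tensor_elt k V ?F v w) = basis_tensor V B ?F v w"
    using tensor_vs_embedding[OF V FO B] by blast
  obtain h' where h': "h' \<in> lin_maps k (tensor_vs k V (kvs k)) (copower_vs B (kvs k))"
      "\<forall>v\<in>carrier V. \<forall>w\<in>carrier (kvs k). h' (tensor_elt k V (kvs k) v w) = basis_tensor V B (kvs k) v w"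
    using tensor_vs_embedding[OF V kvs_Obj B] by blast
  \<comment> \<open>Compatibility of the two embeddings with a coordinate functional on the second
    factor. On the pure tensor of v and u, both sides have as b-th entry the b-th coordinate of v
    times the i-th coordinate of u.\<close>
  have nat: "h' (vapp (far (Fin k V) ?F (kvs k) (coord k I i)) x) =
      vfun B (\<lambda>b. vapp (coord k I i) (vapp (h x) b))"
    if i: "i \<in> I" and x: "x \<in> carrier (tensor_vs k V ?F)" for i x
  proof (rule is_tensor_eqI[OF TF copower_vs_Obj[OF sB kvs_Obj] _ _ _ x])
    note c = coord_Arr[OF I i]
    note cl = lin_maps_Arr_Vect[OF c FO]
    show "(\<lambda>x. h' (vapp (far (Fin k V) ?F (kvs k) (coord k I i)) x)) \<in>
        lin_maps k (tensor_vs k V ?F) (copower_vs B (kvs k))"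
      by (rule lin_maps_comp[OF lin_maps_Arr_Vect[OF far_Fin_Arr[OF V FO kvs_Obj c] tensor_vs_Obj[OF V FO]] h'(1)])
    show "(\<lambda>x. vfun B (\<lambda>b. vapp (coord k I i) (vapp (h x) b))) \<in>
        lin_maps k (tensor_vs k V ?F) (copower_vs B (kvs k))"
      by (rule lin_maps_comp[OF h(1) lin_maps_copower_map[OF sB cl mF module_kvs]])
    fix v u assume v: "v \<in> carrier V" and u: "u \<in> carrier ?F"
    have ck: "vapp (basis_coords V B v) b \<in> carrier k" if "b \<in> B" for b
      using copower_vs_cases(1)[OF lin_maps_closed[OF lin_maps_basis_coords[OF mV B sB] v] sB that] by simp
    have cu: "vapp (coord k I i) u \<in> carrier (kvs k)"
      by (rule Arr_Vect_closed[OF c FO u])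
    show "h' (vapp (far (Fin k V) ?F (kvs k) (coord k I i)) (tensor_elt k V ?F v u)) =
        vfun B (\<lambda>b. vapp (coord k I i) (vapp (h (tensor_elt k V ?F v u)) b))"
      unfolding vapp_far_Fin[OF V FO kvs_Obj c v u] h'(2)[rule_format, OF v cu] h(3)[rule_format, OF v u]
      unfolding basis_tensor_def
      by (rule vfun_eqI[OF sB]) (use sB ck u lin_maps_smult[OF cl] in simp)
  qed
  have hB: "vapp (h x) b \<in> carrier ?F" if "x \<in> carrier (tensor_vs k V ?F)" "b \<in> B" for x b
    by (rule copower_vs_cases(1)[OF lin_maps_closed[OF h(1) that(1)] sB that(2)])
  \<comment> \<open>Seen through h, w is a matrix with entries indexed by b and i. The i-th
    coordinate functional supplies the entries with that i, and all of them together determine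
    w.\<close>
  have "vapp (h w) b = vapp (h w') b" if b: "b \<in> B" for b
  proof (rule copower_vs_eqI[OF hB[OF w(1) b] hB[OF w(2) b] I])
    fix i assume i: "i \<in> I"
    have "vfun B (\<lambda>b. vapp (coord k I i) (vapp (h w) b)) = vfun B (\<lambda>b. vapp (coord k I i) (vapp (h w') b))"
      using nat[OF i w(1)] nat[OF i w(2)] eq i by simp
    then show "vapp (vapp (h w) b) i = vapp (vapp (h w') b) i"
      using b sB hB w by (simp add: vfun_eq_iff vapp_coord[OF I])
  qed
  then have "h w = h w'"
    by (rule copower_vs_eqI[OF lin_maps_closed[OF h(1) w(1)] lin_maps_closed[OF h(1) w(2)] sB])
  then show "w = w'"
    using h(2) w by (simp add: inj_on_eq_iff)
qed

section \<open>Maximality with respect to the epimorphism condition\<close>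

lemma SigmaVect_largest_delta_epi:
  "largest_full_subcat (FunVect k)
    (\<lambda>S. (\<forall>V\<in>Obj (Vect k). Yo k V \<in> S) \<and> (\<forall>V\<in>Obj (Vect k). Fin k V \<in> S) \<and> delta_epi k S)
    (SigmaVect k)"
  unfolding largest_full_subcat_def
proof (intro conjI allI impI ballI)
  show "SigmaVect k \<subseteq> Obj (FunVect k)"
    by (auto simp: SigmaVect_iff)
  show "delta_epi k (SigmaVect k)"
    by (subst delta_epi_iff) (auto simp: SigmaVect_iff)
  show "V \<in> Obj (Vect k) \<Longrightarrow> Yo k V \<in> SigmaVect k" "V \<in> Obj (Vect k) \<Longrightarrow> Fin k V \<in> SigmaVect k" for V
    by (rule Yo_SigmaVect Fin_SigmaVect, assumption)+
  fix S assume "S \<subseteq> Obj (FunVect k) \<and> (\<forall>V\<in>Obj (Vect k). Yo k V \<in> S) \<and>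
    (\<forall>V\<in>Obj (Vect k). Fin k V \<in> S) \<and> delta_epi k S"
  then have "\<And>X. X \<in> S \<Longrightarrow> vect_functor k X" "delta_epi k S"
    by auto
  then show "S \<subseteq> SigmaVect k"
    using delta_epi_iff[of S] by (auto simp: SigmaVect_iff)
qed

end

section \<open>Equivalences\<close>

lemma full_subcat_simps [simp]:
  "Obj (full_subcat C S) = S" "Hom (full_subcat C S) = Hom C"
  "Idn (full_subcat C S) = Idn C" "Comp (full_subcat C S) = Comp C"
  by (simp_all add: full_subcat_def)

lemma op_cat_simps [simp]:
  "Obj (op_cat C) = Obj C" "Hom (op_cat C) A B = Hom C B A"
  "Idn (op_cat C) = Idn C" "Comp (op_cat C) A B D g f = Comp C D B A f g"
  by (simp_all add: op_cat_def)

text \<open>The inverse G picks preimages of objects and of arrows. Of D just identities and unit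
  laws are asked, because composites in D of arrows in the image of F are controlled by C through
  F.\<close>

lemma fully_faithful_surj_imp_equivalent:
  fixes C :: "('o, 'k, 'a) lcat" and D :: "('p, 'k, 'b) lcat"
  assumes C: "k_category k C" and F: "k_functor k C D F" and ff: "fully_faithful C D F"
    and surj: "fob F ` Obj C = Obj D"
    and D_idn: "\<And>A. A \<in> Obj D \<Longrightarrow> Idn D A \<in> Arr D A A"
    and D_right: "\<And>A B f. A \<in> Obj D \<Longrightarrow> B \<in> Obj D \<Longrightarrow> f \<in> Arr D A B \<Longrightarrow> Comp D A A B f (Idn D A) = f"
    and D_left: "\<And>A B f. A \<in> Obj D \<Longrightarrow> B \<in> Obj D \<Longrightarrow> f \<in> Arr D A B \<Longrightarrow> Comp D A B B (Idn D B) f = f"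
  shows "k_equivalent k C D"
proof -
  interpret C: k_category k C by (rule C)
  have Fo: "fob F A \<in> Obj D" if "A \<in> Obj C" for A
    using F that by (auto simp: k_functor_def)
  have Flin: "far F A B \<in> lin_maps k (Hom C A B) (Hom D (fob F A) (fob F B))"
    if "A \<in> Obj C" "B \<in> Obj C" for A B
    using F that by (simp add: k_functor_def)
  have Fidn: "far F A A (Idn C A) = Idn D (fob F A)" if "A \<in> Obj C" for A
    using F that by (simp add: k_functor_def)
  have Fcomp: "far F A E (Comp C A B E g f) = Comp D (fob F A) (fob F B) (fob F E) (far F B E g) (far F A B f)"
    if "A \<in> Obj C" "B \<in> Obj C" "E \<in> Obj C" "f \<in> Arr C A B" "g \<in> Arr C B E" for A B E f g
    using F that by (simp add: k_functor_def)
  have Farr: "far F A B f \<in> Arr D (fob F A) (fob F B)"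
    if "A \<in> Obj C" "B \<in> Obj C" "f \<in> Arr C A B" for A B f
    by (rule lin_maps_closed[OF Flin[OF that(1,2)] that(3)])
  have Fbij: "bij_betw (far F A B) (Arr C A B) (Arr D (fob F A) (fob F B))"
    if "A \<in> Obj C" "B \<in> Obj C" for A B
    using ff that by (simp add: fully_faithful_def)
  have Finj: "f = f'" if "far F A B f = far F A B f'" "A \<in> Obj C" "B \<in> Obj C" "f \<in> Arr C A B" "f' \<in> Arr C A B"
    for A B f f'
    using Fbij[OF that(2,3)] that by (auto simp: bij_betw_def inj_on_eq_iff)
  have Ccomp: "Comp C A B E g f \<in> Arr C A E"
    if "A \<in> Obj C" "B \<in> Obj C" "E \<in> Obj C" "f \<in> Arr C A B" "g \<in> Arr C B E" for A B E f g
    by (rule lin_maps_closed[OF C.comp_linear_left[OF that(1-4)] that(5)])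
  define lift where "lift A B = inv_into (Arr C A B) (far F A B)" for A B
  have lift: "lift A B g \<in> Arr C A B" "far F A B (lift A B g) = g"
    if "A \<in> Obj C" "B \<in> Obj C" "g \<in> Arr D (fob F A) (fob F B)" for A B g
    using Fbij[OF that(1,2)] that(3) inv_into_into[of g "far F A B" "Arr C A B"]
      f_inv_into_f[of g "far F A B" "Arr C A B"]
    by (auto simp: lift_def bij_betw_def)
  \<comment> \<open>F need not be injective on objects, so \<open>ob (fob F A)\<close> may differ
    from A, whereas F of the chosen preimage is the given object on the nose.\<close>
  define ob where "ob = inv_into (Obj C) (fob F)"
  have ob: "ob A \<in> Obj C" "fob F (ob A) = A" if "A \<in> Obj D" for A
    using that surj inv_into_into[of A "fob F" "Obj C"] f_inv_into_f[of A "fob F" "Obj C"]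
    by (auto simp: ob_def)
  define G :: "('p, 'b, 'o, 'a) lfun" where "G = \<lparr>fob = ob, far = (\<lambda>A B. lift (ob A) (ob B))\<rparr>"
  have G: "fob G = ob" "far G A B = lift (ob A) (ob B)" for A B
    by (simp_all add: G_def)
  have lifto: "lift (ob A) (ob B) g \<in> Arr C (ob A) (ob B)" "far F (ob A) (ob B) (lift (ob A) (ob B) g) = g"
    if "A \<in> Obj D" "B \<in> Obj D" "g \<in> Arr D A B" for A B g
    using lift[of "ob A" "ob B" g] that ob by auto
  \<comment> \<open>Faithfulness as a proof principle: each functor law for G is verified after
    applying F.\<close>
  have lift_eqI: "lift (ob A) (ob B) g = f"
    if "A \<in> Obj D" "B \<in> Obj D" "f \<in> Arr C (ob A) (ob B)" "far F (ob A) (ob B) f = g" for A B f g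
    using Fbij[of "ob A" "ob B"] that ob by (auto simp: lift_def bij_betw_def)
  have "k_functor k D C G"
    unfolding k_functor_def G
  proof (intro conjI ballI)
    show "ob \<in> Obj D \<rightarrow> Obj C"
      using ob by auto
    show "lift (ob A) (ob A) (Idn D A) = Idn C (ob A)" if "A \<in> Obj D" for A
      using that ob by (intro lift_eqI) (auto simp: Fidn C.idn_arr)
    show "lift (ob A) (ob E) (Comp D A B E g f) =
        Comp C (ob A) (ob B) (ob E) (lift (ob B) (ob E) g) (lift (ob A) (ob B) f)"
      if "A \<in> Obj D" "B \<in> Obj D" "E \<in> Obj D" "f \<in> Arr D A B" "g \<in> Arr D B E" for A B E f g
      by (rule lift_eqI[OF that(1,3)])
        (use that in \<open>simp_all add: ob lifto Ccomp Fcomp\<close>)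
    fix A B assume A: "A \<in> Obj D" and B: "B \<in> Obj D"
    note lin = Flin[OF ob(1)[OF A] ob(1)[OF B], unfolded ob(2)[OF A] ob(2)[OF B]]
    interpret H: module k "Hom C (ob A) (ob B)"
      by (rule C.hom_module[OF ob(1)[OF A] ob(1)[OF B]])
    show "lift (ob A) (ob B) \<in> lin_maps k (Hom D A B) (Hom C (ob A) (ob B))"
    proof (rule lin_mapsI)
      show "lift (ob A) (ob B) (f \<oplus>\<^bsub>Hom D A B\<^esub> g) =
          lift (ob A) (ob B) f \<oplus>\<^bsub>Hom C (ob A) (ob B)\<^esub> lift (ob A) (ob B) g"
        if "f \<in> Arr D A B" "g \<in> Arr D A B" for f g
        by (rule lift_eqI[OF A B])
          (use that A B in \<open>simp_all add: lifto lin_maps_add[OF lin]\<close>)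
      show "lift (ob A) (ob B) (c \<odot>\<^bsub>Hom D A B\<^esub> f) = c \<odot>\<^bsub>Hom C (ob A) (ob B)\<^esub> lift (ob A) (ob B) f"
        if "c \<in> carrier k" "f \<in> Arr D A B" for c f
        by (rule lift_eqI[OF A B])
          (use that A B in \<open>simp_all add: lifto lin_maps_smult[OF lin]\<close>)
    qed (rule lifto(1)[OF A B])
  qed
  moreover have "naturally_isomorphic C C id_functor (comp_functor G F)"
    unfolding naturally_isomorphic_def
  proof
    \<comment> \<open>A and \<open>ob (fob F A)\<close> have the same image under F; the unit is the
      arrow between them lying over the identity of that image.\<close>
    define \<eta> where "\<eta> = (\<lambda>A\<in>Obj C. lift A (ob (fob F A)) (Idn D (fob F A)))"
    have \<eta>: "\<eta> A \<in> Arr C A (ob (fob F A))" "far F A (ob (fob F A)) (\<eta> A) = Idn D (fob F A)"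
      if "A \<in> Obj C" for A
      using lift[of A "ob (fob F A)" "Idn D (fob F A)"] that
      by (simp_all add: \<eta>_def Fo ob D_idn)
    show "\<forall>A\<in>Obj C. iso_arr C (fob id_functor A) (fob (comp_functor G F) A) (\<eta> A)"
    proof
      fix A assume A: "A \<in> Obj C"
      let ?B = "ob (fob F A)"
      have B: "?B \<in> Obj C" "fob F ?B = fob F A"
        using ob Fo[OF A] by auto
      define \<theta> where "\<theta> = lift ?B A (Idn D (fob F A))"
      have \<theta>: "\<theta> \<in> Arr C ?B A" "far F ?B A \<theta> = Idn D (fob F A)"
        using lift[of ?B A "Idn D (fob F A)"] A B by (simp_all add: \<theta>_def Fo D_idn)
      have "Comp C A ?B A \<theta> (\<eta> A) = Idn C A"
        by (rule Finj[OF _ A A Ccomp C.idn_arr])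
          (use A B \<eta>[OF A] \<theta> in \<open>simp_all add: Fcomp Fidn Fo D_idn D_left\<close>)
      moreover have "Comp C ?B A ?B (\<eta> A) \<theta> = Idn C ?B"
        by (rule Finj[OF _ B(1) B(1) Ccomp C.idn_arr])
          (use A B \<eta>[OF A] \<theta> in \<open>simp_all add: Fcomp Fidn Fo D_idn D_left\<close>)
      ultimately show "iso_arr C (fob id_functor A) (fob (comp_functor G F) A) (\<eta> A)"
        using \<eta>[OF A] \<theta>(1) by (auto simp: iso_arr_def id_functor_def comp_functor_def G)
    qed
    show "\<eta> \<in> nat_trans C C id_functor (comp_functor G F)"
      unfolding nat_trans_def id_functor_def comp_functor_def G mem_Collect_eq lfun.simps
    proof (intro conjI ballI)
      show "\<eta> \<in> extensional (Obj C)"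
        by (simp add: \<eta>_def)
      show "\<eta> A \<in> Arr C A (ob (fob F A))" if "A \<in> Obj C" for A
        by (rule \<eta>(1)[OF that])
      fix A B f assume A: "A \<in> Obj C" and B: "B \<in> Obj C" and f: "f \<in> Arr C A B"
      let ?l = "lift (ob (fob F A)) (ob (fob F B)) (far F A B f)"
      note oA = ob[OF Fo[OF A]] and oB = ob[OF Fo[OF B]]
      note Ff = Farr[OF A B f]
      note l = lifto[OF Fo[OF A] Fo[OF B] Ff]
      show "Comp C A B (ob (fob F B)) (\<eta> B) f = Comp C A (ob (fob F A)) (ob (fob F B)) ?l (\<eta> A)"
        by (rule Finj[OF _ A oB(1) Ccomp[OF A B oB(1) f \<eta>(1)[OF B]]
              Ccomp[OF A oA(1) oB(1) \<eta>(1)[OF A] l(1)]])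
          (simp add: Fcomp[OF A B oB(1) f \<eta>(1)[OF B]] Fcomp[OF A oA(1) oB(1) \<eta>(1)[OF A] l(1)]
            \<eta>(2)[OF A] \<eta>(2)[OF B] l(2) oA(2) oB(2) D_left[OF Fo[OF A] Fo[OF B] Ff]
            D_right[OF Fo[OF A] Fo[OF B] Ff])
    qed
  qed
  moreover have "naturally_isomorphic D D (comp_functor F G) id_functor"
    unfolding naturally_isomorphic_def
  proof
    \<comment> \<open>F after G is the identity of D, on objects by \<open>ob\<close> and on arrows
      by \<open>lifto\<close>, so the counit consists of identities.\<close>
    show "(\<lambda>A\<in>Obj D. Idn D A) \<in> nat_trans D D (comp_functor F G) id_functor"
      by (auto simp: nat_trans_def id_functor_def comp_functor_def G ob D_idn lifto D_left D_right)
    show "\<forall>A\<in>Obj D. iso_arr D (fob (comp_functor F G) A) (fob id_functor A) ((\<lambda>A\<in>Obj D. Idn D A) A)"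
      by (auto simp: iso_arr_def id_functor_def comp_functor_def G ob D_idn D_left
          intro!: bexI[of _ "Idn D A" for A])
  qed
  ultimately show ?thesis
    unfolding k_equivalent_def using F by blast
qed


section \<open>The restricted Yoneda functor of a dense embedding\<close>

text \<open>\<iota> is defined on the opposite category, so C(\<iota> -, X) is covariant on
  \<open>Vect\<close>: an arrow f from V to W gives an arrow from \<iota> W to \<iota> V, which
  accounts for the swapped indices in \<open>far \<iota> W V f\<close>.\<close>

definition nerve ::
    "('o, 'u, 'a::grothendieck_universe) lcat \<Rightarrow> ('u vs, 'u, 'o, 'a) lfun \<Rightarrow> 'o \<Rightarrow> ('u vs, 'u, ('u, 'a) module, 'a) lfun" where
  "nerve C \<iota> X = \<lparr>fob = (\<lambda>V. Hom C (fob \<iota> V) X),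
    far = (\<lambda>V W f. vfun (Arr C (fob \<iota> V) X) (\<lambda>p. Comp C (fob \<iota> W) (fob \<iota> V) X p (far \<iota> W V f)))\<rparr>"

definition nerve_arr ::
    "'u::grothendieck_universe ring \<Rightarrow> ('o, 'u, 'u) lcat \<Rightarrow> ('u vs, 'u, 'o, 'u) lfun \<Rightarrow> 'o \<Rightarrow> 'o \<Rightarrow> 'u \<Rightarrow> 'u vtrans" where
  "nerve_arr k C \<iota> X Y u =
    (\<lambda>V\<in>Obj (Vect k). vfun (Arr C (fob \<iota> V) X) (\<lambda>p. Comp C (fob \<iota> V) X Y u p))"

locale dense_embedding = small_field k + C: k_category k C
  for k :: "'u::grothendieck_universe ring" (structure) and C :: "('o, 'u, 'u) lcat" +
  fixes \<iota> :: "('u vs, 'u, 'o, 'u) lfun"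
  assumes loc_small: "locally_small C" and \<iota>: "k_functor k (op_cat (Vect k)) C \<iota>"
    and A1: "A1 k C \<iota>" and A3: "A3 k C \<iota>"
begin

section \<open>Consequences of density and of (A3)\<close>

lemma Comp_closed:
  "A \<in> Obj C \<Longrightarrow> B \<in> Obj C \<Longrightarrow> E \<in> Obj C \<Longrightarrow> f \<in> Arr C A B \<Longrightarrow> g \<in> Arr C B E \<Longrightarrow>
    Comp C A B E g f \<in> Arr C A E"
  by (rule lin_maps_closed[OF C.comp_linear_left])

lemma fob_\<iota>: "V \<in> Obj (Vect k) \<Longrightarrow> fob \<iota> V \<in> Obj C"
  using \<iota> by (auto simp: k_functor_def)

lemma far_\<iota>_lin:
  "V \<in> Obj (Vect k) \<Longrightarrow> W \<in> Obj (Vect k) \<Longrightarrow>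
    far \<iota> W V \<in> lin_maps k (Hom (Vect k) V W) (Hom C (fob \<iota> W) (fob \<iota> V))"
  using \<iota> by (simp add: k_functor_def)

lemma far_\<iota>_Arr:
  "V \<in> Obj (Vect k) \<Longrightarrow> W \<in> Obj (Vect k) \<Longrightarrow> f \<in> Arr (Vect k) V W \<Longrightarrow>
    far \<iota> W V f \<in> Arr C (fob \<iota> W) (fob \<iota> V)"
  by (rule lin_maps_closed[OF far_\<iota>_lin])

lemma far_\<iota>_Idn: "V \<in> Obj (Vect k) \<Longrightarrow> far \<iota> V V (Idn (Vect k) V) = Idn C (fob \<iota> V)"
  using \<iota> by (simp add: k_functor_def)

lemma far_\<iota>_Comp:
  "U \<in> Obj (Vect k) \<Longrightarrow> V \<in> Obj (Vect k) \<Longrightarrow> W \<in> Obj (Vect k) \<Longrightarrow>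
    f \<in> Arr (Vect k) U V \<Longrightarrow> g \<in> Arr (Vect k) V W \<Longrightarrow>
    far \<iota> W U (Comp (Vect k) U V W g f) =
      Comp C (fob \<iota> W) (fob \<iota> V) (fob \<iota> U) (far \<iota> V U f) (far \<iota> W V g)"
  using \<iota> by (simp add: k_functor_def)

text \<open>Composing u with the canonical cocone gives a cocone with vertex Z, and both u and u'
  mediate it; density makes the mediating arrow unique.\<close>

lemma dense_eqI:
  assumes X: "X \<in> Obj C" and Z: "Z \<in> Obj C" and u: "u \<in> Arr C X Z" "u' \<in> Arr C X Z"
    and eq: "\<And>V f. V \<in> Obj (Vect k) \<Longrightarrow> f \<in> Arr C (fob \<iota> V) X \<Longrightarrow>
      Comp C (fob \<iota> V) X Z u f = Comp C (fob \<iota> V) X Z u' f"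
  shows "u = u'"
proof -
  let ?c = "\<lambda>V f. Comp C (fob \<iota> V) X Z u f"
  have "comma_cocone k C \<iota> X Z ?c"
    unfolding comma_cocone_def
  proof (intro conjI ballI impI)
    show "?c V f \<in> Arr C (fob \<iota> V) Z" if "V \<in> Obj (op_cat (Vect k))" "f \<in> Arr C (fob \<iota> V) X" for V f
      using that X Z u fob_\<iota> by (intro Comp_closed) auto
    fix V f V' f' h
    assume "V \<in> Obj (op_cat (Vect k))" "f \<in> Arr C (fob \<iota> V) X" "V' \<in> Obj (op_cat (Vect k))"
      "f' \<in> Arr C (fob \<iota> V') X" "h \<in> Arr (op_cat (Vect k)) V V'"
      "Comp C (fob \<iota> V) (fob \<iota> V') X f' (far \<iota> V V' h) = f"
    then show "Comp C (fob \<iota> V) (fob \<iota> V') Z (?c V' f') (far \<iota> V V' h) = ?c V f"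
      using C.comp_assoc[of "fob \<iota> V" "fob \<iota> V'" X Z "far \<iota> V V' h" f' u] X Z u(1) fob_\<iota> far_\<iota>_Arr
      by simp
  qed
  then have "\<exists>!v. v \<in> Arr C X Z \<and>
      (\<forall>V\<in>Obj (op_cat (Vect k)). \<forall>f\<in>Arr C (fob \<iota> V) X. Comp C (fob \<iota> V) X Z v f = ?c V f)"
    using A1 X Z unfolding A1_def by blast
  moreover have "\<forall>V\<in>Obj (op_cat (Vect k)). \<forall>f\<in>Arr C (fob \<iota> V) X. Comp C (fob \<iota> V) X Z u' f = ?c V f"
    using eq by simp
  ultimately show ?thesis
    using u by blast
qed

lemma A3D:
  assumes "V \<in> Obj (Vect k)" "is_basis k V B" "X \<in> Obj C"
    "f \<in> Arr C (fob \<iota> V) X" "g \<in> Arr C (fob \<iota> V) X"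
    and "\<And>b. b \<in> B \<Longrightarrow>
      Comp C (fob \<iota> (kvs k)) (fob \<iota> V) X f (far \<iota> (kvs k) V (dual_coord k V B b)) =
      Comp C (fob \<iota> (kvs k)) (fob \<iota> V) X g (far \<iota> (kvs k) V (dual_coord k V B b))"
  shows "f = g"
  using A3[unfolded A3_def, rule_format, OF assms] .

text \<open>Density tests f and g on arrows p from some \<iota> V, and (A3) tests the two composites
  with p along the functionals dual to a basis of V. Composing p with these gives arrows from
  \<iota> k, on which f and g agree.\<close>

lemma separator: "A2 k C \<iota>"
  unfolding A2_def
proof (intro ballI impI)
  fix X Y f g
  assume X: "X \<in> Obj C" and Y: "Y \<in> Obj C" and f: "f \<in> Arr C X Y" and g: "g \<in> Arr C X Y"
    and eq: "\<forall>h\<in>Arr C (fob \<iota> (kvs k)) X.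
      Comp C (fob \<iota> (kvs k)) X Y f h = Comp C (fob \<iota> (kvs k)) X Y g h"
  show "f = g"
  proof (rule dense_eqI[OF X Y f g])
    fix V p assume V: "V \<in> Obj (Vect k)" and p: "p \<in> Arr C (fob \<iota> V) X"
    note VO = fob_\<iota>[OF V] and KO = fob_\<iota>[OF kvs_Obj]
    obtain B where B: "is_basis k V B"
      using exists_basis[of V] V by (auto simp: Obj_Vect)
    have "Comp C (fob \<iota> (kvs k)) (fob \<iota> V) Y (Comp C (fob \<iota> V) X Y f p) (far \<iota> (kvs k) V (dual_coord k V B b)) =
        Comp C (fob \<iota> (kvs k)) (fob \<iota> V) Y (Comp C (fob \<iota> V) X Y g p) (far \<iota> (kvs k) V (dual_coord k V B b))"
      for b
    proof -
      note d = far_\<iota>_Arr[OF V kvs_Obj dual_coord_Arr[OF V B], of b]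
      show ?thesis
        using eq Comp_closed[OF KO VO X d p]
        by (simp add: C.comp_assoc[OF KO VO X Y d p f, symmetric] C.comp_assoc[OF KO VO X Y d p g, symmetric])
    qed
    then show "Comp C (fob \<iota> V) X Y f p = Comp C (fob \<iota> V) X Y g p"
      by (rule A3D[OF V B Y Comp_closed[OF VO X Y p f] Comp_closed[OF VO X Y p g]])
  qed
qed

text \<open>Local smallness enters here: it makes the hom-spaces of C objects of
  \<open>Vect\<close>, so the nerve takes its values there.\<close>

lemma Hom_Obj: "A \<in> Obj C \<Longrightarrow> B \<in> Obj C \<Longrightarrow> Hom C A B \<in> Obj (Vect k)"
  using loc_small by (simp add: Obj_Vect C.hom_module locally_small_def)

section \<open>The nerve on objects and on arrows\<close>

lemma fob_nerve [simp]: "fob (nerve C \<iota> X) V = Hom C (fob \<iota> V) X"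
  by (simp add: nerve_def)

lemma vapp_far_nerve:
  assumes "X \<in> Obj C" "V \<in> Obj (Vect k)" "p \<in> Arr C (fob \<iota> V) X"
  shows "vapp (far (nerve C \<iota> X) V W f) p = Comp C (fob \<iota> W) (fob \<iota> V) X p (far \<iota> W V f)"
  using assms Hom_Obj[OF fob_\<iota>] by (simp add: nerve_def Obj_Vect)

lemma vect_functor_nerve:
  assumes X: "X \<in> Obj C"
  shows "vect_functor k (nerve C \<iota> X)"
proof (rule vect_functorI)
  show "fob (nerve C \<iota> X) V \<in> Obj (Vect k)" if "V \<in> Obj (Vect k)" for V
    using Hom_Obj[OF fob_\<iota>[OF that] X] by simp
  show "far (nerve C \<iota> X) V W f \<in> Arr (Vect k) (fob (nerve C \<iota> X) V) (fob (nerve C \<iota> X) W)"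
    if "V \<in> Obj (Vect k)" "W \<in> Obj (Vect k)" "f \<in> Arr (Vect k) V W" for V W f
    using Arr_VectI[OF C.comp_linear_left[OF fob_\<iota>[OF that(2)] fob_\<iota>[OF that(1)] X far_\<iota>_Arr[OF that]]]
    by (simp add: nerve_def)
  show "(\<lambda>f. vapp (far (nerve C \<iota> X) V W f) p) \<in> lin_maps k (Hom (Vect k) V W) (fob (nerve C \<iota> X) W)"
    if V: "V \<in> Obj (Vect k)" and W: "W \<in> Obj (Vect k)" and p: "p \<in> carrier (fob (nerve C \<iota> X) V)" for V W p
    using lin_maps_comp[OF far_\<iota>_lin[OF V W] C.comp_linear_right[OF fob_\<iota>[OF W] fob_\<iota>[OF V] X, of p]] p
    by (simp add: vapp_far_nerve[OF X V])
  show "vapp (far (nerve C \<iota> X) V V (Idn (Vect k) V)) p = p"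
    if "V \<in> Obj (Vect k)" "p \<in> carrier (fob (nerve C \<iota> X) V)" for V p
    using that X by (simp add: vapp_far_nerve far_\<iota>_Idn C.idn_right fob_\<iota>)
  show "vapp (far (nerve C \<iota> X) U W (Comp (Vect k) U V W g f)) p =
      vapp (far (nerve C \<iota> X) V W g) (vapp (far (nerve C \<iota> X) U V f) p)"
    if U: "U \<in> Obj (Vect k)" and V: "V \<in> Obj (Vect k)" and W: "W \<in> Obj (Vect k)"
      and f: "f \<in> Arr (Vect k) U V" and g: "g \<in> Arr (Vect k) V W"
      and "p \<in> carrier (fob (nerve C \<iota> X) U)" for U V W f g p
  proof -
    have p: "p \<in> Arr C (fob \<iota> U) X" using that(6) by simp
    note f' = far_\<iota>_Arr[OF U V f] and g' = far_\<iota>_Arr[OF V W g]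
    show ?thesis
      by (simp add: vapp_far_nerve[OF X U p] vapp_far_nerve[OF X V Comp_closed[OF fob_\<iota>[OF V] fob_\<iota>[OF U] X f' p]]
          far_\<iota>_Comp[OF U V W f g] C.comp_assoc[OF fob_\<iota>[OF W] fob_\<iota>[OF V] fob_\<iota>[OF U] X g' f' p])
  qed
qed

lemma nerve_SigmaVect:
  assumes X: "X \<in> Obj C"
  shows "nerve C \<iota> X \<in> SigmaVect k"
  unfolding SigmaVect_iff unique_gluing_def
proof (intro conjI allI ballI impI)
  show "vect_functor k (nerve C \<iota> X)"
    by (rule vect_functor_nerve[OF X])
  fix I w w'
  let ?F = "free_vs k I"
  assume I: "small I" and "w \<in> carrier (fob (nerve C \<iota> X) ?F)" "w' \<in> carrier (fob (nerve C \<iota> X) ?F)"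
    and eq: "\<forall>i\<in>I. vapp (far (nerve C \<iota> X) ?F (kvs k) (coord k I i)) w =
      vapp (far (nerve C \<iota> X) ?F (kvs k) (coord k I i)) w'"
  then have w: "w \<in> Arr C (fob \<iota> ?F) X" "w' \<in> Arr C (fob \<iota> ?F) X"
    by simp_all
  have "Comp C (fob \<iota> (kvs k)) (fob \<iota> ?F) X w (far \<iota> (kvs k) ?F (dual_coord k ?F (canonical_vec k I ` I) b)) =
      Comp C (fob \<iota> (kvs k)) (fob \<iota> ?F) X w' (far \<iota> (kvs k) ?F (dual_coord k ?F (canonical_vec k I ` I) b))"
    if "b \<in> canonical_vec k I ` I" for b
    using that eq w by (auto simp: dual_coord_free[OF I] vapp_far_nerve[OF X free_Obj[OF I]])
  then show "w = w'"
    by (rule A3D[OF free_Obj[OF I] is_basis_free[OF I] X w])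
qed

lemma vapp_nerve_arr:
  assumes "X \<in> Obj C" "V \<in> Obj (Vect k)" "p \<in> Arr C (fob \<iota> V) X"
  shows "vapp (nerve_arr k C \<iota> X Y u V) p = Comp C (fob \<iota> V) X Y u p"
  using assms Hom_Obj[OF fob_\<iota>] by (simp add: nerve_arr_def Obj_Vect)

lemma nerve_arr_Arr:
  assumes "X \<in> Obj C" "Y \<in> Obj C" "u \<in> Arr C X Y" "V \<in> Obj (Vect k)"
  shows "nerve_arr k C \<iota> X Y u V \<in> Arr (Vect k) (Hom C (fob \<iota> V) X) (Hom C (fob \<iota> V) Y)"
  using Arr_VectI[OF C.comp_linear_right[OF fob_\<iota>[OF assms(4)] assms(1-3)]] assms(4)
  by (simp add: nerve_arr_def)

lemma nerve_arr_nat_trans: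
  assumes X: "X \<in> Obj C" and Y: "Y \<in> Obj C" and u: "u \<in> Arr C X Y"
  shows "nerve_arr k C \<iota> X Y u \<in> nat_trans (Vect k) (Vect k) (nerve C \<iota> X) (nerve C \<iota> Y)"
proof (subst nat_trans_Vect_iff[OF vect_functor_fob[OF vect_functor_nerve[OF X]]], assumption,
    intro conjI ballI)
  show "nerve_arr k C \<iota> X Y u \<in> extensional (Obj (Vect k))"
    by (simp add: nerve_arr_def)
  show "nerve_arr k C \<iota> X Y u V \<in> Arr (Vect k) (fob (nerve C \<iota> X) V) (fob (nerve C \<iota> Y) V)"
    if "V \<in> Obj (Vect k)" for V
    using nerve_arr_Arr[OF assms that] by simp
  fix V W f p
  assume V: "V \<in> Obj (Vect k)" and W: "W \<in> Obj (Vect k)" and f: "f \<in> Arr (Vect k) V W"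
    and "p \<in> carrier (fob (nerve C \<iota> X) V)"
  then have p: "p \<in> Arr C (fob \<iota> V) X" by simp
  note VO = fob_\<iota>[OF V] and WO = fob_\<iota>[OF W] and f' = far_\<iota>_Arr[OF V W f]
  show "vapp (nerve_arr k C \<iota> X Y u W) (vapp (far (nerve C \<iota> X) V W f) p) =
      vapp (far (nerve C \<iota> Y) V W f) (vapp (nerve_arr k C \<iota> X Y u V) p)"
    by (simp add: vapp_nerve_arr[OF X V p] vapp_far_nerve[OF X V p]
        vapp_nerve_arr[OF X W Comp_closed[OF WO VO X f' p]]
        vapp_far_nerve[OF Y V Comp_closed[OF VO X Y p u]] C.comp_assoc[OF WO VO X Y f' p u])
qed

text \<open>Faithfulness, from the uniqueness half of density: equal components mean equal
  composites with every arrow from some \<iota> V.\<close>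

lemma nerve_arr_inj_on:
  assumes X: "X \<in> Obj C" and Y: "Y \<in> Obj C"
  shows "inj_on (nerve_arr k C \<iota> X Y) (Arr C X Y)"
proof (rule inj_onI)
  fix u u' assume u: "u \<in> Arr C X Y" "u' \<in> Arr C X Y" and eq: "nerve_arr k C \<iota> X Y u = nerve_arr k C \<iota> X Y u'"
  show "u = u'"
  proof (rule dense_eqI[OF X Y u])
    fix V p assume "V \<in> Obj (Vect k)" "p \<in> Arr C (fob \<iota> V) X"
    then show "Comp C (fob \<iota> V) X Y u p = Comp C (fob \<iota> V) X Y u' p"
      using vapp_nerve_arr[OF X, of V p Y u] vapp_nerve_arr[OF X, of V p Y u'] eq by simp
  qed
qed

text \<open>Fullness, from the existence half of density: naturality of \<eta> along h is the
  compatibility that makes the values of \<eta> a cocone on the comma category, and the mediating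
  arrow is a preimage of \<eta>.\<close>

lemma nerve_arr_surj:
  assumes X: "X \<in> Obj C" and Y: "Y \<in> Obj C"
    and \<eta>: "\<eta> \<in> nat_trans (Vect k) (Vect k) (nerve C \<iota> X) (nerve C \<iota> Y)"
  shows "\<eta> \<in> nerve_arr k C \<iota> X Y ` Arr C X Y"
proof -
  have \<eta>V: "\<eta> V \<in> Arr (Vect k) (Hom C (fob \<iota> V) X) (Hom C (fob \<iota> V) Y)" if "V \<in> Obj (Vect k)" for V
    using \<eta> that by (simp add: nat_trans_def)
  have \<eta>p: "vapp (\<eta> V) p \<in> Arr C (fob \<iota> V) Y" if "V \<in> Obj (Vect k)" "p \<in> Arr C (fob \<iota> V) X" for V p
    by (rule Arr_Vect_closed[OF \<eta>V[OF that(1)] Hom_Obj[OF fob_\<iota>[OF that(1)] X] that(2)])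
  have nat: "vapp (\<eta> W) (vapp (far (nerve C \<iota> X) V W f) p) = vapp (far (nerve C \<iota> Y) V W f) (vapp (\<eta> V) p)"
    if "V \<in> Obj (Vect k)" "W \<in> Obj (Vect k)" "f \<in> Arr (Vect k) V W" "p \<in> Arr C (fob \<iota> V) X" for V W f p
    using \<eta> that by (subst (asm) nat_trans_Vect_iff) (simp_all add: Hom_Obj fob_\<iota> X)
  have "comma_cocone k C \<iota> X Y (\<lambda>V p. vapp (\<eta> V) p)"
    unfolding comma_cocone_def op_cat_simps
  proof (intro conjI ballI impI)
    fix V f V' f' h
    assume V: "V \<in> Obj (Vect k)" and f: "f \<in> Arr C (fob \<iota> V) X" and V': "V' \<in> Obj (Vect k)"
      and f': "f' \<in> Arr C (fob \<iota> V') X" and h: "h \<in> Arr (Vect k) V' V"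
      and eq: "Comp C (fob \<iota> V) (fob \<iota> V') X f' (far \<iota> V V' h) = f"
    show "Comp C (fob \<iota> V) (fob \<iota> V') Y (vapp (\<eta> V') f') (far \<iota> V V' h) = vapp (\<eta> V) f"
      using nat[OF V' V h f'] eq
      by (simp add: vapp_far_nerve[OF X V' f'] vapp_far_nerve[OF Y V' \<eta>p[OF V' f']])
  qed (rule \<eta>p)
  then obtain u where u: "u \<in> Arr C X Y"
      "\<forall>V\<in>Obj (op_cat (Vect k)). \<forall>f\<in>Arr C (fob \<iota> V) X. Comp C (fob \<iota> V) X Y u f = vapp (\<eta> V) f"
    using A1 X Y unfolding A1_def by blast
  have "\<eta> = nerve_arr k C \<iota> X Y u"
  proof (rule nat_trans_eqI[OF \<eta> nerve_arr_nat_trans[OF X Y u(1)]])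
    fix V assume V: "V \<in> Obj (Vect k)"
    show "\<eta> V = nerve_arr k C \<iota> X Y u V"
      by (rule Arr_Vect_eqI[OF \<eta>V[OF V] nerve_arr_Arr[OF X Y u(1) V] Hom_Obj[OF fob_\<iota>[OF V] X]])
        (use u(2) V in \<open>simp add: vapp_nerve_arr[OF X V]\<close>)
  qed
  then show ?thesis
    using u(1) by blast
qed

text \<open>Equations between natural transformations are checked on components, where they follow
  from associativity and bilinearity of composition in C; extensionality settles the arguments
  outside \<open>Obj (Vect k)\<close>.\<close>

lemma k_functor_nerve:
  "k_functor k C (full_subcat (FunVect k) (nerve C \<iota> ` Obj C)) \<lparr>fob = nerve C \<iota>, far = nerve_arr k C \<iota>\<rparr>"
  unfolding k_functor_def lfun.simps full_subcat_simps functor_cat_simps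
proof (intro conjI ballI)
  show "nerve C \<iota> \<in> Obj C \<rightarrow> nerve C \<iota> ` Obj C"
    by auto
next
  fix X assume X: "X \<in> Obj C"
  show "nerve_arr k C \<iota> X X (Idn C X) = (\<lambda>V\<in>Obj (Vect k). Idn (Vect k) (fob (nerve C \<iota> X) V))"
    unfolding nerve_arr_def
  proof (rule restrict_ext)
    fix V assume V: "V \<in> Obj (Vect k)"
    have "small (Arr C (fob \<iota> V) X)"
      using Hom_Obj[OF fob_\<iota>[OF V] X] by (simp add: Obj_Vect)
    then show "vfun (Arr C (fob \<iota> V) X) (\<lambda>p. Comp C (fob \<iota> V) X X (Idn C X) p) =
        Idn (Vect k) (fob (nerve C \<iota> X) V)"
      by (simp add: Vect_def vfun_eq_iff C.idn_left[OF fob_\<iota>[OF V] X])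
  qed
next
  fix X Y Z f g
  assume X: "X \<in> Obj C" and Y: "Y \<in> Obj C" and Z: "Z \<in> Obj C" and f: "f \<in> Arr C X Y" and g: "g \<in> Arr C Y Z"
  show "nerve_arr k C \<iota> X Z (Comp C X Y Z g f) =
      (\<lambda>V\<in>Obj (Vect k). Comp (Vect k) (fob (nerve C \<iota> X) V) (fob (nerve C \<iota> Y) V) (fob (nerve C \<iota> Z) V)
        (nerve_arr k C \<iota> Y Z g V) (nerve_arr k C \<iota> X Y f V))"
  proof (rule extensionalityI[where A = "Obj (Vect k)"])
    fix V assume V: "V \<in> Obj (Vect k)"
    note VO = fob_\<iota>[OF V]
    note HX = Hom_Obj[OF VO X] and HY = Hom_Obj[OF VO Y]
    have "nerve_arr k C \<iota> X Z (Comp C X Y Z g f) V =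
        Comp (Vect k) (Hom C (fob \<iota> V) X) (Hom C (fob \<iota> V) Y) (Hom C (fob \<iota> V) Z)
          (nerve_arr k C \<iota> Y Z g V) (nerve_arr k C \<iota> X Y f V)"
      by (rule Arr_Vect_eqI[OF nerve_arr_Arr[OF X Z Comp_closed[OF X Y Z f g] V]
            Comp_Vect_closed[OF nerve_arr_Arr[OF X Y f V] nerve_arr_Arr[OF Y Z g V] HX HY] HX])
        (simp add: vapp_Comp_Vect[OF HX] vapp_nerve_arr[OF X V] vapp_nerve_arr[OF Y V]
          Comp_closed[OF VO X Y _ f] C.comp_assoc[OF VO X Y Z _ f g])
    then show "nerve_arr k C \<iota> X Z (Comp C X Y Z g f) V =
        (\<lambda>V\<in>Obj (Vect k). Comp (Vect k) (fob (nerve C \<iota> X) V) (fob (nerve C \<iota> Y) V) (fob (nerve C \<iota> Z) V)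
          (nerve_arr k C \<iota> Y Z g V) (nerve_arr k C \<iota> X Y f V)) V"
      using V by simp
  qed (simp_all add: nerve_arr_def)
next
  fix X Y assume X: "X \<in> Obj C" and Y: "Y \<in> Obj C"
  interpret XY: module k "Hom C X Y" by (rule C.hom_module[OF X Y])
  let ?H = "Hom (FunVect k) (nerve C \<iota> X) (nerve C \<iota> Y)"
  show "nerve_arr k C \<iota> X Y \<in> lin_maps k (Hom C X Y) ?H"
  proof (rule lin_mapsI)
    show "nerve_arr k C \<iota> X Y u \<in> carrier ?H" if "u \<in> Arr C X Y" for u
      using nerve_arr_nat_trans[OF X Y that] by simp
    show "nerve_arr k C \<iota> X Y (u \<oplus>\<^bsub>Hom C X Y\<^esub> v) = nerve_arr k C \<iota> X Y u \<oplus>\<^bsub>?H\<^esub> nerve_arr k C \<iota> X Y v"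
      if u: "u \<in> Arr C X Y" and v: "v \<in> Arr C X Y" for u v
    proof (rule extensionalityI[where A = "Obj (Vect k)"])
      fix V assume V: "V \<in> Obj (Vect k)"
      note HX = Hom_Obj[OF fob_\<iota>[OF V] X] and HY = Hom_Obj[OF fob_\<iota>[OF V] Y]
      interpret H: module k "Hom (Vect k) (Hom C (fob \<iota> V) X) (Hom C (fob \<iota> V) Y)"
        by (rule module_Hom_Vect[OF HX HY])
      note N = nerve_arr_Arr[OF X Y _ V]
      have "nerve_arr k C \<iota> X Y (u \<oplus>\<^bsub>Hom C X Y\<^esub> v) V = nerve_arr k C \<iota> X Y u V
          \<oplus>\<^bsub>Hom (Vect k) (Hom C (fob \<iota> V) X) (Hom C (fob \<iota> V) Y)\<^esub> nerve_arr k C \<iota> X Y v V"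
        by (rule Arr_Vect_eqI[OF N[OF XY.a_closed[OF u v]] H.a_closed[OF N[OF u] N[OF v]] HX])
          (simp add: vapp_Hom_Vect[OF HX] vapp_nerve_arr[OF X V]
            lin_maps_add[OF C.comp_linear_left[OF fob_\<iota>[OF V] X Y] u v])
      then show "nerve_arr k C \<iota> X Y (u \<oplus>\<^bsub>Hom C X Y\<^esub> v) V =
          (nerve_arr k C \<iota> X Y u \<oplus>\<^bsub>?H\<^esub> nerve_arr k C \<iota> X Y v) V"
        using V by (simp add: functor_cat_def)
    qed (simp_all add: nerve_arr_def functor_cat_def)
    show "nerve_arr k C \<iota> X Y (c \<odot>\<^bsub>Hom C X Y\<^esub> u) = c \<odot>\<^bsub>?H\<^esub> nerve_arr k C \<iota> X Y u"
      if c: "c \<in> carrier k" and u: "u \<in> Arr C X Y" for c u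
    proof (rule extensionalityI[where A = "Obj (Vect k)"])
      fix V assume V: "V \<in> Obj (Vect k)"
      note HX = Hom_Obj[OF fob_\<iota>[OF V] X] and HY = Hom_Obj[OF fob_\<iota>[OF V] Y]
      interpret H: module k "Hom (Vect k) (Hom C (fob \<iota> V) X) (Hom C (fob \<iota> V) Y)"
        by (rule module_Hom_Vect[OF HX HY])
      note N = nerve_arr_Arr[OF X Y _ V]
      have "nerve_arr k C \<iota> X Y (c \<odot>\<^bsub>Hom C X Y\<^esub> u) V =
          c \<odot>\<^bsub>Hom (Vect k) (Hom C (fob \<iota> V) X) (Hom C (fob \<iota> V) Y)\<^esub> nerve_arr k C \<iota> X Y u V"
        by (rule Arr_Vect_eqI[OF N[OF XY.smult_closed[OF c u]] H.smult_closed[OF c N[OF u]] HX])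
          (simp add: vapp_Hom_Vect[OF HX] vapp_nerve_arr[OF X V]
            lin_maps_smult[OF C.comp_linear_left[OF fob_\<iota>[OF V] X Y] c u])
      then show "nerve_arr k C \<iota> X Y (c \<odot>\<^bsub>Hom C X Y\<^esub> u) V = (c \<odot>\<^bsub>?H\<^esub> nerve_arr k C \<iota> X Y u) V"
        using V by (simp add: functor_cat_def)
    qed (simp_all add: nerve_arr_def functor_cat_def)
  qed
qed

text \<open>The target is the full subcategory on the image of the nerve itself, so surjectivity on
  objects holds by construction. Its unit laws come componentwise from \<open>Vect\<close>.\<close>

lemma equivalent_full_subcat:
  "k_equivalent k C (full_subcat (FunVect k) (nerve C \<iota> ` Obj C))" (is "k_equivalent k C ?D")
proof (rule fully_faithful_surj_imp_equivalent[OF C.k_category_axioms k_functor_nerve])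
  show "fully_faithful C ?D \<lparr>fob = nerve C \<iota>, far = nerve_arr k C \<iota>\<rparr>"
    using nerve_arr_nat_trans nerve_arr_inj_on nerve_arr_surj
    by (auto simp: fully_faithful_def bij_betw_def)
  show "fob \<lparr>fob = nerve C \<iota>, far = nerve_arr k C \<iota>\<rparr> ` Obj C = Obj ?D"
    by simp
  have D: "vect_functor k F" if "F \<in> Obj ?D" for F
    using that vect_functor_nerve by auto
  show "Idn ?D F \<in> Arr ?D F F" if "F \<in> Obj ?D" for F
    unfolding full_subcat_simps functor_cat_simps
    by (subst nat_trans_Vect_iff)
      (use vect_functor_fob[OF D[OF that]] vect_functor_closed[OF D[OF that]] in
        \<open>simp_all add: Idn_Vect_closed vapp_Idn_Vect\<close>)
  have nt: "\<eta> V \<in> Arr (Vect k) (fob F V) (fob G V)" "\<eta> \<in> extensional (Obj (Vect k))"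
    if "\<eta> \<in> nat_trans (Vect k) (Vect k) F G" "V \<in> Obj (Vect k)" for \<eta> F G V
    using that by (auto simp: nat_trans_def)
  show "Comp ?D F F G \<eta> (Idn ?D F) = \<eta>" "Comp ?D F G G (Idn ?D G) \<eta> = \<eta>"
    if "F \<in> Obj ?D" "G \<in> Obj ?D" and "\<eta> \<in> Arr ?D F G" for F G \<eta>
  proof -
    have \<eta>: "\<eta> \<in> nat_trans (Vect k) (Vect k) F G"
      using that(3) by simp
    have ext: "\<eta> \<in> extensional (Obj (Vect k))"
      using \<eta> by (simp add: nat_trans_def)
    note C = Comp_Idn_Vect[OF nt(1)[OF \<eta>] vect_functor_fob[OF D[OF that(1)]] vect_functor_fob[OF D[OF that(2)]]]
    show "Comp ?D F F G \<eta> (Idn ?D F) = \<eta>"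
      by (rule extensionalityI[OF _ ext]) (simp_all add: C)
    show "Comp ?D F G G (Idn ?D G) \<eta> = \<eta>"
      by (rule extensionalityI[OF _ ext]) (simp_all add: C)
  qed
qed

end

theorem theorem3p21:
  fixes k :: "'u::grothendieck_universe ring"
  assumes "field k" and "small (carrier k)"
  shows
    "largest_full_subcat (FunVect k)
       (\<lambda>S. A3_star k S \<and> (\<forall>V\<in>Obj (Vect k). Yo k V \<in> S)) (SigmaVect k)
     \<and> (\<forall>(C :: ('o, 'u, 'u) lcat) \<iota>.
          k_additive k C \<and> locally_small C \<and>
          k_functor k (op_cat (Vect k)) C \<iota> \<and> fully_faithful (op_cat (Vect k)) C \<iota> \<and>
          A1 k C \<iota> \<and> A3 k C \<iota>
          \<longrightarrow> A2 k C \<iota> \<and>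
              (\<exists>S\<subseteq>SigmaVect k. k_equivalent k C (full_subcat (FunVect k) S)))
     \<and> (\<forall>V\<in>Obj (Vect k). Fin k V \<in> SigmaVect k)
     \<and> largest_full_subcat (FunVect k)
         (\<lambda>S. (\<forall>V\<in>Obj (Vect k). Yo k V \<in> S) \<and> (\<forall>V\<in>Obj (Vect k). Fin k V \<in> S) \<and> delta_epi k S)
         (SigmaVect k)"
proof (intro conjI allI impI ballI)
  interpret small_field k
    using assms by (simp add: small_field_def small_field_axioms_def)
  show "largest_full_subcat (FunVect k)
      (\<lambda>S. A3_star k S \<and> (\<forall>V\<in>Obj (Vect k). Yo k V \<in> S)) (SigmaVect k)"
    by (rule SigmaVect_largest_A3_star)
  show "Fin k V \<in> SigmaVect k" if "V \<in> Obj (Vect k)" for V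
    by (rule Fin_SigmaVect[OF that])
  show "largest_full_subcat (FunVect k)
      (\<lambda>S. (\<forall>V\<in>Obj (Vect k). Yo k V \<in> S) \<and> (\<forall>V\<in>Obj (Vect k). Fin k V \<in> S) \<and> delta_epi k S)
      (SigmaVect k)"
    by (rule SigmaVect_largest_delta_epi)
  fix C :: "('o, 'u, 'u) lcat" and \<iota>
  assume *: "k_additive k C \<and> locally_small C \<and>
    k_functor k (op_cat (Vect k)) C \<iota> \<and> fully_faithful (op_cat (Vect k)) C \<iota> \<and> A1 k C \<iota> \<and> A3 k C \<iota>"
  interpret dense_embedding k C \<iota>
    using * by (intro dense_embedding.intro dense_embedding_axioms.intro small_field_axioms)
      (auto simp: k_additive_def)
  show "A2 k C \<iota>"
    by (rule separator)
  show "\<exists>S\<subseteq>SigmaVect k. k_equivalent k C (full_subcat (FunVect k) S)"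
    using equivalent_full_subcat nerve_SigmaVect by blast
qed

end
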